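(* Suppose that the reduced Burau representation $\beta_{4,r}$ of $B_4$ is faithful. Then there is an element $A\in\overline{\Gamma_4'}$ that commutes with $\overline{\beta_{4,r}}(\sigma_3)$ and lies outside the image $\overline{\beta_{4,r}}(B_4)$.
   Context: Let $\Lambda=\mathbb{Z}[t,t^{-1}]$. $B_n$ is the braid group with standard generators $\sigma_1,\dots,\sigma_{n-1}$. The unreduced Burau representation $\beta_{n,u}:B_n\to \mathrm{GL}(n,\Lambda)$ sends $\sigma_i$ to the block diagonal matrix $I_{i-1}\oplus\begin{pmatrix}1-t&t\\1&0\end{pmatrix}\oplus I_{n-i-1}$. The reduced Burau representation $\beta_{n,r}:B_n\to\mathrm{GL}(n-1,\Lambda)$ sends $\sigma_i$ to the matrix that agrees with $I_{n-1}$ except in row $i$, whose $(i,i-1)$, $(i,i)$, $(i,i+1)$ entries are $t,\,-t,\,1$ respectively (entries with column index outside $1,\dots,n-1$ are omitted), all other entries of row $i$ being $0$. For a matrix $A$ over $\Lambda$, $\overline{A}$ is obtained by applying $t\mapsto t^{-1}$ to each entry. Let $J_n$ be the $n\times n$ matrix with $1$ on the diagonal, $-t^{-1}$ in every entry above the diagonal and $-t$ in every entry below the diagonal. Let $v_n=(t,t^2,\dots,t^n)$ (row vector) and $\overrightarrow{1_n}=(1,\dots,1)^T$. Define $$\Gamma_n=\{A\in\mathrm{GL}(n,\Lambda): v_nA=v_n,\ A\overrightarrow{1_n}=\overrightarrow{1_n},\ \overline{A}J_nA^T=J_n,\ A|_{t=1}\in S_n\},$$ where $S_n$ is the group of $n\times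 n$ permutation matrices. One has $\beta_{n,u}(B_n)\subset\Gamma_n$. $\Gamma_n'\subset \mathrm{GL}(n-1,\Lambda)$ is the image of $\Gamma_n$ under restriction to the orthogonal complement, with respect to the Hermitian form determined by $J_n$, of the fixed vector. Explicitly, for the action on column vectors, this complement is the free $\Lambda$-module $\{y\in\Lambda^n: v_ny=0\}$ with basis $w_i=t^{1-i}e_i-t^{-i}e_{i+1}$, $1\le i\le n-1$, and $\Gamma_n'$ is the group of matrices, in this basis, of the restrictions of the elements of $\Gamma_n$; in this basis the restriction of $\beta_{n,u}(\sigma_i)$ is $\beta_{n,r}(\sigma_i)$, so $\beta_{n,r}(B_n)\subset\Gamma_n'$. $\overline{\Gamma_n'}$ is the quotient of $\Gamma_n'$ by its center, and $\overline{\beta_{n,r}}:B_n\to\overline{\Gamma_n'}$ is the composition of $\beta_{n,r}$ with the quotient map. *)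

theory Defs
  imports
    "HOL-Library.Poly_Mapping"
    "HOL-Combinatorics.Permutations"
    "HOL-Algebra.Coset"
    "Jordan_Normal_Form.Matrix"
begin

section \<open>Laurent polynomials\<close>

text \<open>The group ring of the infinite cyclic group: finitely supported functions sending an
  exponent of $t$ to its coefficient, with the convolution product.\<close>

type_synonym laurent = "int \<Rightarrow>\<^sub>0 int"

definition tpow :: "int \<Rightarrow> laurent" where
  "tpow k = Poly_Mapping.single k 1"

definition laurent_bar :: "laurent \<Rightarrow> laurent" where
  "laurent_bar = Poly_Mapping.map_key uminus"

definition laurent_at_one :: "laurent \<Rightarrow> int" where
  "laurent_at_one p = (\<Sum>k\<in>Poly_Mapping.keys p. Poly_Mapping.lookup p k)"

definition GL :: "nat \<Rightarrow> laurent mat monoid" where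
  "GL n = units_of (ring_mat TYPE(laurent) n ())"


section \<open>Braid groups\<close>

text \<open>The Artin presentation. The letters \<open>(i, True)\<close> and \<open>(i, False)\<close>
  stand for $\sigma_i$ and its inverse; generators are numbered from 1 to $n-1$.\<close>

type_synonym braid_word = "(nat \<times> bool) list"

definition braid_words :: "nat \<Rightarrow> braid_word set" where
  "braid_words n = lists ({1..<n} \<times> UNIV)"

inductive braid_eq :: "nat \<Rightarrow> braid_word \<Rightarrow> braid_word \<Rightarrow> bool" for n where
  refl: "u \<in> braid_words n \<Longrightarrow> braid_eq n u u"
| sym: "braid_eq n u v \<Longrightarrow> braid_eq n v u"
| trans: "braid_eq n u v \<Longrightarrow> braid_eq n v w \<Longrightarrow> braid_eq n u w"
| append: "braid_eq n u u' \<Longrightarrow> braid_eq n v v' \<Longrightarrow> braid_eq n (u @ v) (u' @ v')"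
| cancel: "i \<in> {1..<n} \<Longrightarrow> braid_eq n [(i, b), (i, \<not> b)] []"
| far: "i \<in> {1..<n} \<Longrightarrow> j \<in> {1..<n} \<Longrightarrow> i + 2 \<le> j \<Longrightarrow>
    braid_eq n [(i, True), (j, True)] [(j, True), (i, True)]"
| braid: "i \<in> {1..<n} \<Longrightarrow> Suc i \<in> {1..<n} \<Longrightarrow>
    braid_eq n [(i, True), (Suc i, True), (i, True)] [(Suc i, True), (i, True), (Suc i, True)]"

definition braid_rel :: "nat \<Rightarrow> (braid_word \<times> braid_word) set" where
  "braid_rel n = {(u, v). braid_eq n u v}"

definition braid_group :: "nat \<Rightarrow> braid_word set monoid" where
  "braid_group n =
    \<lparr>carrier = braid_words n // braid_rel n,
     monoid.mult = (\<lambda>X Y. braid_rel n `` {u @ v | u v. u \<in> X \<and> v \<in> Y}),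
     one = braid_rel n `` {[]}\<rparr>"

definition braid_gen :: "nat \<Rightarrow> nat \<Rightarrow> braid_word set" where
  "braid_gen n i = braid_rel n `` {[(i, True)]}"


section \<open>The reduced Burau representation\<close>

text \<open>Matrix indices start at 0 here, so the row called $i$ in the mathematical text is the one
  with \<open>Suc r = i\<close>, and similarly for columns.\<close>

definition reduced_burau_gen :: "nat \<Rightarrow> nat \<Rightarrow> laurent mat" where
  "reduced_burau_gen n i = mat (n - 1) (n - 1) (\<lambda>(r, c).
     if Suc r = i
     then (if Suc (Suc c) = i then tpow 1
           else if Suc c = i then - tpow 1
           else if c = i then 1
           else 0)
     else (if r = c then 1 else 0))"

primrec reduced_burau_letter :: "nat \<Rightarrow> nat \<times> bool \<Rightarrow> laurent mat" where
  "reduced_burau_letter n (i, b) =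
    (if b then reduced_burau_gen n i else inv\<^bsub>GL (n - 1)\<^esub> (reduced_burau_gen n i))"

primrec reduced_burau_word :: "nat \<Rightarrow> braid_word \<Rightarrow> laurent mat" where
  "reduced_burau_word n [] = \<one>\<^bsub>GL (n - 1)\<^esub>"
| "reduced_burau_word n (l # w) = reduced_burau_letter n l \<otimes>\<^bsub>GL (n - 1)\<^esub> reduced_burau_word n w"

text \<open>Equivalent words have the same value (\<open>reduced_burau_class\<close> below), so
  \<open>the_elem\<close> picks the value common to all words in the class.\<close>

definition reduced_burau :: "nat \<Rightarrow> braid_word set \<Rightarrow> laurent mat" where
  "reduced_burau n X = the_elem (reduced_burau_word n ` X)"


section \<open>The groups $\Gamma_n$ and $\Gamma_n'$\<close>

definition J_mat :: "nat \<Rightarrow> laurent mat" where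
  "J_mat n = mat n n (\<lambda>(r, c). if r = c then 1 else if r < c then - tpow (-1) else - tpow 1)"

definition v_vec :: "nat \<Rightarrow> laurent vec" where
  "v_vec n = vec n (\<lambda>k. tpow (int (Suc k)))"

definition ones_vec :: "nat \<Rightarrow> laurent vec" where
  "ones_vec n = vec n (\<lambda>_. 1)"

definition permutation_mats :: "nat \<Rightarrow> int mat set" where
  "permutation_mats n = {mat n n (\<lambda>(r, c). if r = p c then 1 else 0) | p. p permutes {..<n}}"

definition Gamma :: "nat \<Rightarrow> laurent mat set" where
  "Gamma n = {A \<in> carrier (GL n).
     mat_of_row (v_vec n) * A = mat_of_row (v_vec n) \<and>
     A *\<^sub>v ones_vec n = ones_vec n \<and>
     map_mat laurent_bar A * J_mat n * transpose_mat A = J_mat n \<and>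
     map_mat laurent_at_one A \<in> permutation_mats n}"

text \<open>For $1 \le i \le n-1$ this is $w_i = t^{1-i} e_i - t^{-i} e_{i+1}$; entry \<open>k\<close> is the
  coefficient of $e_{k+1}$.\<close>

definition w_vec :: "nat \<Rightarrow> nat \<Rightarrow> laurent vec" where
  "w_vec n i = vec n (\<lambda>k. if Suc k = i then tpow (1 - int i)
                          else if k = i then - tpow (- int i)
                          else 0)"

definition w_mat :: "nat \<Rightarrow> laurent mat" where
  "w_mat n = mat_of_cols n (map (w_vec n) [1..<n])"

text \<open>\<open>A * w_mat n = w_mat n * B\<close> says that \<open>B\<close> is the matrix, with respect to the basis
  $w_1, \dots, w_{n-1}$, of the restriction of \<open>A\<close> (acting on columns) to the span of the $w_i$.\<close>

definition Gamma' :: "nat \<Rightarrow> laurent mat set" where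
  "Gamma' n = {B \<in> carrier (GL (n - 1)). \<exists>A\<in>Gamma n. A * w_mat n = w_mat n * B}"

definition Gamma'_group :: "nat \<Rightarrow> laurent mat monoid" where
  "Gamma'_group n = (GL (n - 1))\<lparr>carrier := Gamma' n\<rparr>"

definition center :: "('a, 'b) monoid_scheme \<Rightarrow> 'a set" where
  "center G = {z \<in> carrier G. \<forall>x\<in>carrier G. z \<otimes>\<^bsub>G\<^esub> x = x \<otimes>\<^bsub>G\<^esub> z}"

definition Gamma'_bar :: "nat \<Rightarrow> laurent mat set monoid" where
  "Gamma'_bar n = Gamma'_group n Mod center (Gamma'_group n)"

definition reduced_burau_bar :: "nat \<Rightarrow> braid_word set \<Rightarrow> laurent mat set" where
  "reduced_burau_bar n x = center (Gamma'_group n) #>\<^bsub>Gamma'_group n\<^esub> reduced_burau n x"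


section \<open>Well-definedness\<close>

lemma GL_group: "group (GL n)"
proof -
  interpret semiring "ring_mat TYPE(laurent) n ()" by (rule semiring_mat)
  show ?thesis unfolding GL_def by (rule units_group)
qed

lemma GL_mult [simp]: "A \<otimes>\<^bsub>GL n\<^esub> B = A * B"
  and GL_one [simp]: "\<one>\<^bsub>GL n\<^esub> = 1\<^sub>m n"
  by (simp_all add: GL_def units_of_mult units_of_one ring_mat_simps)

lemma GL_carrier: "carrier (GL n) =
    {A \<in> carrier_mat n n. \<exists>B\<in>carrier_mat n n. B * A = 1\<^sub>m n \<and> A * B = 1\<^sub>m n}"
  by (simp add: GL_def units_of_carrier Units_def ring_mat_simps)

lemma tpow_mult: "tpow a * tpow b = tpow (a + b)"
  by (simp add: tpow_def mult_single)

lemma tpow_0: "tpow 0 = 1"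
  by (simp add: tpow_def)

lemma braid_eq_words: "braid_eq n u v \<Longrightarrow> u \<in> braid_words n \<and> v \<in> braid_words n"
  by (induction rule: braid_eq.induct) (auto simp: braid_words_def)

lemma equiv_braid_rel: "equiv (braid_words n) (braid_rel n)"
proof (rule equivI)
  show "braid_rel n \<subseteq> braid_words n \<times> braid_words n"
    using braid_eq_words by (auto simp: braid_rel_def)
  show "refl_on (braid_words n) (braid_rel n)"
    by (auto simp: braid_rel_def refl_on_def intro: braid_eq.refl)
  show "sym (braid_rel n)"
    by (auto simp: braid_rel_def sym_def intro: braid_eq.sym)
  show "trans (braid_rel n)"
    unfolding braid_rel_def trans_def using braid_eq.trans by blast
qed

lemma braid_class_mult:
  assumes "u \<in> braid_words n" "v \<in> braid_words n"
  shows "braid_rel n `` {u} \<otimes>\<^bsub>braid_group n\<^esub> braid_rel n `` {v} = braid_rel n `` {u @ v}"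
proof (intro equalityI subsetI)
  fix x assume "x \<in> braid_rel n `` {u} \<otimes>\<^bsub>braid_group n\<^esub> braid_rel n `` {v}"
  then obtain u' v' where "braid_eq n u u'" "braid_eq n v v'" "braid_eq n (u' @ v') x"
    by (auto simp: braid_group_def braid_rel_def)
  then show "x \<in> braid_rel n `` {u @ v}"
    by (auto simp: braid_rel_def intro: braid_eq.trans[OF braid_eq.append])
next
  fix x assume "x \<in> braid_rel n `` {u @ v}"
  then show "x \<in> braid_rel n `` {u} \<otimes>\<^bsub>braid_group n\<^esub> braid_rel n `` {v}"
    using assms[THEN braid_eq.refl] by (auto simp: braid_group_def braid_rel_def)
qed

lemma braid_words_append: "u @ v \<in> braid_words n \<longleftrightarrow> u \<in> braid_words n \<and> v \<in> braid_words n"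
  by (auto simp: braid_words_def)

lemma braid_word_inverse:
  assumes "u \<in> braid_words n"
  shows "\<exists>v \<in> braid_words n. braid_eq n (v @ u) []"
  using assms
proof (induction u)
  case Nil
  then show ?case by (intro bexI[of _ "[]"]) (auto intro: braid_eq.refl)
next
  case (Cons l u)
  obtain i b where l: "l = (i, b)" by (cases l)
  have mem: "i \<in> {1..<n}" "u \<in> braid_words n"
    using Cons.prems l by (auto simp: braid_words_def)
  from Cons.IH[OF mem(2)] obtain v where v: "v \<in> braid_words n" "braid_eq n (v @ u) []"
    by blast
  have "braid_eq n [(i, \<not> b), (i, b)] []"
    using braid_eq.cancel[of i n "\<not> b"] mem by simp
  then have "braid_eq n ([(i, \<not> b), (i, b)] @ u) ([] @ u)"
    by (rule braid_eq.append) (rule braid_eq.refl[OF mem(2)])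
  then have "braid_eq n (v @ [(i, \<not> b), (i, b)] @ u) (v @ [] @ u)"
    by (rule braid_eq.append[OF braid_eq.refl[OF v(1)]])
  then have "braid_eq n ((v @ [(i, \<not> b)]) @ (l # u)) []"
    using v(2) l by (auto intro: braid_eq.trans)
  moreover have "v @ [(i, \<not> b)] \<in> braid_words n"
    using v(1) mem by (auto simp: braid_words_def)
  ultimately show ?case by blast
qed

lemma braid_group_carrierE:
  assumes "X \<in> carrier (braid_group n)"
  obtains u where "u \<in> braid_words n" "X = braid_rel n `` {u}"
  using assms by (auto simp: braid_group_def elim!: quotientE)

lemma braid_class_carrier:
  "u \<in> braid_words n \<Longrightarrow> braid_rel n `` {u} \<in> carrier (braid_group n)"
  by (auto simp: braid_group_def intro: quotientI)

lemma braid_group_one: "\<one>\<^bsub>braid_group n\<^esub> = braid_rel n `` {[]}"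
  by (simp add: braid_group_def)

lemma braid_group_group: "group (braid_group n)"
proof (rule groupI)
  have nil: "[] \<in> braid_words n" by (simp add: braid_words_def)
  show "\<one>\<^bsub>braid_group n\<^esub> \<in> carrier (braid_group n)"
    by (simp add: braid_group_one braid_class_carrier nil)
  fix X assume X: "X \<in> carrier (braid_group n)"
  then obtain u where u: "u \<in> braid_words n" "X = braid_rel n `` {u}"
    by (rule braid_group_carrierE)
  show "\<one>\<^bsub>braid_group n\<^esub> \<otimes>\<^bsub>braid_group n\<^esub> X = X"
    using u nil by (simp add: braid_group_one braid_class_mult)
  obtain v where v: "v \<in> braid_words n" "braid_eq n (v @ u) []"
    using braid_word_inverse[OF u(1)] by blast
  have "braid_rel n `` {v} \<otimes>\<^bsub>braid_group n\<^esub> X = \<one>\<^bsub>braid_group n\<^esub>"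
    using v u by (simp add: braid_group_one braid_class_mult)
      (rule equiv_class_eq[OF equiv_braid_rel], simp add: braid_rel_def)
  then show "\<exists>Y\<in>carrier (braid_group n). Y \<otimes>\<^bsub>braid_group n\<^esub> X = \<one>\<^bsub>braid_group n\<^esub>"
    using v(1) by (blast intro: braid_class_carrier)
  fix Y assume Y: "Y \<in> carrier (braid_group n)"
  then obtain v where v: "v \<in> braid_words n" "Y = braid_rel n `` {v}"
    by (rule braid_group_carrierE)
  show "X \<otimes>\<^bsub>braid_group n\<^esub> Y \<in> carrier (braid_group n)"
    using u v by (simp add: braid_class_mult braid_class_carrier braid_words_append)
  fix Z assume Z: "Z \<in> carrier (braid_group n)"
  then obtain w where w: "w \<in> braid_words n" "Z = braid_rel n `` {w}"
    by (rule braid_group_carrierE)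
  show "X \<otimes>\<^bsub>braid_group n\<^esub> Y \<otimes>\<^bsub>braid_group n\<^esub> Z = X \<otimes>\<^bsub>braid_group n\<^esub> (Y \<otimes>\<^bsub>braid_group n\<^esub> Z)"
    using u v w by (simp add: braid_class_mult braid_words_append)
qed

declare One_nat_def [simp del]

lemma reduced_burau_gen_row_op_aux:
  fixes X :: "laurent mat"
  assumes "X \<in> carrier_mat m k" "r < m" "s < k"
    and M: "M = mat m m (\<lambda>(r, c). if Suc r = i
       then (if Suc (Suc c) = i then a else if Suc c = i then b else if c = i then d else 0)
       else (if r = c then 1 else 0))"
  shows "(M * X) $$ (r, s) =
    (if Suc r = i
     then (if r = 0 then 0 else a * X $$ (r - 1, s)) + b * X $$ (r, s)
       + (if Suc r < m then d * X $$ (Suc r, s) else 0)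
     else X $$ (r, s))"
proof -
  have sum: "(M * X) $$ (r, s) = (\<Sum>l<m. M $$ (r, l) * X $$ (l, s))"
    using assms(1-3) M by (simp add: scalar_prod_def lessThan_atLeast0)
  show ?thesis
  proof (cases "Suc r = i")
    case False
    have "(\<Sum>l<m. M $$ (r, l) * X $$ (l, s)) = (\<Sum>l<m. if l = r then X $$ (l, s) else 0)"
      using assms(2) M False by (intro sum.cong) auto
    then show ?thesis using sum False assms(2) by simp
  next
    case True
    have "(\<Sum>l<m. M $$ (r, l) * X $$ (l, s)) =
        (\<Sum>l<m. (if Suc l = r then a * X $$ (l, s) else 0) +
          (if l = r then b * X $$ (l, s) else 0) + (if l = Suc r then d * X $$ (l, s) else 0))"
      using assms(2) M True by (intro sum.cong) auto
    also have "\<dots> = (\<Sum>l<m. if Suc l = r then a * X $$ (l, s) else 0) +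
        b * X $$ (r, s) + (if Suc r < m then d * X $$ (Suc r, s) else 0)"
      using assms(2) by (simp add: sum.distrib)
    also have "(\<Sum>l<m. if Suc l = r then a * X $$ (l, s) else 0) =
        (if r = 0 then 0 else a * X $$ (r - 1, s))"
      using assms(2) by (cases r) auto
    finally show ?thesis using sum True by simp
  qed
qed

lemma reduced_burau_gen_carrier [simp]: "reduced_burau_gen n i \<in> carrier_mat (n - 1) (n - 1)"
  by (simp add: reduced_burau_gen_def)

lemma reduced_burau_gen_mult:
  assumes "X \<in> carrier_mat (n - 1) k" "r < n - 1" "s < k"
  shows "(reduced_burau_gen n i * X) $$ (r, s) =
    (if Suc r = i
     then (if r = 0 then 0 else tpow 1 * X $$ (r - 1, s)) - tpow 1 * X $$ (r, s)
       + (if Suc r < n - 1 then X $$ (Suc r, s) else 0)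
     else X $$ (r, s))"
  using reduced_burau_gen_row_op_aux[OF assms reduced_burau_gen_def] by simp

lemma reduced_burau_gen_GL:
  assumes "i \<in> {1..<n}"
  shows "reduced_burau_gen n i \<in> carrier (GL (n - 1))"
proof -
  let ?m = "n - 1"
  define N where "N = mat ?m ?m (\<lambda>(r, c). if Suc r = i
       then (if Suc (Suc c) = i then 1 else if Suc c = i then - tpow (-1)
             else if c = i then tpow (-1) else 0)
       else (if r = c then 1 else 0))"
  have N: "N \<in> carrier_mat ?m ?m" by (simp add: N_def)
  have t: "tpow 1 * tpow (-1) = 1" "tpow (-1) * tpow 1 = 1"
    by (simp_all add: tpow_mult tpow_0)
  have "reduced_burau_gen n i * N = 1\<^sub>m ?m"
  proof (rule eq_matI)
    fix r s assume "r < dim_row (1\<^sub>m ?m :: laurent mat)" "s < dim_col (1\<^sub>m ?m :: laurent mat)"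
    then have "r < ?m" "s < ?m" by auto
    then show "(reduced_burau_gen n i * N) $$ (r, s) = 1\<^sub>m ?m $$ (r, s)"
      by (subst reduced_burau_gen_mult[OF N]) (auto simp: N_def t)
  qed (simp_all add: N_def reduced_burau_gen_def)
  moreover have "N * reduced_burau_gen n i = 1\<^sub>m ?m"
  proof (rule eq_matI)
    fix r s assume "r < dim_row (1\<^sub>m ?m :: laurent mat)" "s < dim_col (1\<^sub>m ?m :: laurent mat)"
    then have "r < ?m" "s < ?m" by auto
    then show "(N * reduced_burau_gen n i) $$ (r, s) = 1\<^sub>m ?m $$ (r, s)"
      by (subst reduced_burau_gen_row_op_aux[OF reduced_burau_gen_carrier _ _ N_def])
        (auto simp: reduced_burau_gen_def t)
  qed (simp_all add: N_def reduced_burau_gen_def)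
  ultimately show ?thesis using N by (auto simp: GL_carrier)
qed

lemma reduced_burau_gen_far:
  assumes "i + 2 \<le> j"
  shows "reduced_burau_gen n i * reduced_burau_gen n j =
    reduced_burau_gen n j * reduced_burau_gen n i"
proof (rule eq_matI)
  fix r s assume "r < dim_row (reduced_burau_gen n j * reduced_burau_gen n i)"
    "s < dim_col (reduced_burau_gen n j * reduced_burau_gen n i)"
  then have rs: "r < n - 1" "s < n - 1" by (auto simp: reduced_burau_gen_def)
  then show "(reduced_burau_gen n i * reduced_burau_gen n j) $$ (r, s) =
      (reduced_burau_gen n j * reduced_burau_gen n i) $$ (r, s)"
  proof -
    note m = reduced_burau_gen_mult[OF reduced_burau_gen_carrier rs]
    consider "Suc r = i" | "Suc r = j" | "Suc r \<noteq> i" "Suc r \<noteq> j" by blast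
    then show ?thesis
    proof cases
      case 1
      then show ?thesis using assms rs by (simp add: m) (auto simp: reduced_burau_gen_def)
    next
      case 2
      then show ?thesis using assms rs by (simp add: m) (auto simp: reduced_burau_gen_def)
    next
      case 3
      then show ?thesis using rs by (simp add: m) (auto simp: reduced_burau_gen_def)
    qed
  qed
qed (simp_all add: reduced_burau_gen_def)

lemma reduced_burau_gen_entry:
  assumes "r < n - 1" "s < n - 1"
  defines "D \<equiv> \<lambda>k. (1\<^sub>m (n - 1) :: laurent mat) $$ (k, s)"
  shows "reduced_burau_gen n i $$ (r, s) =
    (if Suc r = i
     then (if r = 0 then 0 else tpow 1 * D (r - 1)) - tpow 1 * D r
       + (if Suc r < n - 1 then D (Suc r) else 0)
     else D r)"
  using reduced_burau_gen_mult[OF one_carrier_mat assms(1,2), of i]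
  unfolding right_mult_one_mat[OF reduced_burau_gen_carrier] D_def .

lemma reduced_burau_gen_braid:
  assumes "1 \<le> i" "Suc i < n"
  shows "reduced_burau_gen n i * (reduced_burau_gen n (Suc i) * reduced_burau_gen n i) =
    reduced_burau_gen n (Suc i) * (reduced_burau_gen n i * reduced_burau_gen n (Suc i))"
    (is "?A * (?B * ?A) = ?B * (?A * ?B)")
proof (rule eq_matI)
  fix r s assume "r < dim_row (?B * (?A * ?B))" "s < dim_col (?B * (?A * ?B))"
  then have rs: "r < n - 1" "s < n - 1" by (auto simp: reduced_burau_gen_def)
  have c: "reduced_burau_gen n j * reduced_burau_gen n k \<in> carrier_mat (n - 1) (n - 1)" for j k
    by (auto intro: mult_carrier_mat[OF reduced_burau_gen_carrier reduced_burau_gen_carrier])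
  define D where "D k = (1\<^sub>m (n - 1) :: laurent mat) $$ (k, s)" for k
  note m = reduced_burau_gen_mult[OF reduced_burau_gen_carrier _ rs(2)]
    reduced_burau_gen_mult[OF c _ rs(2)]
    reduced_burau_gen_entry[OF _ rs(2), folded D_def]
  consider "Suc r = i" | "r = i" | "Suc r \<noteq> i" "r \<noteq> i" by blast
  then show "(?A * (?B * ?A)) $$ (r, s) = (?B * (?A * ?B)) $$ (r, s)"
  proof cases
    case 1
    then have i: "i = Suc r" and r1: "Suc r < n - 1" using assms by auto
    show ?thesis unfolding i
      using rs r1 by (cases r; cases "Suc (Suc r) < n - 1") (simp_all add: m algebra_simps)
  next
    case 2
    then obtain q where q: "r = Suc q" "i = Suc q" using assms by (cases i) auto
    show ?thesis unfolding q
      using rs q by (cases q; cases "Suc (Suc q) < n - 1") (simp_all add: m algebra_simps)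
  next
    case 3
    then show ?thesis using rs by (simp add: m)
  qed
qed (simp_all add: reduced_burau_gen_def)

lemma reduced_burau_letter_GL:
  assumes "l \<in> {1..<n} \<times> UNIV"
  shows "reduced_burau_letter n l \<in> carrier (GL (n - 1))"
  using assms by (cases l) (auto simp: reduced_burau_gen_GL group.inv_closed[OF GL_group])

lemma reduced_burau_word_GL:
  assumes "w \<in> braid_words n"
  shows "reduced_burau_word n w \<in> carrier (GL (n - 1))"
  using assms
proof (induction w)
  case Nil
  then show ?case using group.is_monoid[OF GL_group, THEN monoid.one_closed] by simp
next
  case (Cons l w)
  then have "l \<in> {1..<n} \<times> UNIV" "w \<in> braid_words n" by (auto simp: braid_words_def)
  with Cons.IH show ?case
    using monoid.m_closed[OF group.is_monoid[OF GL_group] reduced_burau_letter_GL] by simp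
qed

lemma reduced_burau_word_append:
  assumes "u \<in> braid_words n" "v \<in> braid_words n"
  shows "reduced_burau_word n (u @ v) = reduced_burau_word n u * reduced_burau_word n v"
  using assms(1)
proof (induction u)
  case Nil
  then show ?case
    using reduced_burau_word_GL[OF assms(2)] left_mult_one_mat[of "reduced_burau_word n v"]
    by (auto simp: GL_carrier)
next
  case (Cons l u)
  then have "l \<in> {1..<n} \<times> UNIV" "u \<in> braid_words n" by (auto simp: braid_words_def)
  then show ?case
    using Cons.IH reduced_burau_word_GL[OF assms(2)] reduced_burau_word_GL[of u n]
      reduced_burau_letter_GL[of l n]
    by (auto simp: GL_carrier assoc_mult_mat)
qed

lemma reduced_burau_word_eq:
  assumes "braid_eq n u v"
  shows "reduced_burau_word n u = reduced_burau_word n v"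
  using assms
proof (induction rule: braid_eq.induct)
  case (append u u' v v')
  then show ?case using braid_eq_words by (metis reduced_burau_word_append)
next
  case (cancel i b)
  let ?g = "reduced_burau_gen n i"
  have "?g * inv\<^bsub>GL (n - 1)\<^esub> ?g = 1\<^sub>m (n - 1)" "inv\<^bsub>GL (n - 1)\<^esub> ?g * ?g = 1\<^sub>m (n - 1)"
    using group.r_inv[OF GL_group reduced_burau_gen_GL[OF cancel]]
      group.l_inv[OF GL_group reduced_burau_gen_GL[OF cancel]] by simp_all
  moreover have "inv\<^bsub>GL (n - 1)\<^esub> ?g \<in> carrier_mat (n - 1) (n - 1)"
    using group.inv_closed[OF GL_group reduced_burau_gen_GL[OF cancel]] by (simp add: GL_carrier)
  ultimately show ?case
    by (simp add: right_mult_one_mat[OF reduced_burau_gen_carrier] right_mult_one_mat)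
next
  case (far i j)
  then show ?case
    using reduced_burau_gen_far[of i j n]
    by (simp add: right_mult_one_mat[OF reduced_burau_gen_carrier])
next
  case (braid i)
  then show ?case using reduced_burau_gen_braid[of i n]
    by (simp add: right_mult_one_mat[OF reduced_burau_gen_carrier])
qed simp_all

lemma reduced_burau_class:
  assumes "w \<in> braid_words n"
  shows "reduced_burau n (braid_rel n `` {w}) = reduced_burau_word n w"
proof -
  have "reduced_burau_word n ` (braid_rel n `` {w}) = {reduced_burau_word n w}"
  proof (intro equalityI subsetI)
    fix A assume "A \<in> reduced_burau_word n ` (braid_rel n `` {w})"
    then obtain u where "braid_eq n w u" "A = reduced_burau_word n u"
      by (auto simp: braid_rel_def)
    then show "A \<in> {reduced_burau_word n w}" using reduced_burau_word_eq by simp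
  next
    fix A assume "A \<in> {reduced_burau_word n w}"
    then show "A \<in> reduced_burau_word n ` (braid_rel n `` {w})"
      using braid_eq.refl[OF assms] by (auto simp: braid_rel_def)
  qed
  then show ?thesis by (simp add: reduced_burau_def)
qed

lemma reduced_burau_hom: "reduced_burau n \<in> hom (braid_group n) (GL (n - 1))"
proof (rule homI)
  fix X assume "X \<in> carrier (braid_group n)"
  then obtain u where u: "u \<in> braid_words n" "X = braid_rel n `` {u}"
    by (rule braid_group_carrierE)
  then show "reduced_burau n X \<in> carrier (GL (n - 1))"
    by (simp add: reduced_burau_class reduced_burau_word_GL)
  fix Y assume "Y \<in> carrier (braid_group n)"
  then obtain v where v: "v \<in> braid_words n" "Y = braid_rel n `` {v}"
    by (rule braid_group_carrierE)
  show "reduced_burau n (X \<otimes>\<^bsub>braid_group n\<^esub> Y) =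
      reduced_burau n X \<otimes>\<^bsub>GL (n - 1)\<^esub> reduced_burau n Y"
    using u v by (simp add: braid_class_mult braid_words_append reduced_burau_class
        reduced_burau_word_append)
qed

lemma reduced_burau_braid_gen:
  assumes "i \<in> {1..<n}"
  shows "reduced_burau n (braid_gen n i) = reduced_burau_gen n i"
  using assms by (simp add: braid_gen_def reduced_burau_class braid_words_def
      right_mult_one_mat[OF reduced_burau_gen_carrier])

declare One_nat_def [simp]

end

theory Submission
  imports Defs
begin

text \<open>The Burau module of \<open>B\<^sub>4\<close> is spanned by $w_1, w_2, w_3$. On it $\sigma_3$ multiplies $w_3$ by $-t$ and
fixes a plane that contains $w_1$ and $q_0 = w_1 + (1+t) w_2 + t w_3$. In the basis $w_1, q_0$ of that
plane the invariant Hermitian form is proportional to diag$(1, d)$ with $d = t + t^{-1}$. If $w = a w_1 + b q_0$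
has norm $a \bar a + d b \bar b = 1$, then the unitary reflection in $w$ with eigenvalue $-t$ commutes
with $\sigma_3$, and it lies in \<open>\<Gamma>\<^sub>4'\<close> if $a$ and $b$ take the values $1$ and $0$ at $t = 1$. For $a = 1$, $b = 0$ it
is $\sigma_1$ itself. The element looked for is the reflection with
$a = 2t^2 - 4t + 5 - 4t^{-1} + 2t^{-2}$ and $b = 2t^2 - 4t + 4 - 2t^{-1}$
(\<open>extra_element_Gamma'\<close>, \<open>extra_element_commutes\<close>).

That it is not in the image is seen from a leading coefficient. A central element of \<open>\<Gamma>\<^sub>4'\<close> commutes
with the three reflections $\sigma_i$ and is therefore scalar (\<open>commuting_scalar\<close>). So if the class of the
extra element were in the image, a multiple of it would be the Burau matrix of a braid $x$, this matrix would
commute with that of $\sigma_3$, and by faithfulness $x$ would commute with $\sigma_3$. Then $x$ is a product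
of three known braids and their inverses (\<open>centralizer_sigma3\<close>). On the plane these braids act, up to units,
trivially, as diag$(-t^{-1}, 1)$, and as an involution. In a product that alternates between this involution and
nontrivial powers of the diagonal matrix the terms of highest degree never cancel, so the $w_1$-coordinate of the
image of $w_1$ has leading coefficient $1$ or $-1$ (\<open>centralizer_leading\<close>). For multiples of the extra element
that coefficient is divisible by $4$ (\<open>not_leading_multiple\<close>).

The centralizer of $\sigma_3$ is found from the decomposition of \<open>B\<^sub>4\<close> as a semidirect product of the
group generated by $\sigma_1, \sigma_2$ and the normal subgroup generated by
$p = \sigma_3 \sigma_1^{-1}$ and $q = \sigma_2 p^{-1} \sigma_2^{-1} p$. Modulo the normal subgroup a normal
form with respect to an action on pairs of integers, in which $\sigma_3$ is a transvection, leaves only the expected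
elements (\<open>commutes_sigma3_mod_fiber\<close>). After division by elements that commute with $\sigma_3$ there remains
a word in $p$ and $q$ that is fixed by conjugation with $\sigma_3$, that is, by $p \mapsto p$,
$q \mapsto pq$. Since $p$ and $q$ are free generators (\<open>fiber_normal_form_unique\<close>), comparing normal forms
shows that the word is a product of powers of $p$ and of $q^{-1} p q$, and the latter is conjugate to
$p^{-1}$ by a braid that commutes with $\sigma_3$.\<close>

section \<open>The braid group on four strands as a type\<close>

text \<open>The group is made an instance of \<open>group_add\<close>, the library's class of groups that need not be commutative,
so that the simplifier can reduce words. Hence products of braids are written as sums below, inverses as
negatives, and conjugation by $g$ as $g + x - g$.\<close>

typedef braid4 = "carrier (braid_group 4)"
  using braid_class_carrier[of "[]" 4] by (auto simp: braid_words_def)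

setup_lifting type_definition_braid4

instantiation braid4 :: group_add
begin

lift_definition zero_braid4 :: braid4 is "\<one>\<^bsub>braid_group 4\<^esub>"
  by (rule monoid.one_closed[OF group.is_monoid[OF braid_group_group]])

lift_definition plus_braid4 :: "braid4 \<Rightarrow> braid4 \<Rightarrow> braid4" is "\<lambda>x y. x \<otimes>\<^bsub>braid_group 4\<^esub> y"
  by (rule monoid.m_closed[OF group.is_monoid[OF braid_group_group]])

lift_definition uminus_braid4 :: "braid4 \<Rightarrow> braid4" is "\<lambda>x. inv\<^bsub>braid_group 4\<^esub> x"
  by (rule group.inv_closed[OF braid_group_group])

definition minus_braid4 :: "braid4 \<Rightarrow> braid4 \<Rightarrow> braid4" where
  "minus_braid4 x y = x + - y"

instance
proof
  interpret group "braid_group 4" by (rule braid_group_group)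
  fix x y z :: braid4
  show "x + y + z = x + (y + z)" by transfer (rule m_assoc)
  show "0 + x = x" by transfer (rule l_one)
  show "x + 0 = x" by transfer (rule r_one)
  show "- x + x = 0" by transfer (rule l_inv)
  show "x + - y = x - y" by (simp add: minus_braid4_def)
qed

end

definition braid_sigma :: "nat \<Rightarrow> braid4" where
  "braid_sigma i = Abs_braid4 (braid_gen 4 i)"

definition letter :: "nat \<times> bool \<Rightarrow> braid4" where
  "letter l = (if snd l then braid_sigma (fst l) else - braid_sigma (fst l))"

lemma Abs_word_append:
  assumes "u \<in> braid_words 4" "v \<in> braid_words 4"
  shows "Abs_braid4 (braid_rel 4 `` {u @ v}) = Abs_braid4 (braid_rel 4 `` {u}) + Abs_braid4 (braid_rel 4 `` {v})"
  using assms by (simp add: plus_braid4.abs_eq eq_onp_def braid_class_carrier braid_class_mult)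

lemma Abs_word_Nil: "Abs_braid4 (braid_rel 4 `` {[]}) = 0"
  by (simp add: zero_braid4_def braid_group_one)

lemma Abs_word_eq: "braid_eq 4 u v \<Longrightarrow> Abs_braid4 (braid_rel 4 `` {u}) = Abs_braid4 (braid_rel 4 `` {v})"
  by (rule arg_cong[where f = Abs_braid4], rule equiv_class_eq[OF equiv_braid_rel])
    (simp add: braid_rel_def)

lemma Abs_letter:
  assumes "i \<in> {1..<4}"
  shows "Abs_braid4 (braid_rel 4 `` {[(i, b)]}) = letter (i, b)"
proof (cases b)
  case True
  then show ?thesis by (simp add: letter_def braid_sigma_def braid_gen_def)
next
  case False
  have w: "[(i, c)] \<in> braid_words 4" for c using assms by (auto simp: braid_words_def)
  have "Abs_braid4 (braid_rel 4 `` {[(i, True)]}) + Abs_braid4 (braid_rel 4 `` {[(i, False)]}) = 0"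
    using Abs_word_eq[OF braid_eq.cancel[OF assms, of True]] Abs_word_append[OF w w, of True False]
    by (simp add: Abs_word_Nil)
  from minus_unique[OF this] show ?thesis using False
    by (simp add: letter_def braid_sigma_def braid_gen_def)
qed

lemma Abs_Cons:
  assumes "l # w \<in> braid_words 4"
  shows "Abs_braid4 (braid_rel 4 `` {l # w}) = letter l + Abs_braid4 (braid_rel 4 `` {w})"
proof -
  have "[l] \<in> braid_words 4" "w \<in> braid_words 4" "fst l \<in> {1..<4}"
    using assms by (auto simp: braid_words_def)
  then show ?thesis
    using Abs_word_append[of "[l]" w] Abs_letter[of "fst l" "snd l"] by simp
qed

lemma braid_sigma_far: "braid_sigma 1 + braid_sigma 3 = braid_sigma 3 + braid_sigma 1"
  using Abs_word_eq[OF braid_eq.far[of 1 4 3]]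
  by (simp add: Abs_Cons braid_words_def letter_def Abs_word_Nil)

lemma braid_eq_12: "braid_eq 4 [(1, True), (2, True), (1, True)] [(2, True), (1, True), (2, True)]"
  and braid_eq_23: "braid_eq 4 [(2, True), (3, True), (2, True)] [(3, True), (2, True), (3, True)]"
proof -
  have "Suc 1 = 2" "Suc 2 = 3" by simp_all
  then show "braid_eq 4 [(1, True), (2, True), (1, True)] [(2, True), (1, True), (2, True)]"
    "braid_eq 4 [(2, True), (3, True), (2, True)] [(3, True), (2, True), (3, True)]"
    using braid_eq.braid[of 1 4] braid_eq.braid[of 2 4]
    by (metis atLeastLessThan_iff one_le_numeral le_refl numeral_less_iff semiring_norm(76,78,79,81)
        one_less_numeral_iff)+
qed

lemma braid_sigma_braid12: "braid_sigma 1 + (braid_sigma 2 + braid_sigma 1) = braid_sigma 2 + (braid_sigma 1 + braid_sigma 2)"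
  using Abs_word_eq[OF braid_eq_12]
  by (simp add: Abs_Cons braid_words_def letter_def Abs_word_Nil)

lemma braid_sigma_braid23: "braid_sigma 2 + (braid_sigma 3 + braid_sigma 2) = braid_sigma 3 + (braid_sigma 2 + braid_sigma 3)"
  using Abs_word_eq[OF braid_eq_23]
  by (simp add: Abs_Cons braid_words_def letter_def Abs_word_Nil)

lemma braid4_word:
  obtains w where "w \<in> braid_words 4" "x = Abs_braid4 (braid_rel 4 `` {w})"
  using Rep_braid4[of x] by (metis braid_group_carrierE Rep_braid4_inverse)

lemma braid4_induct [case_names zero pos neg]:
  assumes "P 0"
    and "\<And>i x. i \<in> {1, 2, 3} \<Longrightarrow> P x \<Longrightarrow> P (braid_sigma i + x)"
    and "\<And>i x. i \<in> {1, 2, 3} \<Longrightarrow> P x \<Longrightarrow> P (- braid_sigma i + x)"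
  shows "P x"
proof -
  have "P (Abs_braid4 (braid_rel 4 `` {w}))" if "w \<in> braid_words 4" for w
    using that
  proof (induction w)
    case Nil
    then show ?case using assms(1) by (simp add: Abs_word_Nil)
  next
    case (Cons l w)
    have "w \<in> braid_words 4" "fst l \<in> {1, 2, 3}" using Cons.prems by (auto simp: braid_words_def)
    then show ?case unfolding Abs_Cons[OF Cons.prems]
      using Cons.IH assms(2,3) by (auto simp: letter_def)
  qed
  then show ?thesis using braid4_word[of x] by metis
qed

text \<open>The universal property of the Artin presentation, for actions instead of homomorphisms: permutations of a set
that satisfy the braid relations extend to an action of the group. It supplies all invariants of braids other than
the Burau matrix.\<close>

lemma braid4_action:
  fixes f g :: "nat \<Rightarrow> 'a \<Rightarrow> 'a"
  assumes inverse: "\<And>i z. i \<in> {1, 2, 3} \<Longrightarrow> f i (g i z) = z \<and> g i (f i z) = z"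
    and far: "\<And>z. f 1 (f 3 z) = f 3 (f 1 z)"
    and braid12: "\<And>z. f 1 (f 2 (f 1 z)) = f 2 (f 1 (f 2 z))"
    and braid23: "\<And>z. f 2 (f 3 (f 2 z)) = f 3 (f 2 (f 3 z))"
  obtains F :: "braid4 \<Rightarrow> 'a \<Rightarrow> 'a" where "\<And>x y z. F (x + y) z = F x (F y z)" "\<And>z. F 0 z = z"
    "\<And>i z. i \<in> {1, 2, 3} \<Longrightarrow> F (braid_sigma i) z = f i z" "\<And>i z. i \<in> {1, 2, 3} \<Longrightarrow> F (- braid_sigma i) z = g i z"
proof -
  define ev where "ev = foldr (\<lambda>(i, b). if b then f i else g i)"
  have ev_append: "ev (u @ v) z = ev u (ev v z)" for u v z by (simp add: ev_def)
  have ev_eq: "ev u = ev v" if "braid_eq 4 u v" for u v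
    using that
  proof (induction rule: braid_eq.induct)
    case (append u u' v v')
    then show ?case by (metis ev_append ext)
  next
    case (cancel i b)
    then have "i \<in> {1, 2, 3}" by auto
    then show ?case using inverse by (auto simp: ev_def)
  next
    case (far i j)
    then have "i = 1" "j = 3" by auto
    then show ?case using assms(2) by (auto simp: ev_def)
  next
    case (braid i)
    then consider "i = 1" | "i = 2" by fastforce
    then show ?case
    proof cases
      case 1
      then show ?thesis using braid12 by (simp add: ev_def fun_eq_iff Suc_1[symmetric] del: Suc_1)
    next
      case 2
      then show ?thesis using braid23 by (simp add: ev_def fun_eq_iff)
    qed
  qed simp_all
  define F where "F x = the_elem (ev ` Rep_braid4 x)" for x
  have F: "F (Abs_braid4 (braid_rel 4 `` {w})) = ev w" if w: "w \<in> braid_words 4" for w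
  proof -
    have "ev ` (braid_rel 4 `` {w}) = {ev w}"
    proof (intro equalityI subsetI)
      fix h assume "h \<in> ev ` (braid_rel 4 `` {w})"
      then obtain u where "braid_eq 4 w u" "h = ev u" by (auto simp: braid_rel_def)
      then show "h \<in> {ev w}" using ev_eq by simp
    next
      fix h assume "h \<in> {ev w}"
      moreover have "w \<in> braid_rel 4 `` {w}" using braid_eq.refl[OF w] by (simp add: braid_rel_def)
      ultimately show "h \<in> ev ` (braid_rel 4 `` {w})" by blast
    qed
    then show ?thesis by (simp add: F_def Abs_braid4_inverse braid_class_carrier w)
  qed
  have generated: "F (letter (i, b)) = ev [(i, b)]" if "i \<in> {1, 2, 3}" for i b
  proof -
    have "i \<in> {1..<4}" "[(i, b)] \<in> braid_words 4" using that by (auto simp: braid_words_def)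
    then show ?thesis using F[of "[(i, b)]"] by (simp add: Abs_letter)
  qed
  show ?thesis
  proof (rule that)
    show "F (x + y) z = F x (F y z)" for x y z
    proof -
      obtain u where u: "u \<in> braid_words 4" "x = Abs_braid4 (braid_rel 4 `` {u})" by (rule braid4_word)
      obtain v where v: "v \<in> braid_words 4" "y = Abs_braid4 (braid_rel 4 `` {v})" by (rule braid4_word)
      show ?thesis using u v
        by (simp add: F Abs_word_append[symmetric] braid_words_append ev_append)
    qed
    show "F 0 z = z" for z using F[of "[]"] by (simp add: Abs_word_Nil braid_words_def ev_def)
    show "F (braid_sigma i) z = f i z" if "i \<in> {1, 2, 3}" for i z
      using generated[OF that, of True] by (simp add: letter_def ev_def)
    show "F (- braid_sigma i) z = g i z" if "i \<in> {1, 2, 3}" for i z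
      using generated[OF that, of False] by (simp add: letter_def ev_def)
  qed
qed


section \<open>Conjugation in the braid group\<close>

text \<open>Together with the cancellation rules of the simplifier these equations reduce words freely; to that end the
simplification rule that folds $x + (-y)$ into $x - y$ has to be switched off.\<close>

lemmas group_word = add.assoc minus_add minus_add_cancel add_minus_cancel diff_conv_add_uminus

definition sigma1 :: braid4 where "sigma1 = braid_sigma 1"
definition sigma2 :: braid4 where "sigma2 = braid_sigma 2"
definition sigma3 :: braid4 where "sigma3 = braid_sigma 3"

lemma sigma_commute: "sigma1 + sigma3 = sigma3 + sigma1"
  by (simp only: sigma1_def sigma3_def braid_sigma_far)

lemma sigma121: "sigma1 + (sigma2 + sigma1) = sigma2 + (sigma1 + sigma2)"
  by (simp only: sigma1_def sigma2_def braid_sigma_braid12)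

lemma sigma232: "sigma2 + (sigma3 + sigma2) = sigma3 + (sigma2 + sigma3)"
  by (simp only: sigma2_def sigma3_def braid_sigma_braid23)

definition conjg :: "'a::group_add \<Rightarrow> 'a \<Rightarrow> 'a" where
  "conjg g x = g + x + - g"

lemma conjg_add: "conjg g (x + y) = conjg g x + conjg g y"
  by (simp add: conjg_def group_word del: add_uminus_conv_diff)

lemma conjg_uminus: "conjg g (- x) = - conjg g x"
  by (simp add: conjg_def group_word del: add_uminus_conv_diff)

lemma conjg_zero: "conjg g 0 = 0"
  by (simp add: conjg_def)

lemma conjg_by_zero: "conjg 0 x = x"
  by (simp add: conjg_def)

lemma conjg_conjg: "conjg g (conjg h x) = conjg (g + h) x"
  by (simp add: conjg_def group_word del: add_uminus_conv_diff)

lemma conjg_eq_self_iff: "conjg g x = x \<longleftrightarrow> g + x = x + g"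
proof -
  have "conjg g x = x \<longleftrightarrow> conjg g x + g = x + g" by simp
  also have "conjg g x + g = g + x" by (simp add: conjg_def add.assoc)
  finally show ?thesis .
qed

lemma conjg_move: "g + x = conjg g x + g"
  by (simp add: conjg_def add.assoc)

text \<open>The kernel of the homomorphism from $B_4$ to $B_3$ that sends $\sigma_1, \sigma_2, \sigma_3$ to
$\sigma_1, \sigma_2, \sigma_1$ is free of rank two. These generators of it are chosen such that the
$\sigma_i$ act on them by transvections, with $\sigma_3$ sending $q$ to $pq$.\<close>

definition fib_p :: braid4 where "fib_p = sigma3 + - sigma1"
definition fib_q :: braid4 where "fib_q = conjg sigma2 (- fib_p) + fib_p"

lemma sigma1_fib_p: "sigma1 + fib_p = fib_p + sigma1"
proof -
  have "sigma1 + fib_p = (sigma1 + sigma3) + - sigma1" by (simp only: fib_p_def add.assoc)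
  also have "\<dots> = fib_p + sigma1" by (simp add: sigma_commute fib_p_def add.assoc)
  finally show ?thesis .
qed

lemma sigma3_eq: "sigma3 = fib_p + sigma1"
  by (simp add: fib_p_def add.assoc)

lemma conjg_sigma1_fib_p: "conjg sigma1 fib_p = fib_p"
  by (simp add: conjg_eq_self_iff sigma1_fib_p)

lemma conjg_sigma3_fib_p: "conjg sigma3 fib_p = fib_p"
  by (simp add: conjg_eq_self_iff sigma3_eq sigma1_fib_p add.assoc)

lemma conjg_sigma2_fib_p: "conjg sigma2 fib_p = fib_p + - fib_q"
  by (simp add: fib_q_def conjg_uminus group_word del: add_uminus_conv_diff)

lemma braid_swap_inverse:
  fixes x y :: "'a::group_add"
  assumes "x + (y + x) = y + (x + y)"
  shows "- y + (- x + y) = x + (- y + - x)"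
proof -
  have "(- y + (- x + y)) + (x + y) = - y + (- x + (x + (y + x)))"
    unfolding assms by (simp add: add.assoc)
  also have "\<dots> = (x + (- y + - x)) + (x + y)"
    by (simp add: group_word del: add_uminus_conv_diff)
  finally show ?thesis by (rule add_right_imp_eq)
qed

text \<open>The half twist of the first three strands, the Garside element of the group generated by $\sigma_1$ and
$\sigma_2$.\<close>

definition half_twist :: braid4 where "half_twist = sigma1 + (sigma2 + sigma1)"

lemma sigma1_half_twist: "sigma1 + half_twist = half_twist + sigma2"
proof -
  have "half_twist + sigma2 = sigma1 + (sigma2 + (sigma1 + sigma2))" by (simp only: half_twist_def add.assoc)
  then show ?thesis by (simp only: half_twist_def sigma121)
qed

lemma sigma2_half_twist: "sigma2 + half_twist = half_twist + sigma1"
proof -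
  have "sigma2 + (sigma1 + (sigma2 + sigma1)) = (sigma2 + (sigma1 + sigma2)) + sigma1" by (simp only: add.assoc)
  then show ?thesis by (simp add: half_twist_def sigma121[symmetric])
qed

lemma fib_q_word: "fib_q = half_twist + (- sigma3 + (- sigma2 + - sigma1))"
proof -
  have "fib_q = sigma2 + (sigma1 + ((- sigma3 + (- sigma2 + sigma3)) + - sigma1))"
    by (simp add: fib_q_def fib_p_def conjg_def group_word del: add_uminus_conv_diff)
  also have "\<dots> = (sigma2 + (sigma1 + sigma2)) + (- sigma3 + (- sigma2 + - sigma1))"
    by (simp only: braid_swap_inverse[OF sigma232] add.assoc)
  finally show ?thesis by (simp only: half_twist_def sigma121)
qed

lemma commute_inverse:
  fixes x y :: "'a::group_add"
  assumes "x + y = y + x"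
  shows "- y + x = x + - y"
proof -
  have "- y + x = - y + (x + y) + - y" by (simp add: group_word del: add_uminus_conv_diff)
  also have "\<dots> = x + - y" unfolding assms by simp
  finally show ?thesis .
qed

lemma conjg_sigma2_fib_q: "conjg sigma2 fib_q = fib_q"
proof -
  have "fib_q + sigma2 = half_twist + (- sigma3 + (- sigma2 + (- sigma1 + sigma2)))"
    by (simp only: fib_q_word add.assoc)
  also have "\<dots> = half_twist + ((- sigma3 + sigma1) + (- sigma2 + - sigma1))"
    by (simp only: braid_swap_inverse[OF sigma121] add.assoc)
  also have "\<dots> = (half_twist + sigma1) + (- sigma3 + (- sigma2 + - sigma1))"
    by (simp only: commute_inverse[OF sigma_commute] add.assoc)
  also have "\<dots> = sigma2 + fib_q"
    by (simp only: sigma2_half_twist[symmetric] fib_q_word add.assoc)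
  finally show ?thesis by (simp add: conjg_eq_self_iff)
qed

lemma conjg_sigma1_fib_q: "conjg sigma1 fib_q = fib_q + fib_p"
proof -
  have "fib_q + sigma3 = half_twist + (- sigma3 + (- sigma2 + (- sigma1 + sigma3)))"
    by (simp only: fib_q_word add.assoc)
  also have "\<dots> = half_twist + ((- sigma3 + (- sigma2 + sigma3)) + - sigma1)"
    by (simp only: commute_inverse[OF sigma_commute[symmetric]] add.assoc)
  also have "\<dots> = (half_twist + sigma2) + (- sigma3 + (- sigma2 + - sigma1))"
    by (simp only: braid_swap_inverse[OF sigma232] add.assoc)
  also have "\<dots> = sigma1 + fib_q"
    by (simp only: sigma1_half_twist[symmetric] fib_q_word add.assoc)
  finally have "sigma1 + fib_q = fib_q + fib_p + sigma1" by (simp add: sigma3_eq add.assoc)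
  then show ?thesis unfolding conjg_def by (simp add: group_word del: add_uminus_conv_diff)
qed

lemma conjg_sigma3_fib_q: "conjg sigma3 fib_q = fib_p + fib_q"
proof -
  have "conjg sigma3 fib_q = conjg fib_p (conjg sigma1 fib_q)" by (simp add: conjg_conjg sigma3_eq)
  also have "\<dots> = fib_p + fib_q" unfolding conjg_sigma1_fib_q by (simp add: conjg_def group_word del: add_uminus_conv_diff)
  finally show ?thesis .
qed

definition full_twist3 :: braid4 where "full_twist3 = half_twist + half_twist"

text \<open>Besides $\sigma_1$ and $\sigma_3$, this is the generator needed for the centralizer of $\sigma_3$. It turns
the first two strands by half a turn around the ribbon formed by the last two, which is itself given a half twist.
So its square is the full twist of all four strands; on the plane fixed by $\sigma_3$ it is thus a multiple of an involution.\<close>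

definition wrap :: braid4 where "wrap = sigma1 + (sigma2 + (sigma3 + (sigma3 + (sigma2 + sigma3))))"

lemma conjg_half_twist: "conjg half_twist fib_p = - fib_q" "conjg half_twist fib_q = fib_q + (fib_p + - fib_q)"
proof -
  have h: "conjg half_twist x = conjg sigma1 (conjg sigma2 (conjg sigma1 x))" for x
    by (simp add: half_twist_def conjg_conjg add.assoc)
  show "conjg half_twist fib_p = - fib_q"
    by (simp add: h conjg_sigma1_fib_p conjg_sigma2_fib_p conjg_sigma1_fib_q conjg_add conjg_uminus minus_add del: add_uminus_conv_diff)
  show "conjg half_twist fib_q = fib_q + (fib_p + - fib_q)"
    by (simp add: h conjg_sigma1_fib_p conjg_sigma2_fib_p conjg_sigma2_fib_q conjg_sigma1_fib_q conjg_add conjg_uminus group_word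
        del: add_uminus_conv_diff)
qed

text \<open>Modulo the kernel of $B_4 \to B_3$ the braid is the full twist of three strands. All factors $p$
coming from $\sigma_3 = p \sigma_1$ are moved to the left.\<close>

lemma wrap_eq: "wrap = - fib_q + (- fib_p + (- fib_q + full_twist3))"
proof -
  have twice: "sigma1 + (sigma2 + fib_p) = - fib_q + (sigma1 + sigma2)"
  proof -
    have "conjg (sigma1 + sigma2) fib_p = - fib_q"
      by (simp add: conjg_conjg[symmetric] conjg_sigma2_fib_p conjg_add conjg_uminus conjg_sigma1_fib_p conjg_sigma1_fib_q minus_add
          del: add_uminus_conv_diff)
    then show ?thesis using conjg_move[of "sigma1 + sigma2" fib_p] by (simp add: add.assoc)
  qed
  have "wrap = (sigma1 + (sigma2 + fib_p)) + (sigma1 + (fib_p + (sigma1 + (sigma2 + (fib_p + sigma1)))))"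
    by (simp only: wrap_def sigma3_eq add.assoc)
  also have "\<dots> = - fib_q + (sigma1 + (sigma2 + ((sigma1 + fib_p) + (sigma1 + (sigma2 + (fib_p + sigma1))))))"
    unfolding twice by (simp only: add.assoc)
  also have "\<dots> = - fib_q + ((sigma1 + (sigma2 + fib_p)) + (sigma1 + ((sigma1 + (sigma2 + fib_p)) + sigma1)))"
    unfolding sigma1_fib_p by (simp only: add.assoc)
  also have "\<dots> = - fib_q + (- fib_q + ((half_twist + - fib_q) + half_twist))"
    unfolding twice by (simp only: half_twist_def add.assoc)
  also have "half_twist + - fib_q = conjg half_twist (- fib_q) + half_twist"
    by (rule conjg_move)
  also have "- fib_q + (- fib_q + ((conjg half_twist (- fib_q) + half_twist) + half_twist)) =
      - fib_q + (- fib_p + (- fib_q + full_twist3))"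
    by (simp add: conjg_uminus conjg_half_twist full_twist3_def group_word del: add_uminus_conv_diff)
  finally show ?thesis .
qed

lemma conjg_full_twist3: "conjg full_twist3 fib_p = fib_q + (- fib_p + - fib_q)"
  by (simp add: full_twist3_def conjg_conjg[symmetric] conjg_half_twist conjg_add conjg_uminus
      group_word del: add_uminus_conv_diff)

lemma full_twist3_central: "sigma1 + full_twist3 = full_twist3 + sigma1" "sigma2 + full_twist3 = full_twist3 + sigma2"
  by (simp_all only: full_twist3_def add.assoc[symmetric] sigma1_half_twist sigma2_half_twist)
    (simp_all only: add.assoc sigma1_half_twist sigma2_half_twist)

text \<open>This is what makes $q^{-1} p q$, which is fixed by $\sigma_3$, expressible in braids that are known to
commute with $\sigma_3$.\<close>

lemma conjg_wrap_fib_p: "conjg wrap fib_p = - fib_q + (- fib_p + fib_q)"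
proof -
  have wrap: "conjg wrap x = conjg (- fib_q) (conjg (- fib_p) (conjg (- fib_q) (conjg full_twist3 x)))" for x
    by (simp add: wrap_eq conjg_conjg add.assoc)
  show ?thesis
    by (simp add: wrap conjg_full_twist3) (simp add: conjg_def group_word del: add_uminus_conv_diff)
qed

lemma conjg_sigma3_wrap: "conjg sigma3 wrap = wrap"
proof -
  have "conjg sigma3 full_twist3 = conjg fib_p (conjg sigma1 full_twist3)" by (simp add: conjg_conjg sigma3_eq)
  also have "conjg sigma1 full_twist3 = full_twist3" by (simp add: conjg_eq_self_iff full_twist3_central)
  also have "conjg fib_p full_twist3 = fib_p + (conjg full_twist3 (- fib_p) + full_twist3)"
    by (simp add: conjg_def group_word del: add_uminus_conv_diff)
  finally show ?thesis
    by (simp add: wrap_eq conjg_add conjg_uminus conjg_sigma3_fib_q conjg_sigma3_fib_p conjg_full_twist3 group_word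
        del: add_uminus_conv_diff)
qed


section \<open>A normal form modulo the fiber\<close>

definition int_mult :: "int \<Rightarrow> 'a::group_add \<Rightarrow> 'a" where
  "int_mult n x = (if 0 \<le> n then ((+) x ^^ nat n) 0 else ((+) (- x) ^^ nat (- n)) 0)"

lemma int_mult_0 [simp]: "int_mult 0 x = 0"
  by (simp add: int_mult_def)

lemma int_mult_1 [simp]: "int_mult 1 x = x"
  by (simp add: int_mult_def)

lemma int_mult_plus1: "int_mult (n + 1) x = x + int_mult n x"
proof (cases "0 \<le> n")
  case True
  then have "nat (n + 1) = Suc (nat n)" by simp
  with True show ?thesis by (simp add: int_mult_def)
next
  case False
  then have "nat (- n) = Suc (nat (- (n + 1)))" by simp
  with False show ?thesis by (auto simp: int_mult_def)
qed

lemma int_mult_minus1: "int_mult (n - 1) x = - x + int_mult n x"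
  using int_mult_plus1[of "n - 1" x] by simp

lemma int_mult_add: "int_mult (m + n) x = int_mult m x + int_mult n x"
proof (induction m rule: int_induct[where k = 0])
  case (step1 i)
  have "int_mult (i + 1 + n) x = int_mult ((i + n) + 1) x" by (simp add: algebra_simps)
  also have "\<dots> = int_mult (i + 1) x + int_mult n x"
    unfolding int_mult_plus1 step1 by (simp add: add.assoc)
  finally show ?case .
next
  case (step2 i)
  have "int_mult (i - 1 + n) x = int_mult ((i + n) - 1) x" by (simp add: algebra_simps)
  also have "\<dots> = int_mult (i - 1) x + int_mult n x"
    unfolding int_mult_minus1 step2 by (simp add: add.assoc)
  finally show ?case .
qed simp

lemma int_mult_uminus: "int_mult (- n) x = - int_mult n x"
  using int_mult_add[of "- n" n x] by (simp add: eq_neg_iff_add_eq_0)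

lemma int_mult_minus_one [simp]: "int_mult (- 1) x = - x"
  by (simp add: int_mult_uminus)

lemma conjg_int_mult: "conjg g (int_mult n x) = int_mult n (conjg g x)"
  by (induction n rule: int_induct[where k = 0])
    (simp_all add: int_mult_plus1 int_mult_minus1 conjg_zero conjg_add conjg_uminus)

lemma int_mult_commute:
  assumes "g + x = x + g"
  shows "g + int_mult n x = int_mult n x + g"
  using assms unfolding conjg_eq_self_iff[symmetric] by (simp add: conjg_int_mult)

inductive_set generated :: "'a::group_add set \<Rightarrow> 'a set" for A where
  zero: "0 \<in> generated A"
| add: "a \<in> A \<Longrightarrow> x \<in> generated A \<Longrightarrow> a + x \<in> generated A"
| diff: "a \<in> A \<Longrightarrow> x \<in> generated A \<Longrightarrow> - a + x \<in> generated A"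

lemma generated_incl: "a \<in> A \<Longrightarrow> a \<in> generated A"
  using generated.add[OF _ generated.zero] by fastforce

lemma generated_add: "x \<in> generated A \<Longrightarrow> y \<in> generated A \<Longrightarrow> x + y \<in> generated A"
  by (induction rule: generated.induct) (simp_all add: add.assoc generated.add generated.diff)

lemma generated_uminus: "x \<in> generated A \<Longrightarrow> - x \<in> generated A"
proof (induction rule: generated.induct)
  case zero
  show ?case using generated.zero by simp
next
  case (add a x)
  have "- a + 0 \<in> generated A" by (rule generated.diff[OF add(1) generated.zero])
  with add(3) show ?case using generated_add by (fastforce simp: minus_add simp del: add_uminus_conv_diff)
next
  case (diff a x)
  with generated_incl[OF diff(1)] show ?case using generated_add
    by (fastforce simp: minus_add simp del: add_uminus_conv_diff)
qed

lemma generated_int_mult: "x \<in> generated A \<Longrightarrow> int_mult n x \<in> generated A"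
  by (induction n rule: int_induct[where k = 0])
    (simp_all add: int_mult_plus1 int_mult_minus1 generated.zero generated_add generated_uminus)

lemma generated_conjg:
  assumes "\<And>a. a \<in> A \<Longrightarrow> conjg g a \<in> generated B" "x \<in> generated A"
  shows "conjg g x \<in> generated B"
  using assms(2)
  by (induction rule: generated.induct)
    (simp_all add: conjg_zero conjg_add conjg_uminus generated.zero generated_add generated_uminus assms(1))

text \<open>The kernel of the homomorphism from $B_4$ to $B_3$ described above.\<close>

definition fiber :: "braid4 set" where "fiber = generated {fib_p, fib_q}"

lemma fib_p_in_fiber: "fib_p \<in> fiber" and fib_q_in_fiber: "fib_q \<in> fiber"
  by (auto simp: fiber_def generated_incl)

lemma fiber_zero: "0 \<in> fiber"
  by (simp add: fiber_def generated.zero)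

lemma fiber_add: "x \<in> fiber \<Longrightarrow> y \<in> fiber \<Longrightarrow> x + y \<in> fiber"
  by (simp add: fiber_def generated_add)

lemma fiber_uminus: "x \<in> fiber \<Longrightarrow> - x \<in> fiber"
  by (simp add: fiber_def generated_uminus)

lemma conjg_eq_flip: "conjg g x = y \<Longrightarrow> conjg (- g) y = (x::'a::group_add)"
  by (auto simp: conjg_conjg conjg_by_zero)

lemma conjg_inverse_sigma1_fib_q: "conjg (- sigma1) fib_q = fib_q + - fib_p"
  by (rule conjg_eq_flip) (simp add: conjg_add conjg_uminus conjg_sigma1_fib_p conjg_sigma1_fib_q group_word
      del: add_uminus_conv_diff)

lemma conjg_inverse_sigma2_fib_p: "conjg (- sigma2) fib_p = fib_p + fib_q"
  by (rule conjg_eq_flip) (simp add: conjg_add conjg_sigma2_fib_p conjg_sigma2_fib_q group_word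
      del: add_uminus_conv_diff)

lemma conjg_generators_fiber:
  assumes "x \<in> fiber"
  shows "conjg sigma1 x \<in> fiber" "conjg (- sigma1) x \<in> fiber" "conjg sigma2 x \<in> fiber" "conjg (- sigma2) x \<in> fiber"
proof -
  note flip = conjg_eq_flip[OF conjg_sigma1_fib_p] conjg_eq_flip[OF conjg_sigma2_fib_q]
  have "conjg g x \<in> fiber" if "conjg g fib_p \<in> fiber" "conjg g fib_q \<in> fiber" for g
    using that assms unfolding fiber_def by (auto intro: generated_conjg[where A = "{fib_p, fib_q}"])
  moreover have "conjg g y \<in> fiber" if "g \<in> {sigma1, - sigma1, sigma2, - sigma2}" "y \<in> {fib_p, fib_q}" for g y
    using that by (auto simp: conjg_sigma1_fib_p conjg_sigma1_fib_q conjg_sigma2_fib_p conjg_sigma2_fib_q conjg_inverse_sigma1_fib_q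
        conjg_inverse_sigma2_fib_p flip fib_p_in_fiber fib_q_in_fiber fiber_add fiber_uminus simp del: add_uminus_conv_diff)
  ultimately show "conjg sigma1 x \<in> fiber" "conjg (- sigma1) x \<in> fiber" "conjg sigma2 x \<in> fiber" "conjg (- sigma2) x \<in> fiber"
    by auto
qed

lemma conjg_fiber: "x \<in> fiber \<Longrightarrow> conjg g x \<in> fiber"
proof (induction g arbitrary: x rule: braid4_induct)
  case zero
  then show ?case by (simp add: conjg_by_zero)
next
  case (pos i g)
  then have g: "conjg g x \<in> fiber" by blast
  then have "conjg fib_p (conjg sigma1 (conjg g x)) \<in> fiber"
    unfolding conjg_def[of fib_p] by (intro fiber_add fiber_uminus fib_p_in_fiber conjg_generators_fiber)
  then have "conjg sigma3 (conjg g x) \<in> fiber" by (simp add: conjg_conjg sigma3_eq add.assoc)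
  then show ?case using pos(1) conjg_generators_fiber[OF g]
    by (auto simp: conjg_conjg[symmetric] sigma1_def sigma2_def sigma3_def)
next
  case (neg i g)
  then have g: "conjg g x \<in> fiber" by blast
  have "conjg (- fib_p) (conjg g x) \<in> fiber"
    using g unfolding conjg_def[of "- fib_p"] by (intro fiber_add fiber_uminus fib_p_in_fiber)
  then have "conjg (- sigma1) (conjg (- fib_p) (conjg g x)) \<in> fiber" by (rule conjg_generators_fiber)
  then have "conjg (- sigma3) (conjg g x) \<in> fiber"
    by (simp add: conjg_conjg sigma3_eq minus_add add.assoc del: add_uminus_conv_diff)
  then show ?case using neg(1) conjg_generators_fiber[OF g]
    by (auto simp: conjg_conjg[symmetric] sigma1_def sigma2_def sigma3_def)
qed


text \<open>Modulo the center of $B_3$ this element has order three and the half twist has order two, and that quotient is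
the free product of the groups generated by them.\<close>

definition half_rot :: braid4 where "half_rot = sigma1 + sigma2"

text \<open>Words in $\sigma_1$ and $\sigma_2^{-1}$. In the action on pairs of integers both letters become elementary
matrices with nonnegative entries, so nothing cancels.\<close>

fun pos_word :: "bool list \<Rightarrow> braid4" where
  "pos_word [] = 0"
| "pos_word (b # w) = (if b then sigma1 else - sigma2) + pos_word w"

lemma half_rot_sigma1: "half_rot + sigma1 = half_twist"
  by (simp add: half_rot_def half_twist_def add.assoc)

lemma half_rot_half_twist: "half_rot + half_twist = full_twist3 + - sigma2"
proof -
  have "half_rot + half_twist + sigma2 = half_rot + (sigma1 + half_twist)" by (simp add: sigma1_half_twist add.assoc)
  also have "\<dots> = full_twist3" by (simp add: full_twist3_def half_rot_sigma1 add.assoc[symmetric])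
  finally show ?thesis by (simp add: eq_diff_eq)
qed

lemma half_rot_half_rot_half_rot: "half_rot + (half_rot + half_rot) = full_twist3"
proof -
  have "half_rot + (half_rot + half_rot) = half_twist + (sigma2 + (sigma1 + sigma2))"
    by (simp add: half_rot_def half_twist_def add.assoc)
  also have "sigma2 + (sigma1 + sigma2) = half_twist" by (simp add: half_twist_def sigma121)
  finally show ?thesis by (simp add: full_twist3_def)
qed

lemma half_twist_half_rot: "half_twist + half_rot = full_twist3 + - sigma1"
proof -
  have "half_twist + half_rot + sigma1 = full_twist3" by (simp add: full_twist3_def half_rot_sigma1 add.assoc)
  then show ?thesis by (simp add: eq_diff_eq)
qed

lemma full_twist3_half_twist: "full_twist3 + half_twist = half_twist + full_twist3"
  by (simp add: full_twist3_def add.assoc)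

lemma full_twist3_half_rot: "full_twist3 + half_rot = half_rot + full_twist3"
proof -
  have "full_twist3 + half_rot = (full_twist3 + sigma1) + sigma2" by (simp only: half_rot_def add.assoc)
  also have "\<dots> = sigma1 + (sigma2 + full_twist3)"
    by (simp only: full_twist3_central add.assoc flip: full_twist3_central(1))
  also have "\<dots> = half_rot + full_twist3" by (simp only: half_rot_def add.assoc)
  finally show ?thesis .
qed

text \<open>The normal form of the modular group, lifted to $B_3$: a central element, a possible half twist, a positive
word, and a power of the element of order three.\<close>

definition B3_form :: "int \<Rightarrow> bool \<Rightarrow> bool list \<Rightarrow> nat \<Rightarrow> braid4" where
  "B3_form m j w i =
     int_mult m full_twist3 + ((if j then half_twist else 0) + (pos_word w + int_mult (int i) half_rot))"

definition B3_forms :: "braid4 set" where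
  "B3_forms = {B3_form m j w i | m j w i. i < 3}"

lemma B3_formsI: "i < 3 \<Longrightarrow> B3_form m j w i \<in> B3_forms"
  by (auto simp: B3_forms_def)

lemma B3_forms_full_twist3:
  assumes "y \<in> B3_forms"
  shows "int_mult n full_twist3 + y \<in> B3_forms"
proof -
  obtain m j w i where "i < 3" "y = B3_form m j w i" using assms by (auto simp: B3_forms_def)
  then have "int_mult n full_twist3 + y = B3_form (n + m) j w i"
    by (simp add: B3_form_def int_mult_add add.assoc)
  with \<open>i < 3\<close> show ?thesis by (simp add: B3_formsI)
qed

lemma B3_forms_half_twist:
  assumes "y \<in> B3_forms"
  shows "half_twist + y \<in> B3_forms"
proof -
  obtain m j w i where y: "i < 3" "y = B3_form m j w i" using assms by (auto simp: B3_forms_def)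
  have move: "half_twist + (int_mult m full_twist3 + z) = int_mult m full_twist3 + (half_twist + z)" for z
    by (simp only: add.assoc[symmetric] int_mult_commute[OF full_twist3_half_twist[symmetric]])
  have "half_twist + y =
      (if j then B3_form (m + 1) False w i else B3_form m True w i)"
    using y(2) by (simp add: B3_form_def move) (simp add: full_twist3_def int_mult_add add.assoc)
  with y(1) show ?thesis by (simp add: B3_formsI)
qed

lemma B3_forms_half_rot:
  assumes "y \<in> B3_forms"
  shows "half_rot + y \<in> B3_forms"
proof -
  obtain m j w i where y: "i < 3" "y = B3_form m j w i" using assms by (auto simp: B3_forms_def)
  have move: "half_rot + (int_mult m full_twist3 + z) = int_mult m full_twist3 + (half_rot + z)" for z
    by (simp only: add.assoc[symmetric] int_mult_commute[OF full_twist3_half_rot[symmetric]])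
  have y': "half_rot + y = int_mult m full_twist3 +
      (half_rot + ((if j then half_twist else 0) + (pos_word w + int_mult (int i) half_rot)))"
    by (simp only: y(2) B3_form_def move)
  show ?thesis
  proof (cases j)
    case True
    have "half_rot + (half_twist + z) = full_twist3 + (- sigma2 + z)" for z
      by (simp only: add.assoc[symmetric] half_rot_half_twist)
    then have "half_rot + y = B3_form (m + 1) False (False # w) i"
      using True y' by (simp add: B3_form_def int_mult_add add.assoc)
    with y(1) show ?thesis by (simp add: B3_formsI)
  next
    case j: False
    show ?thesis
    proof (cases w)
      case Nil
      have half_rot: "half_rot + int_mult (int i) half_rot = int_mult (1 + int i) half_rot"
        using int_mult_plus1[of "int i" half_rot] by (simp add: add.commute[of 1])
      show ?thesis
      proof (cases "i = 2")
        case True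
        have "int_mult 2 half_rot = half_rot + half_rot" using int_mult_plus1[of 1 half_rot] by simp
        then have "half_rot + int_mult (int i) half_rot = full_twist3"
          using True half_rot_half_rot_half_rot by simp
        then have "half_rot + y = B3_form (m + 1) False [] 0"
          using j Nil y' by (simp add: B3_form_def int_mult_add)
        then show ?thesis by (simp add: B3_formsI)
      next
        case False
        then have "half_rot + y = B3_form m False [] (Suc i)" "Suc i < 3"
          using j Nil y' y(1) by (simp_all add: half_rot B3_form_def)
        then show ?thesis by (simp add: B3_formsI)
      qed
    next
      case (Cons b v)
      have "half_rot + (sigma1 + z) = half_twist + z" "half_rot + (- sigma2 + z) = sigma1 + z" for z
        by (simp_all only: add.assoc[symmetric] half_rot_sigma1) (simp add: half_rot_def add.assoc)
      then have "half_rot + y = (if b then B3_form m True v i else B3_form m False (True # v) i)"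
        using j Cons y' by (simp add: B3_form_def add.assoc)
      with y(1) show ?thesis by (simp add: B3_formsI)
    qed
  qed
qed

lemma B3_forms_inverse:
  assumes "y \<in> B3_forms"
  shows "- half_twist + y \<in> B3_forms" "- half_rot + y \<in> B3_forms"
proof -
  have "- half_twist + y = half_twist + (int_mult (- 1) full_twist3 + y)"
    by (simp add: full_twist3_def group_word del: add_uminus_conv_diff)
  then show "- half_twist + y \<in> B3_forms"
    by (simp only: B3_forms_half_twist B3_forms_full_twist3 assms)
  have "- half_rot + y = half_rot + (half_rot + (int_mult (- 1) full_twist3 + y))"
    by (simp add: half_rot_half_rot_half_rot[symmetric] group_word del: add_uminus_conv_diff)
  then show "- half_rot + y \<in> B3_forms"
    by (simp only: B3_forms_half_rot B3_forms_full_twist3 assms)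
qed

lemma B3_forms_generators:
  assumes "y \<in> B3_forms"
  shows "sigma1 + y \<in> B3_forms" "- sigma1 + y \<in> B3_forms" "sigma2 + y \<in> B3_forms" "- sigma2 + y \<in> B3_forms"
proof -
  have sigma1: "sigma1 + z = - half_rot + (half_twist + z)" "- sigma1 + z = - half_twist + (half_rot + z)"
    and sigma2: "sigma2 + z = - sigma1 + (half_rot + z)" "- sigma2 + z = - half_rot + (sigma1 + z)" for z
    by (simp_all add: half_rot_sigma1[symmetric] group_word del: add_uminus_conv_diff)
      (simp_all add: half_rot_def group_word del: add_uminus_conv_diff)
  have 1: "sigma1 + z \<in> B3_forms" "- sigma1 + z \<in> B3_forms" if "z \<in> B3_forms" for z
    using that by (simp_all only: sigma1 B3_forms_inverse B3_forms_half_rot B3_forms_half_twist)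
  show "sigma1 + y \<in> B3_forms" "- sigma1 + y \<in> B3_forms" by (rule 1[OF assms])+
  show "sigma2 + y \<in> B3_forms" "- sigma2 + y \<in> B3_forms"
    by (simp_all only: sigma2 1 B3_forms_inverse B3_forms_half_rot assms)
qed

lemma fiber_times_B3: "\<exists>k\<in>fiber. \<exists>y\<in>B3_forms. x = k + y"
proof (induction x rule: braid4_induct)
  case zero
  have "0 = B3_form 0 False [] 0" by (simp add: B3_form_def)
  then have "0 \<in> B3_forms" using B3_formsI[of 0 0 False "[]"] by simp
  then show ?case using fiber_zero by force
next
  case (pos i x)
  then obtain k y where x: "k \<in> fiber" "y \<in> B3_forms" "x = k + y" by blast
  have "sigma1 + x = conjg sigma1 k + (sigma1 + y)" "sigma2 + x = conjg sigma2 k + (sigma2 + y)"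
    "sigma3 + x = (fib_p + conjg sigma1 k) + (sigma1 + y)"
    using x(3) by (simp_all add: conjg_def sigma3_eq group_word del: add_uminus_conv_diff)
  moreover have "conjg sigma1 k \<in> fiber" "conjg sigma2 k \<in> fiber" "fib_p + conjg sigma1 k \<in> fiber"
    using x(1) by (simp_all add: conjg_fiber fiber_add fib_p_in_fiber)
  moreover note B3_forms_generators[OF x(2)]
  ultimately have "\<exists>k\<in>fiber. \<exists>y\<in>B3_forms. g + x = k + y" if "g \<in> {sigma1, sigma2, sigma3}" for g
    using that by blast
  then show ?case using pos(1) by (auto simp: sigma1_def sigma2_def sigma3_def)
next
  case (neg i x)
  then obtain k y where x: "k \<in> fiber" "y \<in> B3_forms" "x = k + y" by blast
  have "- sigma1 + x = conjg (- sigma1) k + (- sigma1 + y)" "- sigma2 + x = conjg (- sigma2) k + (- sigma2 + y)"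
    "- sigma3 + x = conjg (- sigma1) (- fib_p + k) + (- sigma1 + y)"
    using x(3) by (simp_all add: conjg_def sigma3_eq group_word del: add_uminus_conv_diff)
  moreover have "conjg (- sigma1) k \<in> fiber" "conjg (- sigma2) k \<in> fiber" "conjg (- sigma1) (- fib_p + k) \<in> fiber"
    using x(1) by (simp_all add: conjg_fiber fiber_add fiber_uminus fib_p_in_fiber)
  moreover note B3_forms_generators[OF x(2)]
  ultimately have "\<exists>k\<in>fiber. \<exists>y\<in>B3_forms. - g + x = k + y" if "g \<in> {sigma1, sigma2, sigma3}" for g
    using that by blast
  then show ?case using neg(1) by (auto simp: sigma1_def sigma2_def sigma3_def)
qed


section \<open>Braids commuting with sigma3 modulo the fiber\<close>

lemma int_mult_of_uminus: "int_mult n (- x) = - int_mult n x"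
proof (induction n rule: int_induct[where k = 0])
  case (step1 i)
  have "x + int_mult i x = int_mult i x + x" by (rule int_mult_commute) simp
  then show ?case by (simp only: int_mult_plus1 step1 minus_add)
next
  case (step2 i)
  have "- x + int_mult i x = int_mult i x + - x" by (rule int_mult_commute) simp
  then show ?case by (simp only: int_mult_minus1 step2 minus_add)
qed simp

lemma pos_word_replicate_True: "pos_word (replicate n True) = int_mult (int n) sigma1"
proof (induction n)
  case (Suc n)
  then show ?case using int_mult_plus1[of "int n" sigma1] by (simp add: add.commute[of 1])
qed simp

lemma pos_word_replicate_False: "pos_word (replicate n False) = int_mult (int n) (- sigma2)"
proof (induction n)
  case (Suc n)
  then show ?case using int_mult_plus1[of "int n" "- sigma2"] by (simp add: add.commute[of 1])
qed simp

text \<open>The Burau representation at $t = -1$ has an invariant vector; this is the action on the quotient. It factors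
through $B_3$ and is the familiar map onto the modular group.\<close>

lemma braid4_SL2_action:
  obtains V :: "braid4 \<Rightarrow> int \<times> int \<Rightarrow> int \<times> int"
  where "\<And>x y z. V (x + y) z = V x (V y z)" "\<And>z. V 0 z = z"
    "\<And>a b. V sigma1 (a, b) = (a + b, b)" "\<And>a b. V sigma2 (a, b) = (a, b - a)"
    "\<And>a b. V sigma3 (a, b) = (a + b, b)" "\<And>a b. V (- sigma2) (a, b) = (a, b + a)"
    "\<And>k z. k \<in> fiber \<Longrightarrow> V k z = z"
proof -
  define f g :: "nat \<Rightarrow> int \<times> int \<Rightarrow> int \<times> int"
    where "f i = (\<lambda>(a, b). if i = 2 then (a, b - a) else (a + b, b))"
      and "g i = (\<lambda>(a, b). if i = 2 then (a, b + a) else (a - b, b))" for i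
  obtain V where V: "\<And>x y z. V (x + y) z = V x (V y z)" "\<And>z. V 0 z = z"
    "\<And>i z. i \<in> {1, 2, 3} \<Longrightarrow> V (braid_sigma i) z = f i z" "\<And>i z. i \<in> {1, 2, 3} \<Longrightarrow> V (- braid_sigma i) z = g i z"
    by (rule braid4_action[of f g]) (auto simp: f_def g_def)
  have gens: "V sigma1 z = f 1 z" "V sigma2 z = f 2 z" "V sigma3 z = f 3 z"
    "V (- sigma1) z = g 1 z" "V (- sigma2) z = g 2 z" "V (- sigma3) z = g 3 z" for z
    by (simp_all add: sigma1_def sigma2_def sigma3_def V(3,4))
  have fib_p: "V fib_p z = z" for z
    by (cases z) (simp add: fib_p_def V(1) gens f_def g_def del: add_uminus_conv_diff)
  have inverse: "V (- x) z = z" if "\<And>z. V x z = z" for x z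
    using V(1)[of "- x" x z] V(2) that by simp
  have fib_q: "V fib_q z = z" for z
    using fib_p inverse[of fib_p]
    by (cases z) (simp add: fib_q_def conjg_def V(1) gens f_def g_def del: add_uminus_conv_diff)
  have fiber: "V k z = z" if "k \<in> fiber" for k z
    using that unfolding fiber_def
    by (induction arbitrary: z rule: generated.induct) (auto simp: V(1,2) fib_p fib_q inverse)
  show ?thesis
    by (rule that[of V]) (simp_all add: V(1,2) gens fiber f_def g_def)
qed


text \<open>A braid that commutes with $\sigma_3$ maps the vector $(1, 0)$, fixed by $\sigma_3$, to a multiple of itself.
Each normal form that contains the wrong letters moves $(1, 0)$ away from its line, because positive words keep
the signs of the coordinates.\<close>

lemma commutes_sigma3_mod_fiber:
  assumes "x + sigma3 = sigma3 + x"
  obtains k m n where "k \<in> fiber" "x = k + (int_mult m full_twist3 + int_mult n sigma1)"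
proof -
  obtain V :: "braid4 \<Rightarrow> int \<times> int \<Rightarrow> int \<times> int"
    where V: "\<And>x y z. V (x + y) z = V x (V y z)" "\<And>z. V 0 z = z"
    "\<And>a b. V sigma1 (a, b) = (a + b, b)" "\<And>a b. V sigma2 (a, b) = (a, b - a)"
    "\<And>a b. V sigma3 (a, b) = (a + b, b)" "\<And>a b. V (- sigma2) (a, b) = (a, b + a)"
    "\<And>k z. k \<in> fiber \<Longrightarrow> V k z = z"
    by (rule braid4_SL2_action) (rule that)
  have half: "V half_twist (a, b) = (b, - a)" and half_rot: "V half_rot (a, b) = (b, b - a)" for a b
    by (simp_all add: half_twist_def half_rot_def V)
  have full: "V full_twist3 (a, b) = (- a, - b)" for a b
    by (simp add: full_twist3_def V half)
  have full_inverse: "V (- full_twist3) (a, b) = (- a, - b)" for a b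
    using V(1)[of "- full_twist3" full_twist3 "(- a, - b)"] by (simp add: V(2) full)
  have proj: "fst (V sigma1 z) = fst z + snd z" "snd (V sigma1 z) = snd z"
    "fst (V (- sigma2) z) = fst z" "snd (V (- sigma2) z) = snd z + fst z"
    "fst (V half_twist z) = snd z" "snd (V half_twist z) = - fst z"
    "fst (V half_rot z) = snd z" "snd (V half_rot z) = snd z - fst z" for z
    by (cases z, simp add: V half half_rot)+
  \<comment> \<open>the full twist acts as minus one and so preserves every line\<close>
  have snd_full: "snd (V full_twist3 z) = - snd z" "snd (V (- full_twist3) z) = - snd z" for z
    by (cases z, simp add: full full_inverse)+
  have zfull: "snd (V (int_mult m full_twist3) z) = 0 \<longleftrightarrow> snd z = 0" for m z
    by (induction m arbitrary: z rule: int_induct[where k = 0])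
      (simp_all add: V(1,2) int_mult_plus1 int_mult_minus1 snd_full)
  obtain k y where ky: "k \<in> fiber" "y \<in> B3_forms" "x = k + y" using fiber_times_B3 by blast
  then obtain m j w i where y: "i < 3" "y = B3_form m j w i" by (auto simp: B3_forms_def)
  define u where "u = (if j then half_twist else 0) + (pos_word w + int_mult (int i) half_rot)"
  have x: "x = k + (int_mult m full_twist3 + u)"
    using ky(3) y(2) by (simp add: B3_form_def u_def)
  have "V sigma3 (V x (1, 0)) = V x (V sigma3 (1, 0))"
    by (simp only: V(1)[symmetric] assms)
  then have "V sigma3 (V x (1, 0)) = V x (1, 0)" by (simp add: V(5))
  then have "snd (V x (1, 0)) = 0" by (cases "V x (1, 0)") (simp add: V(5))
  then have u0: "snd (V u (1, 0)) = 0" by (simp add: x V(1,7) ky(1) zfull)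
  consider "i = 0" | "i = 1" | "i = 2" using y(1) by linarith
  then show ?thesis
  proof cases
    case 1
    have W: "fst (V (pos_word w) (1, 0)) \<ge> 1 \<and> snd (V (pos_word w) (1, 0)) \<ge> 0 \<and>
      (snd (V (pos_word w) (1, 0)) = 0 \<longrightarrow> w = replicate (length w) True)" for w
      by (induction w) (auto simp: V(1,2) proj)
    have "\<not> j"
      using u0 W[of w] 1 by (auto simp: u_def V(1,2) proj split: if_splits)
    then have "u = int_mult (int (length w)) sigma1"
      using u0 W[of w] 1 pos_word_replicate_True[of "length w"] by (auto simp: u_def)
    with x show ?thesis using that ky(1) by blast
  next
    case 2
    have W: "fst (V (pos_word w) (0, - 1)) \<le> 0 \<and> snd (V (pos_word w) (0, - 1)) \<le> - 1 \<and>
      (fst (V (pos_word w) (0, - 1)) = 0 \<longrightarrow> w = replicate (length w) False)" for w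
      by (induction w) (auto simp: V(1,2) proj)
    have j: j
      using u0 W[of w] 2 by (auto simp: u_def V(1,2) half_rot split: if_splits)
    then have "w = replicate (length w) False"
      using u0 W[of w] 2 by (auto simp: u_def V(1,2) half_rot proj split: if_splits)
    then have w: "pos_word w = int_mult (int (length w)) (- sigma2)"
      using pos_word_replicate_False[of "length w"] by simp
    have "conjg half_twist sigma2 = sigma1"
      unfolding conjg_def by (simp add: sigma1_half_twist[symmetric] add.assoc)
    then have "half_twist + pos_word w = int_mult (- int (length w)) sigma1 + half_twist"
      unfolding w by (simp add: conjg_move[of half_twist] conjg_int_mult conjg_uminus)
        (simp add: int_mult_uminus int_mult_of_uminus)
    then have "u = int_mult (- int (length w)) sigma1 + (full_twist3 + - sigma1)"
      using j 2 by (simp add: u_def half_twist_half_rot add.assoc[symmetric] del: add_uminus_conv_diff)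
        (simp add: half_twist_half_rot add.assoc del: add_uminus_conv_diff)
    also have "\<dots> = full_twist3 + (int_mult (- int (length w)) sigma1 + - sigma1)"
      by (simp only: add.assoc[symmetric] int_mult_commute[OF full_twist3_central(1)[symmetric]])
    also have "\<dots> = int_mult 1 full_twist3 + int_mult (- int (length w) + - 1) sigma1"
      by (simp only: int_mult_add int_mult_1 int_mult_minus_one)
    finally have "x = k + (int_mult (m + 1) full_twist3 + int_mult (- int (length w) + - 1) sigma1)"
      unfolding x by (simp only: int_mult_add add.assoc)
    with ky(1) show ?thesis by (rule that)
  next
    case 3
    have W: "fst (V (pos_word w) (- 1, - 1)) \<le> - 1 \<and> snd (V (pos_word w) (- 1, - 1)) \<le> - 1" for w
      by (induction w) (auto simp: V(1,2) proj)
    have "int_mult 2 half_rot = half_rot + half_rot" using int_mult_plus1[of 1 half_rot] by simp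
    then show ?thesis
      using u0 W[of w] 3 by (auto simp: u_def V(1,2) half_rot proj split: if_splits)
  qed
qed


section \<open>Freeness of the fiber\<close>

definition conjg_pair :: "'a::group_add \<Rightarrow> 'a \<times> 'a \<Rightarrow> 'a \<times> 'a" where
  "conjg_pair g z = (conjg g (fst z), conjg g (snd z))"

lemma conjg_pair_add: "conjg_pair g (conjg_pair h z) = conjg_pair (g + h) z"
  by (simp add: conjg_pair_def conjg_conjg)

lemma conjg_pair_zero: "conjg_pair 0 z = z"
  by (simp add: conjg_pair_def conjg_by_zero)

text \<open>The group $B_4$ acts on the free group of rank two, hence by substitution on pairs of elements of an arbitrary
group. The point is that $p$ and $q$ act by inner automorphisms, namely as conjugation by the first and by
the second component. Since substitutions compose in the opposite order, the action is from the right.\<close>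

lemma braid4_pair_action:
  obtains F :: "braid4 \<Rightarrow> 'a::group_add \<times> 'a \<Rightarrow> 'a \<times> 'a"
  where "\<And>x y z. F (x + y) z = F y (F x z)" "\<And>z. F 0 z = z"
    "\<And>x g z. F x (conjg_pair g z) = conjg_pair g (F x z)"
    "\<And>M N. F fib_p (M, N) = conjg_pair M (M, N)"
    "\<And>M N. F fib_q (M, N) = conjg_pair N (M, N)"
proof -
  define f g :: "nat \<Rightarrow> 'a \<times> 'a \<Rightarrow> 'a \<times> 'a"
    where "f i = (\<lambda>(M, N). if i = 1 then (M, N + - M) else if i = 2 then (M + N, N) else (M, - M + N))"
      and "g i = (\<lambda>(M, N). if i = 1 then (M, N + M) else if i = 2 then (M + - N, N) else (M, M + N))" for i
  obtain A where A: "\<And>x y z. A (x + y) z = A x (A y z)" "\<And>z. A 0 z = z"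
    "\<And>i z. i \<in> {1, 2, 3} \<Longrightarrow> A (braid_sigma i) z = f i z" "\<And>i z. i \<in> {1, 2, 3} \<Longrightarrow> A (- braid_sigma i) z = g i z"
    by (rule braid4_action[of f g])
      (auto simp: f_def g_def group_word simp del: add_uminus_conv_diff)
  \<comment> \<open>passing to inverses turns the left action into a right action\<close>
  define F where "F x = A (- x)" for x
  have add: "F (x + y) z = F y (F x z)" for x y z
    by (simp only: F_def minus_add A(1))
  have zero: "F 0 z = z" for z by (simp add: F_def A(2))
  have gens: "F (braid_sigma i) z = g i z" "F (- braid_sigma i) z = f i z" if "i \<in> {1, 2, 3}" for i z
    using that by (simp_all add: F_def A(3,4))
  have equivariant_gen: "g i (conjg_pair h z) = conjg_pair h (g i z)"
    "f i (conjg_pair h z) = conjg_pair h (f i z)" for i h z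
    by (auto simp: f_def g_def conjg_pair_def conjg_add conjg_uminus split: prod.splits
        simp del: add_uminus_conv_diff)
  have equivariant: "F x (conjg_pair h z) = conjg_pair h (F x z)" for x h z
    by (induction x arbitrary: z rule: braid4_induct)
      (simp_all only: zero add gens equivariant_gen)
  have generated: "F sigma1 z = g 1 z" "F sigma2 z = g 2 z" "F sigma3 z = g 3 z"
    "F (- sigma1) z = f 1 z" "F (- sigma2) z = f 2 z" "F (- sigma3) z = f 3 z" for z
    by (simp_all add: sigma1_def sigma2_def sigma3_def gens)
  have fib_p: "F fib_p (M, N) = conjg_pair M (M, N)" for M N
    by (simp add: fib_p_def add generated f_def g_def conjg_pair_def conjg_def group_word
        del: add_uminus_conv_diff)
  have p': "F (- fib_p) (M, N) = conjg_pair (- M) (M, N)" for M N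
    by (simp add: fib_p_def minus_add add generated f_def g_def conjg_pair_def conjg_def group_word
        del: add_uminus_conv_diff)
  have fib_q: "F fib_q (M, N) = conjg_pair N (M, N)" for M N
    by (simp add: fib_q_def conjg_def[of sigma2] add generated fib_p p' f_def g_def conjg_pair_def conjg_def group_word
        del: add_uminus_conv_diff)
  show ?thesis by (rule that[of F]) (fact add zero equivariant fib_p fib_q)+
qed

text \<open>The word $x^{n_0} y^{\pm 1} x^{n_1} y^{\pm 1} \cdots x^m$, where the list contains the exponents of $x$ each
with the sign of the following letter $y$ and the last exponent is kept apart. Powers of $y$ are split into
letters because the substitution of $xy$ for $y$ then changes only the exponents of $x$.\<close>

fun word_val :: "'a::group_add \<Rightarrow> 'a \<Rightarrow> (int \<times> bool) list \<Rightarrow> int \<Rightarrow> 'a" where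
  "word_val x y [] m = int_mult m x"
| "word_val x y ((n, e) # r) m = int_mult n x + ((if e then y else - y) + word_val x y r m)"

fun reduced_word :: "(int \<times> bool) list \<Rightarrow> bool" where
  "reduced_word ((n, e) # (n', e') # r) \<longleftrightarrow> (n' \<noteq> 0 \<or> e = e') \<and> reduced_word ((n', e') # r)"
| "reduced_word r \<longleftrightarrow> True"

lemma reduced_head: "reduced_word ((n, e) # r) \<Longrightarrow> reduced_word ((n', e) # r)"
  by (cases r) auto

lemma reduced_tail: "reduced_word (l # r) \<Longrightarrow> reduced_word r"
  by (cases "(l # r)" rule: reduced_word.cases) auto

lemma word_val_int_mult: "reduced_word r \<Longrightarrow> \<exists>r' m'. reduced_word r' \<and> int_mult k x + word_val x y r m = word_val x y r' m'"
proof (cases r)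
  case Nil
  then show ?thesis by (intro exI[of _ "[]"] exI[of _ "k + m"]) (simp add: int_mult_add)
next
  case (Cons l v)
  assume r: "reduced_word r"
  obtain n e where l: "l = (n, e)" by (cases l)
  have "reduced_word ((k + n, e) # v)" using r reduced_head unfolding Cons l by blast
  then show ?thesis unfolding Cons l
    by (intro exI[of _ "(k + n, e) # v"] exI[of _ m]) (simp add: int_mult_add add.assoc)
qed

lemma word_val_letter:
  assumes "reduced_word r"
  shows "\<exists>r' m'. reduced_word r' \<and> (if e then y else - y) + word_val x y r m = word_val x y r' m'"
proof (cases "reduced_word ((0, e) # r)")
  case True
  then show ?thesis by (intro exI[of _ "(0, e) # r"] exI[of _ m]) simp
next
  case False
  then obtain v where v: "r = (0, \<not> e) # v"
    using assms by (cases r) auto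
  then have "reduced_word v" using assms reduced_tail by blast
  then show ?thesis unfolding v
    by (intro exI[of _ v] exI[of _ m]) auto
qed

lemma fiber_normal_form: "x \<in> fiber \<Longrightarrow> \<exists>r m. reduced_word r \<and> x = word_val fib_p fib_q r m"
  unfolding fiber_def
proof (induction rule: generated.induct)
  case zero
  show ?case by (intro exI[of _ "[]"] exI[of _ 0]) simp
next
  case (add a x)
  then obtain r m where r: "reduced_word r" "x = word_val fib_p fib_q r m" by blast
  show ?case using add(1) r word_val_int_mult[OF r(1), of 1 fib_p fib_q m] word_val_letter[OF r(1), of True fib_q fib_p m] by auto
next
  case (diff a x)
  then obtain r m where r: "reduced_word r" "x = word_val fib_p fib_q r m" by blast
  show ?case using diff(1) r word_val_int_mult[OF r(1), of "- 1" fib_p fib_q m] word_val_letter[OF r(1), of False fib_q fib_p m]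
    by auto
qed

text \<open>The group of integer matrices of determinant one, an entry list standing for the rows of the matrix. As for
braids, the group operation is written as a sum.\<close>

typedef sl2 = "{(a, b, c, d). a * d - b * c = (1::int)}"
  by (rule exI[of _ "(1, 0, 0, 1)"]) simp

setup_lifting type_definition_sl2

instantiation sl2 :: group_add
begin

lift_definition zero_sl2 :: sl2 is "(1, 0, 0, 1)"
  by simp

lift_definition plus_sl2 :: "sl2 \<Rightarrow> sl2 \<Rightarrow> sl2"
  is "\<lambda>(a, b, c, d) (a', b', c', d'). (a * a' + b * c', a * b' + b * d', c * a' + d * c', c * b' + d * d')"
proof clarify
  fix a b c d a' b' c' d' :: int
  assume "a * d - b * c = 1" "a' * d' - b' * c' = 1"
  moreover have "(a * a' + b * c') * (c * b' + d * d') - (a * b' + b * d') * (c * a' + d * c') =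
      (a * d - b * c) * (a' * d' - b' * c')" by (simp add: algebra_simps)
  ultimately show "(a * a' + b * c') * (c * b' + d * d') - (a * b' + b * d') * (c * a' + d * c') = 1"
    by simp
qed

lift_definition uminus_sl2 :: "sl2 \<Rightarrow> sl2" is "\<lambda>(a, b, c, d). (d, - b, - c, a)"
  by (auto simp: algebra_simps)

definition minus_sl2 :: "sl2 \<Rightarrow> sl2 \<Rightarrow> sl2" where
  "minus_sl2 x y = x + - y"

instance
proof
  fix x y z :: sl2
  show "x + y + z = x + (y + z)" by transfer (auto simp: algebra_simps)
  show "0 + x = x" by transfer auto
  show "x + 0 = x" by transfer auto
  show "- x + x = 0" by transfer (auto simp: algebra_simps)
  show "x + - y = x - y" by (simp add: minus_sl2_def)
qed

end

lift_definition first_col :: "sl2 \<Rightarrow> int \<times> int" is "\<lambda>(a, b, c, d). (a, c)" .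

text \<open>With the entry $2$ these matrices would generate a free group as well, but the estimates of the ping-pong
argument below would be equalities in the limit; $3$ leaves room.\<close>

lift_definition upper :: sl2 is "(1, 3, 0, 1)" by simp
lift_definition lower :: sl2 is "(1, 0, 3, 1)" by simp

lemma first_col_zero: "first_col 0 = (1, 0)"
  by transfer simp

lemma first_col_upper:
  "first_col (upper + x) = (fst (first_col x) + 3 * snd (first_col x), snd (first_col x))"
  "first_col (- upper + x) = (fst (first_col x) - 3 * snd (first_col x), snd (first_col x))"
  by (transfer, auto simp: algebra_simps)+

lemma first_col_lower:
  "first_col (lower + x) = (fst (first_col x), snd (first_col x) + 3 * fst (first_col x))"
  "first_col (- lower + x) = (fst (first_col x), snd (first_col x) - 3 * fst (first_col x))"
  by (transfer, auto simp: algebra_simps)+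

lemma first_col_int_mult_upper: "first_col (int_mult n upper + x) = (fst (first_col x) + 3 * n * snd (first_col x), snd (first_col x))"
  by (induction n rule: int_induct[where k = 0])
    (simp_all add: int_mult_plus1 int_mult_minus1 add.assoc first_col_upper algebra_simps)

text \<open>A conjugate of the unipotent matrix $1 + 3 e_{12}$ determines the primitive vectors on its fixed line, and for
conjugation by $x$ these are the first column of $x$ and its negative.\<close>

lemma conjg_upper_first_col:
  assumes "conjg x upper = conjg y upper"
  shows "\<exists>\<sigma>\<in>{1, - 1}. first_col x = (\<sigma> * fst (first_col y), \<sigma> * snd (first_col y))"
proof -
  have "\<exists>\<sigma>\<in>{1, - 1}. (a :: int) = \<sigma> * a' \<and> c = \<sigma> * c'"
    if "a * a = a' * a'" "c * c = c' * c'" "a * c = a' * c'" for a c a' c'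
  proof -
    have "a = a' \<or> a = - a'" "c = c' \<or> c = - c'"
      using that(1,2) by (simp_all add: square_eq_iff)
    with that(3) show ?thesis by auto
  qed
  moreover have "fst (first_col x) * fst (first_col x) = fst (first_col y) * fst (first_col y) \<and>
    snd (first_col x) * snd (first_col x) = snd (first_col y) * snd (first_col y) \<and>
    fst (first_col x) * snd (first_col x) = fst (first_col y) * snd (first_col y)"
    using assms unfolding conjg_def by transfer (auto simp: algebra_simps)
  ultimately show ?thesis by (metis prod.collapse)
qed

lemma first_col_word_val_Cons:
  "first_col (word_val upper lower ((n, e) # r) m) =
    (fst (first_col (word_val upper lower ((0, e) # r) m)) + 3 * n * snd (first_col (word_val upper lower ((0, e) # r) m)),
     snd (first_col (word_val upper lower ((0, e) # r) m)))"
  by (simp add: first_col_int_mult_upper)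

text \<open>The ping-pong argument: after a letter $y^{\pm 1}$ the first column $(a, c)$ lies in the cone
$|c| \geq 2|a|$, on the side given by the sign of the letter. A nontrivial power of $x$ leads out of the cone, and a
further letter of the same sign stays on the same side.\<close>

lemma ping_pong:
  assumes "reduced_word ((n, e) # r)" "first_col (word_val upper lower ((0, e) # r) 0) = (a, c)"
  shows "2 * \<bar>a\<bar> \<le> \<bar>c\<bar> \<and> (if e then 0 < a * c else a * c < 0)"
  using assms
proof (induction r arbitrary: n e a c)
  case Nil
  then show ?case by (auto simp: first_col_lower[of 0, simplified] first_col_zero split: if_splits)
next
  case (Cons l r)
  obtain n' e' where l: "l = (n', e')" by (cases l)
  obtain a' c' where ac': "first_col (word_val upper lower ((0, e') # r) 0) = (a', c')" by fastforce
  have IH: "2 * \<bar>a'\<bar> \<le> \<bar>c'\<bar>" "if e' then 0 < a' * c' else a' * c' < 0"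
    using Cons.IH[OF _ ac', of n'] Cons.prems(1) l by auto
  define u where "u = a' + 3 * n' * c'"
  have "first_col (word_val upper lower (l # r) 0) = (u, c')"
    unfolding l first_col_word_val_Cons[of n'] ac' u_def by simp
  then have ac: "a = u" "c = c' + (if e then 3 * u else - 3 * u)"
    using Cons.prems(2) by (auto simp: first_col_lower split: if_splits)
  consider "n' \<noteq> 0" | "n' = 0" "e' = e" using Cons.prems(1) l by auto
  then show ?case
  proof cases
    case 1
    have c': "c' \<noteq> 0" using IH(2) by (auto split: if_splits)
    have "\<bar>c'\<bar> \<le> \<bar>n' * c'\<bar>" using 1 mult_right_mono[of 1 "\<bar>n'\<bar>" "\<bar>c'\<bar>"] by (simp add: abs_mult)
    then have u: "2 * \<bar>c'\<bar> \<le> \<bar>u\<bar>" using IH(1) unfolding u_def by linarith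
    then have "\<bar>u * c'\<bar> * 2 \<le> u * u"
      using mult_left_mono[of "2 * \<bar>c'\<bar>" "\<bar>u\<bar>" "\<bar>u\<bar>"] by (simp add: abs_mult algebra_simps)
    moreover have "0 < u * u" using u c' by (simp add: zero_less_mult_iff) linarith
    ultimately have "\<bar>u * c'\<bar> < 3 * (u * u)" by linarith
    then show ?thesis using u unfolding ac by (cases e) (auto simp: algebra_simps)
  next
    case 2
    then have u: "u = a'" by (simp add: u_def)
    define sq where "sq = a' * a'"
    have "a * c = a' * c' + (if e then 3 * sq else - 3 * sq)"
      unfolding ac u sq_def by (simp add: algebra_simps)
    moreover have "0 \<le> sq" by (simp add: sq_def)
    ultimately have "if e then 0 < a * c else a * c < 0"
      using IH(2) 2(2) by (cases e) simp_all
    moreover have "2 * \<bar>a\<bar> \<le> \<bar>c\<bar>"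
      using IH(2) 2(2) unfolding ac u
      by (cases e) (auto simp: zero_less_mult_iff mult_less_0_iff)
    ultimately show ?thesis by simp
  qed
qed

text \<open>The exponent of the first power of $x$ and the sign of the first letter $y^{\pm 1}$ can be read off from the
first column: the cone determines the exponent since different ones differ by at least $3|c|$ in the first
coordinate.\<close>

lemma ping_pong_injective:
  assumes "reduced_word r" "reduced_word r'" "\<sigma> \<in> {1, - 1 :: int}"
    and "first_col (word_val upper lower r 0) = (\<sigma> * fst (first_col (word_val upper lower r' 0)), \<sigma> * snd (first_col (word_val upper lower r' 0)))"
  shows "r = r'"
  using assms
proof (induction r arbitrary: r')
  case Nil
  show ?case
  proof (cases r')
    case (Cons l v)
    obtain n e where l: "l = (n, e)" by (cases l)
    obtain a c where ac: "first_col (word_val upper lower ((0, e) # v) 0) = (a, c)" by fastforce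
    have "c \<noteq> 0" using ping_pong[OF _ ac, of n] Nil(2) Cons l by (auto split: if_splits)
    then show ?thesis
      using Nil(3,4) unfolding Cons l first_col_word_val_Cons[of n] ac by (auto simp: first_col_zero)
  qed simp
next
  case outer: (Cons l v)
  obtain n e where l: "l = (n, e)" by (cases l)
  obtain a c where ac: "first_col (word_val upper lower ((0, e) # v) 0) = (a, c)" by fastforce
  have pp: "2 * \<bar>a\<bar> \<le> \<bar>c\<bar>" "if e then 0 < a * c else a * c < 0"
    using ping_pong[OF _ ac, of n] outer.prems(1) l by auto
  then have c0: "c \<noteq> 0" by (auto split: if_splits)
  show ?case
  proof (cases r')
    case Nil
    then show ?thesis
      using c0 outer.prems(3,4) unfolding l first_col_word_val_Cons[of n] ac by (auto simp: first_col_zero)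
  next
    case (Cons l' v')
    obtain n' e' where l': "l' = (n', e')" by (cases l')
    obtain a' c' where ac': "first_col (word_val upper lower ((0, e') # v') 0) = (a', c')" by fastforce
    have pp': "2 * \<bar>a'\<bar> \<le> \<bar>c'\<bar>" "if e' then 0 < a' * c' else a' * c' < 0"
      using ping_pong[OF _ ac', of n'] outer.prems(2) Cons l' by auto
    have eqs: "a + 3 * n * c = \<sigma> * (a' + 3 * n' * c')" "c = \<sigma> * c'"
      using outer.prems(4) unfolding Cons l l' first_col_word_val_Cons[of n] first_col_word_val_Cons[of n'] ac ac' by auto
    have \<sigma>: "\<sigma> = 1 \<or> \<sigma> = - 1" using outer.prems(3) by auto
    have "a - \<sigma> * a' = 3 * ((n' - n) * c)"
      using eqs \<sigma> by (auto simp: algebra_simps)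
    moreover have "\<bar>a - \<sigma> * a'\<bar> \<le> \<bar>c\<bar>"
      using pp(1) pp'(1) eqs(2) \<sigma> by auto
    moreover have "\<bar>c\<bar> \<le> \<bar>(n' - n) * c\<bar>" if "n \<noteq> n'"
      using that mult_right_mono[of 1 "\<bar>n' - n\<bar>" "\<bar>c\<bar>"] by (simp add: abs_mult)
    ultimately have n: "n = n'" using c0 by fastforce
    then have a: "a = \<sigma> * a'" using eqs by (simp add: algebra_simps)
    have e: "e = e'" using pp(2) pp'(2) a eqs(2) \<sigma> by (auto split: if_splits)
    have tails: "first_col (word_val upper lower v 0) = (\<sigma> * fst (first_col (word_val upper lower v' 0)), \<sigma> * snd (first_col (word_val upper lower v' 0)))"
      using ac ac' a eqs(2) unfolding e
      by (auto simp: first_col_lower prod_eq_iff algebra_simps split: if_splits)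
    have "v = v'"
      by (rule outer.IH[OF _ _ outer.prems(3) tails])
        (use outer.prems(1,2) Cons reduced_tail in blast)+
    then show ?thesis by (simp add: Cons l l' n e)
  qed
qed

text \<open>The action on pairs turns an equation between words in $p$ and $q$ into one between conjugates of a fixed
matrix by the same words in two matrices. As the stabilizer of this matrix contains the powers of $p$, the
last exponent is not determined in this way.\<close>

lemma fiber_normal_form_unique:
  assumes "reduced_word r" "reduced_word r'" "word_val fib_p fib_q r m = word_val fib_p fib_q r' m'"
  shows "r = r'"
proof -
  obtain F :: "braid4 \<Rightarrow> sl2 \<times> sl2 \<Rightarrow> sl2 \<times> sl2"
    where F: "\<And>x y z. F (x + y) z = F y (F x z)" "\<And>z. F 0 z = z"
    "\<And>x g z. F x (conjg_pair g z) = conjg_pair g (F x z)"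
    "\<And>M N. F fib_p (M, N) = conjg_pair M (M, N)"
    "\<And>M N. F fib_q (M, N) = conjg_pair N (M, N)"
    by (rule braid4_pair_action) (rule that)
  let ?z = "(upper, lower)"
  have step: "F (x + y) ?z = conjg_pair (g + h) ?z"
    if "F x ?z = conjg_pair g ?z" "F y ?z = conjg_pair h ?z" for x y g h
    by (simp only: F(1) that F(3) conjg_pair_add)
  have inverse: "F (- x) ?z = conjg_pair (- g) ?z" if "F x ?z = conjg_pair g ?z" for x g
  proof -
    have "F (- x) (F x ?z) = ?z" using F(1)[of x "- x" ?z] by (simp add: F(2))
    then have "conjg_pair (- g) (conjg_pair g (F (- x) ?z)) = conjg_pair (- g) ?z"
      by (simp only: that F(3))
    then show ?thesis by (simp add: conjg_pair_add conjg_pair_zero)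
  qed
  have zero: "F 0 ?z = conjg_pair 0 ?z" by (simp add: F(2) conjg_pair_zero)
  have int_mult: "F (int_mult n fib_p) ?z = conjg_pair (int_mult n upper) ?z" for n
    by (induction n rule: int_induct[where k = 0])
      (simp_all only: int_mult_0 zero int_mult_plus1 int_mult_minus1 step inverse F(4))
  have val: "F (word_val fib_p fib_q r m) ?z = conjg_pair (word_val upper lower r m) ?z" for r m
    by (induction upper lower r m rule: word_val.induct)
      (simp_all add: int_mult step inverse F(5))
  have col: "first_col (word_val upper lower r m) = first_col (word_val upper lower r 0)" for r m
  proof (induction r)
    case Nil
    then show ?case using first_col_int_mult_upper[of m 0] by (simp add: first_col_zero)
  next
    case (Cons l r)
    then show ?case by (cases l) (auto simp: first_col_int_mult_upper first_col_lower)
  qed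
  have "conjg (word_val upper lower r m) upper = conjg (word_val upper lower r' m') upper"
    using arg_cong[OF assms(3), of "\<lambda>x. F x ?z"] by (simp add: val conjg_pair_def)
  from conjg_upper_first_col[OF this] show ?thesis
    using ping_pong_injective[OF assms(1,2)] col by metis
qed


section \<open>The centralizer of sigma3\<close>

text \<open>The result of substituting $xy$ for $y$ in a word: $y$ contributes an $x$ to the exponent before it, while
$y^{-1}$ becomes $y^{-1} x^{-1}$ and contributes to the next exponent. The first argument carries the contribution of the
preceding letter.\<close>

fun twist_word :: "int \<Rightarrow> (int \<times> bool) list \<Rightarrow> (int \<times> bool) list" where
  "twist_word d [] = []"
| "twist_word d ((n, e) # r) = (d + n + (if e then 1 else 0), e) # twist_word (if e then 0 else - 1) r"

fun twist_end :: "int \<Rightarrow> (int \<times> bool) list \<Rightarrow> int" where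
  "twist_end d [] = d"
| "twist_end d ((n, e) # r) = twist_end (if e then 0 else - 1) r"

lemma word_val_twist_word: "int_mult d x + word_val x (x + y) r m = word_val x y (twist_word d r) (twist_end d r + m)"
proof (induction r arbitrary: d)
  case Nil
  then show ?case by (simp add: int_mult_add)
next
  case (Cons l r)
  obtain n e where l: "l = (n, e)" by (cases l)
  show ?case
  proof (cases e)
    case True
    then show ?thesis using Cons.IH[of 0] by (simp add: l int_mult_add add.assoc)
  next
    case False
    then show ?thesis using Cons.IH[of "- 1"]
      by (simp add: l int_mult_add group_word del: add_uminus_conv_diff)
  qed
qed

text \<open>The exponent between two letters of opposite signs is unchanged: such letters contribute to it both or neither,
and with opposite signs.\<close>

lemma reduced_twist_word: "reduced_word r \<Longrightarrow> reduced_word (twist_word d r)"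
  by (induction r arbitrary: d rule: reduced_word.induct) auto

lemma twist_end_cases: "twist_end d r \<in> {d, 0, - 1}"
  by (induction d r rule: twist_end.induct) auto

text \<open>This group contains $\sigma_1 = p^{-1} \sigma_3$. It is the whole centralizer of $\sigma_3$, by
\<open>centralizer_sigma3\<close> below.\<close>

definition sigma3_commuting :: "braid4 set" where "sigma3_commuting = generated {fib_p, sigma3, wrap}"

lemma sigma3_commuting_generators: "fib_p \<in> sigma3_commuting" "sigma3 \<in> sigma3_commuting" "wrap \<in> sigma3_commuting"
  by (auto simp: sigma3_commuting_def generated_incl)

lemma sigma3_commuting_add: "x \<in> sigma3_commuting \<Longrightarrow> y \<in> sigma3_commuting \<Longrightarrow> x + y \<in> sigma3_commuting"
  by (simp add: sigma3_commuting_def generated_add)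

lemma sigma3_commuting_uminus: "x \<in> sigma3_commuting \<Longrightarrow> - x \<in> sigma3_commuting"
  by (simp add: sigma3_commuting_def generated_uminus)

lemma sigma3_commuting_int_mult: "x \<in> sigma3_commuting \<Longrightarrow> int_mult n x \<in> sigma3_commuting"
  by (simp add: sigma3_commuting_def generated_int_mult)

lemma conjg_fib_q_fib_p_in_sigma3_commuting: "- fib_q + (fib_p + fib_q) \<in> sigma3_commuting"
proof -
  have "conjg wrap (- fib_p) = - fib_q + (fib_p + fib_q)"
    by (simp add: conjg_uminus conjg_wrap_fib_p group_word del: add_uminus_conv_diff)
  moreover have "conjg wrap (- fib_p) \<in> sigma3_commuting"
    unfolding conjg_def by (intro sigma3_commuting_add sigma3_commuting_uminus sigma3_commuting_generators)
  ultimately show ?thesis by simp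
qed

text \<open>In a word fixed by the substitution the contributions cancel at every exponent of $x$, so the signs of the letters
$y^{\pm 1}$ alternate and begin with $-1$. The word thus splits into powers of $p$ and of $q^{-1} p q$. The
induction treats the words that begin in the middle of a factor $q^{-1} p^n q$ along with the others; for these the
carry is $-1$.\<close>

lemma twist_word_fixed_in_sigma3_commuting:
  assumes "twist_word d r = r" "twist_end d r = 0" "d \<in> {0, - 1}"
  shows "(if d = 0 then word_val fib_p fib_q r m else - fib_q + word_val fib_p fib_q r m) \<in> sigma3_commuting"
  using assms
proof (induction r arbitrary: d)
  case Nil
  then show ?case by (simp add: sigma3_commuting_int_mult sigma3_commuting_generators)
next
  case (Cons l r)
  obtain n e where l: "l = (n, e)" by (cases l)
  consider "d = 0" "\<not> e" | "d = - 1" e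
    using Cons.prems(1,3) l by (cases e) auto
  then show ?case
  proof cases
    case 1
    have "twist_word (- 1) r = r" "twist_end (- 1) r = 0" using Cons.prems l 1 by auto
    from Cons.IH[OF this] have "- fib_q + word_val fib_p fib_q r m \<in> sigma3_commuting" by simp
    then have "int_mult n fib_p + (- fib_q + word_val fib_p fib_q r m) \<in> sigma3_commuting"
      by (rule sigma3_commuting_add[OF sigma3_commuting_int_mult[OF sigma3_commuting_generators(1)]])
    with 1 show ?thesis by (simp add: l)
  next
    case 2
    have "twist_word 0 r = r" "twist_end 0 r = 0" using Cons.prems l 2 by auto
    from Cons.IH[OF this] have IH: "word_val fib_p fib_q r m \<in> sigma3_commuting" by simp
    have "- fib_q + (fib_p + fib_q) = conjg (- fib_q) fib_p" by (simp add: conjg_def add.assoc)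
    then have "- fib_q + (int_mult n fib_p + (fib_q + word_val fib_p fib_q r m)) = int_mult n (- fib_q + (fib_p + fib_q)) + word_val fib_p fib_q r m"
      by (simp only: conjg_int_mult[symmetric]) (simp add: conjg_def add.assoc)
    also have "\<dots> \<in> sigma3_commuting" by (intro sigma3_commuting_add sigma3_commuting_int_mult conjg_fib_q_fib_p_in_sigma3_commuting IH)
    finally show ?thesis using 2 by (simp add: l)
  qed
qed

lemma fib_p_nonzero: "fib_p \<noteq> 0"
proof
  assume "fib_p = 0"
  then have "word_val fib_p fib_q [(0, True)] 0 = word_val fib_p fib_q [] 0" by (simp add: fib_q_def conjg_zero)
  from fiber_normal_form_unique[OF _ _ this] show False by simp
qed

lemma fiber_centralizer_sigma3:
  assumes "x \<in> fiber" "x + sigma3 = sigma3 + x"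
  shows "x \<in> sigma3_commuting"
proof -
  obtain r m where r: "reduced_word r" "x = word_val fib_p fib_q r m" using fiber_normal_form[OF assms(1)] by blast
  have conjg_word_val: "conjg g (word_val a b r m) = word_val (conjg g a) (conjg g b) r m"
    for g a b :: braid4 and r m
    by (induction a b r m rule: word_val.induct) (simp_all add: conjg_int_mult conjg_add conjg_uminus)
  have "conjg sigma3 x = x" unfolding conjg_eq_self_iff by (rule assms(2)[symmetric])
  then have "x = conjg sigma3 x" by simp
  also have "\<dots> = word_val fib_p fib_q (twist_word 0 r) (twist_end 0 r + m)"
    unfolding r(2) conjg_word_val conjg_sigma3_fib_p conjg_sigma3_fib_q using word_val_twist_word[of 0 fib_p fib_q r m] by simp
  finally have eq: "word_val fib_p fib_q r m = word_val fib_p fib_q (twist_word 0 r) (twist_end 0 r + m)" by (simp add: r(2))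
  from fiber_normal_form_unique[OF r(1) reduced_twist_word[OF r(1)] eq] have twist_word: "twist_word 0 r = r" by simp
  have word_val_end: "word_val fib_p fib_q r (i + m) = word_val fib_p fib_q r i + int_mult m fib_p" for r i m
    by (induction r) (auto simp: int_mult_add add.assoc)
  have "word_val fib_p fib_q r m = word_val fib_p fib_q r (m + twist_end 0 r)"
    using eq unfolding twist_word by (simp add: add.commute)
  \<comment> \<open>the carry at the end is 0 or -1, so it suffices that p is not trivial\<close>
  then have "int_mult (twist_end 0 r) fib_p = 0" by (metis word_val_end add.right_neutral add_left_imp_eq)
  then have "twist_end 0 r = 0" using twist_end_cases[of 0 r] fib_p_nonzero by auto
  with twist_word_fixed_in_sigma3_commuting[OF twist_word this, of m] show ?thesis by (simp add: r(2))
qed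

text \<open>Congruence modulo the fiber is compatible with the group operation because the fiber is normal.\<close>

lemma diff_in_fiber_add:
  assumes "x - y \<in> fiber" "x' - y' \<in> fiber"
  shows "(x + x') - (y + y') \<in> fiber"
proof -
  have "(x + x') - (y + y') = conjg x (x' - y') + (x - y)"
    by (simp add: conjg_def group_word del: add_uminus_conv_diff)
  then show ?thesis using assms by (simp add: fiber_add conjg_fiber)
qed

lemma diff_in_fiber_uminus:
  assumes "x - y \<in> fiber"
  shows "- x - (- y) \<in> fiber"
proof -
  have "- x - (- y) = conjg (- x) (- (x - y))"
    by (simp add: conjg_def group_word del: add_uminus_conv_diff)
  then show ?thesis using assms by (simp only: fiber_uminus conjg_fiber)
qed

lemma diff_in_fiber_int_mult:
  assumes "x - y \<in> fiber"
  shows "int_mult n x - int_mult n y \<in> fiber"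
  by (induction n rule: int_induct[where k = 0])
    (simp_all only: int_mult_0 int_mult_plus1 int_mult_minus1 diff_in_fiber_add diff_in_fiber_uminus assms fiber_zero diff_self)

text \<open>Modulo the fiber the braid agrees with a product of powers of \<open>wrap\<close> and $\sigma_3$, which commute with
$\sigma_3$. So the quotient is an element of the fiber that commutes with $\sigma_3$.\<close>

theorem centralizer_sigma3:
  assumes "x + sigma3 = sigma3 + x"
  shows "x \<in> sigma3_commuting"
proof -
  obtain k m n where x: "k \<in> fiber" "x = k + (int_mult m full_twist3 + int_mult n sigma1)"
    using commutes_sigma3_mod_fiber[OF assms] .
  define y where "y = int_mult m wrap + int_mult n sigma3"
  have "full_twist3 - wrap = - (- fib_q + (- fib_p + - fib_q))"
    by (simp add: wrap_eq group_word del: add_uminus_conv_diff)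
  then have wrap: "full_twist3 - wrap \<in> fiber" by (simp only: fiber_add fiber_uminus fib_p_in_fiber fib_q_in_fiber)
  have "sigma1 - sigma3 = - fib_p" by (simp add: fib_p_def minus_add group_word del: add_uminus_conv_diff)
  then have "sigma1 - sigma3 \<in> fiber" by (simp only: fiber_uminus fib_p_in_fiber)
  with wrap have "(int_mult m full_twist3 + int_mult n sigma1) - y \<in> fiber"
    unfolding y_def by (intro diff_in_fiber_add diff_in_fiber_int_mult)
  moreover have "x - y = k + ((int_mult m full_twist3 + int_mult n sigma1) - y)"
    by (simp add: x(2) group_word del: add_uminus_conv_diff)
  ultimately have "x - y \<in> fiber" using x(1) by (simp only: fiber_add)
  have "conjg sigma3 y = y"
    by (simp add: y_def conjg_add conjg_int_mult conjg_sigma3_wrap) (simp add: conjg_def)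
  moreover have "conjg sigma3 x = x" unfolding conjg_eq_self_iff by (rule assms[symmetric])
  ultimately have "conjg sigma3 (x - y) = x - y"
    by (simp only: diff_conv_add_uminus conjg_add conjg_uminus)
  with \<open>x - y \<in> fiber\<close> have "x - y \<in> sigma3_commuting"
    by (intro fiber_centralizer_sigma3) (simp_all only: conjg_eq_self_iff)
  moreover have "y \<in> sigma3_commuting" unfolding y_def by (intro sigma3_commuting_add sigma3_commuting_int_mult sigma3_commuting_generators)
  ultimately have "(x - y) + y \<in> sigma3_commuting" by (rule sigma3_commuting_add)
  then show ?thesis by simp
qed


section \<open>Laurent polynomials\<close>

text \<open>Laurent polynomials with integer coefficients form a free abelian group on the powers of $t$.\<close>

lemma laurent_induct [case_names zero tpow diff]:
  assumes "P 0" "\<And>k. P (tpow k)" "\<And>f g. P f \<Longrightarrow> P g \<Longrightarrow> P (f - g)"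
  shows "P (f :: laurent)"
  using subset_UNIV assms(1) _ assms(3)
proof (rule frag_induction)
  show "P (frag_of k)" for k using assms(2)[of k] by (simp add: tpow_def)
qed

lemma lookup_tpow: "Poly_Mapping.lookup (tpow k) m = (if m = k then 1 else 0)"
  by (simp add: tpow_def lookup_single when_def)

lemma lookup_tpow_mult: "Poly_Mapping.lookup (tpow k * f) m = Poly_Mapping.lookup f (m - k)"
  by (induction f rule: laurent_induct)
    (auto simp: tpow_mult lookup_tpow right_diff_distrib lookup_minus)

lemma tpow_mult_left: "tpow a * (tpow b * x) = tpow (a + b) * x"
  by (simp add: tpow_mult flip: mult.assoc)

lemma tpow_mult_right: "tpow a * (x * tpow b) = tpow (a + b) * x"
  by (simp add: mult.commute[of x] tpow_mult_left)

lemmas tpow_simps = tpow_mult tpow_mult_left tpow_mult_right tpow_0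

lemma lookup_laurent_bar: "Poly_Mapping.lookup (laurent_bar f) k = Poly_Mapping.lookup f (- k)"
  unfolding laurent_bar_def by (simp add: map_key.rep_eq)

lemma laurent_bar_tpow: "laurent_bar (tpow k) = tpow (- k)"
  by (rule poly_mapping_eqI) (auto simp: lookup_laurent_bar lookup_tpow)

lemma laurent_bar_zero: "laurent_bar 0 = 0"
  by (rule poly_mapping_eqI) (simp add: lookup_laurent_bar)

lemma laurent_bar_one: "laurent_bar 1 = 1"
  using laurent_bar_tpow[of 0] by (simp add: tpow_0)

lemma laurent_bar_add: "laurent_bar (f + g) = laurent_bar f + laurent_bar g"
  by (rule poly_mapping_eqI) (simp add: lookup_laurent_bar lookup_add)

lemma laurent_bar_diff: "laurent_bar (f - g) = laurent_bar f - laurent_bar g"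
  by (rule poly_mapping_eqI) (simp add: lookup_laurent_bar lookup_minus)

lemma laurent_bar_uminus: "laurent_bar (- f) = - laurent_bar f"
  by (rule poly_mapping_eqI) (simp add: lookup_laurent_bar)

lemma laurent_bar_mult: "laurent_bar (f * g) = laurent_bar f * laurent_bar g"
proof (induction f rule: laurent_induct)
  case (tpow k)
  show ?case
    by (rule poly_mapping_eqI) (simp add: lookup_laurent_bar laurent_bar_tpow lookup_tpow_mult)
qed (simp_all add: laurent_bar_zero laurent_bar_diff left_diff_distrib)

lemma laurent_bar_bar: "laurent_bar (laurent_bar f) = f"
  by (rule poly_mapping_eqI) (simp add: lookup_laurent_bar)

lemma laurent_bar_numeral: "laurent_bar (numeral n) = numeral n"
proof -
  have "laurent_bar (of_nat m) = of_nat m" for m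
    by (induction m) (simp_all add: laurent_bar_zero laurent_bar_one laurent_bar_add)
  from this[of "numeral n"] show ?thesis by simp
qed

lemmas laurent_bar_simps = laurent_bar_zero laurent_bar_one laurent_bar_tpow laurent_bar_add
  laurent_bar_diff laurent_bar_uminus laurent_bar_mult laurent_bar_bar laurent_bar_numeral

lemma laurent_at_one_sum:
  assumes "finite S" "Poly_Mapping.keys f \<subseteq> S"
  shows "laurent_at_one f = (\<Sum>k\<in>S. Poly_Mapping.lookup f k)"
  unfolding laurent_at_one_def
  by (rule sum.mono_neutral_left) (use assms in \<open>auto simp: in_keys_iff\<close>)

lemma laurent_at_one_tpow: "laurent_at_one (tpow k) = 1"
  by (simp add: laurent_at_one_def tpow_def)

lemma laurent_at_one_zero: "laurent_at_one 0 = 0"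
  by (simp add: laurent_at_one_def)

lemma laurent_at_one_diff: "laurent_at_one (f - g) = laurent_at_one f - laurent_at_one g"
proof -
  let ?S = "Poly_Mapping.keys f \<union> Poly_Mapping.keys g"
  have "laurent_at_one h = (\<Sum>k\<in>?S. Poly_Mapping.lookup h k)" if "h \<in> {f, g, f - g}" for h
    using that keys_diff[of f g] by (intro laurent_at_one_sum) auto
  then show ?thesis by (simp add: lookup_minus sum_subtractf)
qed

lemma laurent_at_one_one: "laurent_at_one 1 = 1"
  using laurent_at_one_tpow[of 0] by (simp add: tpow_0)

lemma laurent_at_one_uminus: "laurent_at_one (- f) = - laurent_at_one f"
  using laurent_at_one_diff[of 0 f] by (simp add: laurent_at_one_zero)

lemma laurent_at_one_add: "laurent_at_one (f + g) = laurent_at_one f + laurent_at_one g"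
  using laurent_at_one_diff[of f "- g"] by (simp add: laurent_at_one_uminus)

lemma laurent_at_one_mult: "laurent_at_one (f * g) = laurent_at_one f * laurent_at_one g"
proof (induction f rule: laurent_induct)
  case (tpow k)
  show ?case
    by (induction g rule: laurent_induct)
      (simp_all add: laurent_at_one_tpow laurent_at_one_zero laurent_at_one_diff tpow_mult right_diff_distrib)
qed (simp_all add: laurent_at_one_zero laurent_at_one_diff left_diff_distrib)

lemma laurent_at_one_bar: "laurent_at_one (laurent_bar f) = laurent_at_one f"
  by (induction f rule: laurent_induct)
    (simp_all add: laurent_at_one_zero laurent_at_one_tpow laurent_at_one_diff laurent_bar_simps)

lemma laurent_at_one_numeral: "laurent_at_one (numeral n) = numeral n"
proof -
  have "laurent_at_one (of_nat m) = int m" for m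
    by (induction m) (simp_all add: laurent_at_one_zero laurent_at_one_one laurent_at_one_add)
  from this[of "numeral n"] show ?thesis by simp
qed

lemmas laurent_at_one_simps = laurent_at_one_zero laurent_at_one_one laurent_at_one_tpow laurent_at_one_add
  laurent_at_one_diff laurent_at_one_uminus laurent_at_one_mult laurent_at_one_bar laurent_at_one_numeral


section \<open>Alternating products on the plane\<close>

text \<open>The power $(-t)^k$, for all integers $k$.\<close>

definition neg_t :: "int \<Rightarrow> laurent" where
  "neg_t k = (if even k then tpow k else - tpow k)"

lemma neg_t_add: "neg_t j * neg_t k = neg_t (j + k)"
  by (auto simp: neg_t_def tpow_mult)

lemma neg_t_0: "neg_t 0 = 1"
  by (simp add: neg_t_def tpow_0)

text \<open>The action of $t^{-2}$ times \<open>wrap\<close> on the plane fixed by $\sigma_3$, in the coordinates with respect to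
$w_1$ and $w_1 + (1+t) w_2 + t w_3$.\<close>

definition swap_plane :: "laurent \<times> laurent \<Rightarrow> laurent \<times> laurent" where
  "swap_plane v =
     ((1 - tpow 1 - tpow (-1)) * fst v + (tpow 2 - tpow 1 + 1 - tpow (-1)) * snd v,
      (tpow (-1) - 1) * fst v + (tpow 1 + tpow (-1) - 1) * snd v)"

definition scale :: "laurent \<Rightarrow> laurent \<times> laurent \<Rightarrow> laurent \<times> laurent" where
  "scale c v = (c * fst v, c * snd v)"

definition stretch :: "int \<Rightarrow> laurent \<times> laurent \<Rightarrow> laurent \<times> laurent" where
  "stretch k v = (neg_t k * fst v, snd v)"

lemma swap_plane_swap_plane: "swap_plane (swap_plane v) = v"
  by (cases v) (simp add: swap_plane_def algebra_simps tpow_simps)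

lemma swap_plane_scale: "swap_plane (scale c v) = scale c (swap_plane v)"
  by (simp add: swap_plane_def scale_def algebra_simps)

lemma stretch_scale: "stretch k (scale c v) = scale c (stretch k v)"
  by (simp add: stretch_def scale_def algebra_simps)

lemma stretch_stretch: "stretch j (stretch k v) = stretch (j + k) v"
  by (simp add: stretch_def neg_t_add flip: mult.assoc)

lemma stretch_0: "stretch 0 v = v"
  by (simp add: stretch_def neg_t_0)

lemma scale_scale: "scale c (scale d v) = scale (c * d) v"
  by (simp add: scale_def algebra_simps)

definition monomial_units :: "laurent set" where
  "monomial_units = range tpow \<union> uminus ` range tpow"

lemma monomial_units_mult: "c \<in> monomial_units \<Longrightarrow> d \<in> monomial_units \<Longrightarrow> c * d \<in> monomial_units"
  by (auto simp: monomial_units_def tpow_mult)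

lemma tpow_monomial_unit: "tpow k \<in> monomial_units" and neg_t_monomial_unit: "neg_t k \<in> monomial_units" and one_monomial_unit: "1 \<in> monomial_units"
  using tpow_0 by (auto simp: monomial_units_def neg_t_def intro: range_eqI[of _ _ 0])

lemma lookup_monomial_unit_mult:
  assumes "c \<in> monomial_units"
  obtains j s where "\<bar>s :: int\<bar> = 1"
    "\<And>f k. Poly_Mapping.lookup (c * f) k = s * Poly_Mapping.lookup f (k - j)"
proof -
  obtain j where "c = tpow j \<or> c = - tpow j" using assms by (auto simp: monomial_units_def)
  then show ?thesis
  proof
    assume "c = tpow j"
    then show ?thesis using that[of 1 j] by (simp add: lookup_tpow_mult)
  next
    assume "c = - tpow j"
    then show ?thesis using that[of "- 1" j] by (simp add: lookup_tpow_mult)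
  qed
qed

text \<open>The vectors obtained from $w_1$ by alternating products that begin on the left with the involution. The factor $c$
keeps track of the scalars.\<close>

inductive_set alternating :: "(laurent \<times> laurent) set" where
  base: "c \<in> monomial_units \<Longrightarrow> scale c (swap_plane (1, 0)) \<in> alternating"
| step: "c \<in> monomial_units \<Longrightarrow> v \<in> alternating \<Longrightarrow> k \<noteq> 0 \<Longrightarrow>
    scale c (swap_plane (stretch k v)) \<in> alternating"

definition orbit :: "(laurent \<times> laurent) set" where
  "orbit = {scale c (1, 0) | c. c \<in> monomial_units} \<union>
    {scale c (stretch k v) | c k v. c \<in> monomial_units \<and> v \<in> alternating}"

lemma orbit_scale:
  assumes "c \<in> monomial_units" "v \<in> orbit"
  shows "scale c v \<in> orbit"
  using assms(2) monomial_units_mult[OF assms(1)] unfolding orbit_def by (auto simp: scale_scale) blast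

lemma orbit_stretch:
  assumes "v \<in> orbit"
  shows "stretch k v \<in> orbit"
  using assms unfolding orbit_def
proof (elim UnE CollectE exE conjE)
  fix c assume "v = scale c (1, 0)" "c \<in> monomial_units"
  then have "stretch k v = scale (neg_t k * c) (1, 0)" "neg_t k * c \<in> monomial_units"
    by (simp_all add: stretch_def scale_def monomial_units_mult neg_t_monomial_unit)
  then show "stretch k v \<in> {scale c (1, 0) | c. c \<in> monomial_units} \<union>
    {scale c (stretch k v) | c k v. c \<in> monomial_units \<and> v \<in> alternating}" by blast
next
  fix c j u assume v: "v = scale c (stretch j u)" "c \<in> monomial_units" "u \<in> alternating"
  then have "stretch k v = scale c (stretch (k + j) u)"
    by (simp add: stretch_scale stretch_stretch)
  with v(2,3) show "stretch k v \<in> {scale c (1, 0) | c. c \<in> monomial_units} \<union>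
    {scale c (stretch k v) | c k v. c \<in> monomial_units \<and> v \<in> alternating}"
    by blast
qed

text \<open>If two involutions meet, the involution cancels against the one that produced the vector.\<close>

lemma orbit_swap_plane:
  assumes "v \<in> orbit"
  shows "swap_plane v \<in> orbit"
proof -
  have alternating: "u \<in> orbit" if "u \<in> alternating" for u
  proof -
    have "u = scale 1 (stretch 0 u)" by (simp add: stretch_0 scale_def)
    then show ?thesis using that one_monomial_unit unfolding orbit_def by blast
  qed
  from assms consider c where "c \<in> monomial_units" "v = scale c (1, 0)"
    | c k u where "c \<in> monomial_units" "u \<in> alternating" "v = scale c (stretch k u)"
    unfolding orbit_def by blast
  then show ?thesis
  proof cases
    case 1
    then show ?thesis by (simp add: swap_plane_scale alternating alternating.base)
  next
    case outer: 2
    show ?thesis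
    proof (cases "k = 0")
      case False
      then show ?thesis using outer
        by (simp add: swap_plane_scale alternating alternating.step)
    next
      case True
      have "swap_plane u \<in> orbit"
        using outer(2)
      proof cases
        case (base d)
        then show ?thesis unfolding orbit_def by (auto simp: swap_plane_scale swap_plane_swap_plane)
      next
        case (step d w j)
        then have "swap_plane u = scale d (stretch j w)"
          by (simp add: swap_plane_scale swap_plane_swap_plane)
        then show ?thesis using step unfolding orbit_def by blast
      qed
      then show ?thesis using outer True
        by (simp add: stretch_0 swap_plane_scale orbit_scale)
    qed
  qed
qed

definition leading :: "int \<Rightarrow> int \<Rightarrow> laurent \<Rightarrow> bool" where
  "leading n s f \<longleftrightarrow> Poly_Mapping.lookup f n = s \<and> (\<forall>k>n. Poly_Mapping.lookup f k = 0)"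

text \<open>The terms of highest degree of the involution form a matrix of rank one: they map $(x, y)$ to
$(ty - x)$ times $(t, 1)$.\<close>

lemma leading_swap_plane:
  assumes "leading n s (tpow 1 * snd v - fst v)"
    and "\<forall>k\<ge>n. Poly_Mapping.lookup (snd v) k = 0" "\<forall>k>n. Poly_Mapping.lookup (fst v) k = 0"
  shows "leading (n + 1) s (fst (swap_plane v))" "leading n s (snd (swap_plane v))"
proof -
  have s: "Poly_Mapping.lookup (snd v) (n - 1) - Poly_Mapping.lookup (fst v) n = s"
    and z: "\<And>k. n < k \<Longrightarrow> Poly_Mapping.lookup (snd v) (k - 1) = Poly_Mapping.lookup (fst v) k"
    using assms(1) by (auto simp: leading_def lookup_minus lookup_tpow_mult)
  show "leading (n + 1) s (fst (swap_plane v))"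
    using s z assms(2,3) unfolding leading_def swap_plane_def
    by (auto simp: left_diff_distrib distrib_right lookup_add lookup_minus lookup_tpow_mult)
  show "leading n s (snd (swap_plane v))"
    using s z assms(2,3) unfolding leading_def swap_plane_def
    by (auto simp: left_diff_distrib distrib_right lookup_add lookup_minus lookup_tpow_mult)
qed

lemma leading_monomial_unit_mult:
  assumes "leading n s f" "c \<in> monomial_units" "\<bar>s\<bar> = 1"
  shows "\<exists>n' s'. \<bar>s'\<bar> = 1 \<and> leading n' s' (c * f)"
proof -
  obtain j r where r: "\<bar>r :: int\<bar> = 1"
    "\<And>f k. Poly_Mapping.lookup (c * f) k = r * Poly_Mapping.lookup f (k - j)"
    using lookup_monomial_unit_mult[OF assms(2)] by metis
  then have "leading (n + j) (r * s) (c * f)" using assms(1) by (simp add: leading_def)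
  then show ?thesis using r(1) assms(3) by (intro exI[of _ "n + j"] exI[of _ "r * s"]) (simp add: abs_mult)
qed

lemma lookup_neg_t_mult:
  "Poly_Mapping.lookup (neg_t k * f) m = (if even k then 1 else - 1) * Poly_Mapping.lookup f (m - k)"
  by (simp add: neg_t_def lookup_tpow_mult)

text \<open>After an involution the coordinates have degrees $n$ and $n - 1$ and the same leading coefficient. Multiplying the
first one by $(-t)^k$ with $k \neq 0$ destroys the equality of the degrees of $x$ and $ty$, so in $ty - x$ there is
no cancellation and the leading coefficient remains a unit.\<close>

lemma alternating_leading:
  assumes "v \<in> alternating"
  shows "\<exists>n s. \<bar>s\<bar> = 1 \<and> leading n s (fst v) \<and> leading (n - 1) s (snd v)"
proof -
  \<comment> \<open>scalars and the involution together, applied to a vector with a unit leading coefficient in \<open>t y - x\<close>\<close>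
  have scaled: "\<exists>m r. \<bar>r\<bar> = 1 \<and> leading m r (fst (scale c (swap_plane v))) \<and>
      leading (m - 1) r (snd (scale c (swap_plane v)))"
    if c: "c \<in> monomial_units" and s: "\<bar>s\<bar> = 1" and lead: "leading n s (tpow 1 * snd v - fst v)"
      "\<forall>k\<ge>n. Poly_Mapping.lookup (snd v) k = 0" "\<forall>k>n. Poly_Mapping.lookup (fst v) k = 0"
    for c v n s
  proof -
    obtain j r where r: "\<bar>r :: int\<bar> = 1"
      "\<And>f k. Poly_Mapping.lookup (c * f) k = r * Poly_Mapping.lookup f (k - j)"
      using lookup_monomial_unit_mult[OF c] by metis
    then have "leading (n + 1 + j) (r * s) (fst (scale c (swap_plane v)))"
      "leading (n + j) (r * s) (snd (scale c (swap_plane v)))"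
      using leading_swap_plane[OF lead] by (simp_all add: leading_def scale_def)
    then show ?thesis using r(1) s
      by (intro exI[of _ "n + 1 + j"] exI[of _ "r * s"]) (simp add: abs_mult)
  qed
  show ?thesis
    using assms
  proof (induction rule: alternating.induct)
    case (base c)
    have "Poly_Mapping.lookup (1 :: laurent) k = (if k = 0 then 1 else 0)" for k
      using lookup_tpow[of 0 k] by (simp add: tpow_0)
    then show ?case
      by (intro scaled[OF base, of "- 1" 0]) (auto simp: leading_def)
  next
    case (step c v k)
    then obtain n s where s: "\<bar>s\<bar> = 1" "leading n s (fst v)" "leading (n - 1) s (snd v)" by blast
    show ?case
    proof (cases "0 < k")
      case True
      then show ?thesis
        using s by (intro scaled[OF step(1), of "(if even k then - s else s)" "n + k"])
          (auto simp: leading_def stretch_def lookup_minus lookup_tpow_mult lookup_neg_t_mult)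
    next
      case False
      then show ?thesis
        using s step(3) by (intro scaled[OF step(1), of s n])
          (auto simp: leading_def stretch_def lookup_minus lookup_tpow_mult lookup_neg_t_mult)
    qed
  qed
qed

lemma orbit_leading:
  assumes "v \<in> orbit"
  shows "\<exists>n s. \<bar>s\<bar> = 1 \<and> leading n s (fst v)"
proof -
  from assms consider c where "c \<in> monomial_units" "v = scale c (1, 0)"
    | c k u where "c \<in> monomial_units" "u \<in> alternating" "v = scale c (stretch k u)"
    unfolding orbit_def by blast
  then show ?thesis
  proof cases
    case 1
    have "leading 0 1 (1 :: laurent)"
      using lookup_tpow[of 0] by (simp add: leading_def tpow_0)
    from leading_monomial_unit_mult[OF this 1(1)] show ?thesis by (simp add: 1(2) scale_def)
  next
    case 2
    obtain n s where "\<bar>s\<bar> = 1" "leading n s (fst u)" using alternating_leading[OF 2(2)] by blast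
    from leading_monomial_unit_mult[OF this(2) monomial_units_mult[OF 2(1) neg_t_monomial_unit] this(1)]
    show ?thesis by (simp add: 2(3) scale_def stretch_def mult.assoc)
  qed
qed


section \<open>The centralizer of sigma3 in the Burau representation\<close>

definition burau :: "braid4 \<Rightarrow> laurent mat" where
  "burau x = reduced_burau 4 (Rep_braid4 x)"

lemma burau_carrier: "burau x \<in> carrier_mat 3 3"
  using hom_in_carrier[OF reduced_burau_hom Rep_braid4, of x]
  by (auto simp: burau_def GL_carrier)

lemma burau_add: "burau (x + y) = burau x * burau y"
  using hom_mult[OF reduced_burau_hom Rep_braid4 Rep_braid4, of x y]
  by (simp add: burau_def plus_braid4.rep_eq)

lemma burau_zero: "burau 0 = 1\<^sub>m 3"
proof -
  have "Rep_braid4 0 = braid_rel 4 `` {[]}" by (simp add: zero_braid4.rep_eq braid_group_one)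
  moreover have "[] \<in> braid_words 4" by (simp add: braid_words_def)
  ultimately show ?thesis by (simp add: burau_def reduced_burau_class)
qed

lemma burau_braid_sigma:
  assumes "i \<in> {1..<4}"
  shows "burau (braid_sigma i) = reduced_burau_gen 4 i"
proof -
  have "[(i, True)] \<in> braid_words 4" using assms by (auto simp: braid_words_def)
  then show ?thesis
    using assms by (simp add: burau_def braid_sigma_def Abs_braid4_inverse braid_gen_def braid_class_carrier
        flip: reduced_burau_braid_gen)
qed

definition vec3 :: "laurent \<Rightarrow> laurent \<Rightarrow> laurent \<Rightarrow> laurent vec" where
  "vec3 a b c = vec 3 ((!) [a, b, c])"

lemma vec3_carrier: "vec3 a b c \<in> carrier_vec 3"
  by (simp add: vec3_def)

lemma burau_generators:
  "burau sigma1 *\<^sub>v vec3 a b c = vec3 (b - tpow 1 * a) b c"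
  "burau sigma2 *\<^sub>v vec3 a b c = vec3 a (tpow 1 * a - tpow 1 * b + c) c"
  "burau sigma3 *\<^sub>v vec3 a b c = vec3 a b (tpow 1 * b - tpow 1 * c)"
proof -
  have idx: "i = 0 \<or> i = 1 \<or> i = 2" if "i < 3" for i :: nat using that by linarith
  have sum3: "(\<Sum>k<3. f k) = f 0 + f 1 + f 2" for f :: "nat \<Rightarrow> laurent"
    by (simp add: eval_nat_numeral)
  show "burau sigma1 *\<^sub>v vec3 a b c = vec3 (b - tpow 1 * a) b c"
  "burau sigma2 *\<^sub>v vec3 a b c = vec3 a (tpow 1 * a - tpow 1 * b + c) c"
  "burau sigma3 *\<^sub>v vec3 a b c = vec3 a b (tpow 1 * b - tpow 1 * c)"
    by (rule eq_vecI; auto simp: sigma1_def sigma2_def sigma3_def burau_braid_sigma reduced_burau_gen_def vec3_def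
        scalar_prod_def sum3 dest!: idx simp flip: lessThan_atLeast0)+
qed

text \<open>The vector with coordinates $v$ in the basis $w_1$, $w_1 + (1+t) w_2 + t w_3$ of the eigenspace of $\sigma_3$ for
the eigenvalue one.\<close>

definition plane :: "laurent \<times> laurent \<Rightarrow> laurent vec" where
  "plane v = vec3 (fst v + snd v) ((1 + tpow 1) * snd v) (tpow 1 * snd v)"

lemma burau_add_vec: "u \<in> carrier_vec 3 \<Longrightarrow> burau (x + y) *\<^sub>v u = burau x *\<^sub>v (burau y *\<^sub>v u)"
  using burau_carrier[of x] burau_carrier[of y] by (simp add: burau_add)

lemma burau_uminus_vec:
  assumes "burau x *\<^sub>v u = w" "u \<in> carrier_vec 3"
  shows "burau (- x) *\<^sub>v w = u"
  using burau_add_vec[OF assms(2), of "- x" x] assms by (simp add: burau_zero)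

lemma plane_carrier: "plane v \<in> carrier_vec 3"
  by (simp add: plane_def vec3_carrier)

lemma burau_sigma1_plane: "burau sigma1 *\<^sub>v plane v = plane (stretch 1 v)"
  by (simp add: plane_def burau_generators stretch_def neg_t_def algebra_simps)

lemma burau_sigma3_plane: "burau sigma3 *\<^sub>v plane v = plane v"
  by (simp add: plane_def burau_generators algebra_simps)

lemma burau_fib_p_plane: "burau fib_p *\<^sub>v plane v = plane (stretch (- 1) v)"
proof -
  have "burau sigma1 *\<^sub>v plane (stretch (- 1) v) = plane v"
    by (simp add: burau_sigma1_plane stretch_stretch stretch_0)
  from burau_uminus_vec[OF this plane_carrier] show ?thesis
    by (simp add: fib_p_def burau_add_vec plane_carrier burau_sigma3_plane del: add_uminus_conv_diff)
qed

lemma burau_wrap_plane: "burau wrap *\<^sub>v plane v = plane (scale (tpow 2) (swap_plane v))"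
  by (simp add: wrap_def burau_add_vec vec3_carrier plane_def burau_generators scale_def swap_plane_def)
    (simp add: algebra_simps tpow_simps)

lemma burau_sigma3_commuting_orbit:
  assumes "x \<in> sigma3_commuting" "v \<in> orbit"
  shows "\<exists>u\<in>orbit. burau x *\<^sub>v plane v = plane u"
proof -
  define Inv where "Inv = (\<lambda>x. \<forall>v\<in>orbit. \<exists>u\<in>orbit. burau x *\<^sub>v plane v = plane u)"
  have add: "Inv (x + y)" if "Inv x" "Inv y" for x y
    using that unfolding Inv_def by (fastforce simp: burau_add_vec plane_carrier)
  have "burau (- fib_p) *\<^sub>v plane v = plane (stretch 1 v)" for v
    using burau_uminus_vec[OF burau_fib_p_plane plane_carrier, of "stretch 1 v"]
    by (simp add: stretch_stretch stretch_0)
  then have fib_p: "Inv fib_p" "Inv (- fib_p)"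
    unfolding Inv_def using orbit_stretch by (simp_all add: burau_fib_p_plane) blast+
  have sigma3: "Inv sigma3" "Inv (- sigma3)"
    unfolding Inv_def using burau_uminus_vec[OF burau_sigma3_plane plane_carrier]
    by (auto simp: burau_sigma3_plane)
  have "burau (- wrap) *\<^sub>v plane v = plane (scale (tpow (- 2)) (swap_plane v))" for v
    using burau_uminus_vec[OF burau_wrap_plane plane_carrier, of "scale (tpow (- 2)) (swap_plane v)"]
    by (simp add: swap_plane_scale swap_plane_swap_plane scale_scale tpow_simps)
      (simp add: scale_def)
  then have wrap: "Inv wrap" "Inv (- wrap)"
    unfolding Inv_def using orbit_swap_plane orbit_scale[OF tpow_monomial_unit] by (simp_all add: burau_wrap_plane) blast+
  have "Inv 0" unfolding Inv_def burau_zero using one_mult_mat_vec[OF plane_carrier] by metis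
  with assms(1) have "Inv x"
    unfolding sigma3_commuting_def by (induction rule: generated.induct) (auto intro: add fib_p sigma3 wrap)
  then show ?thesis using assms(2) by (simp add: Inv_def)
qed

text \<open>The third coordinate of a vector in the plane is $t$ times its second plane coordinate $y$, and the first is the
sum of both plane coordinates. So $a - y$ is the coefficient of $w_1$.\<close>

lemma centralizer_leading:
  assumes "x + sigma3 = sigma3 + x" "burau x *\<^sub>v vec3 1 0 0 = vec3 a b (tpow 1 * y)"
  shows "\<exists>n s. \<bar>s\<bar> = 1 \<and> leading n s (a - y)"
proof -
  have "(1, 0) = scale 1 (1 :: laurent, 0 :: laurent)" by (simp add: scale_def)
  then have "(1, 0) \<in> orbit" using one_monomial_unit unfolding orbit_def by blast
  from burau_sigma3_commuting_orbit[OF centralizer_sigma3[OF assms(1)] this]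
  obtain v where v: "v \<in> orbit" "burau x *\<^sub>v vec3 1 0 0 = plane v"
    by (auto simp: plane_def)
  then have eq: "vec3 a b (tpow 1 * y) = plane v" using assms(2) by simp
  have "a = fst v + snd v" "tpow 1 * y = tpow 1 * snd v"
    using arg_cong[OF eq, of "\<lambda>u. u $ 0"] arg_cong[OF eq, of "\<lambda>u. u $ 2"]
    by (simp_all add: plane_def vec3_def)
  moreover from this(2) have "tpow (- 1) * (tpow 1 * y) = tpow (- 1) * (tpow 1 * snd v)" by simp
  ultimately have "a - y = fst v" by (simp add: tpow_simps)
  then show ?thesis using orbit_leading[OF v(1)] by simp
qed


section \<open>Unitary reflections\<close>

text \<open>The identity minus the matrix of rank one with column $u$ and row $f$. With $f u = 1 + t$ it is a
complex reflection whose nontrivial eigenvalue is $-t$.\<close>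

definition reflection :: "nat \<Rightarrow> (nat \<Rightarrow> laurent) \<Rightarrow> (nat \<Rightarrow> laurent) \<Rightarrow> laurent mat" where
  "reflection n u f = mat n n (\<lambda>(i, j). (if i = j then 1 else 0) - u i * f j)"

lemma reflection_carrier: "reflection n u f \<in> carrier_mat n n"
  by (simp add: reflection_def)

lemma reflection_mult_right:
  assumes "i < n" "j < dim_col B" "dim_row B = n"
  shows "(reflection n u f * B) $$ (i, j) = B $$ (i, j) - u i * (\<Sum>k<n. f k * B $$ (k, j))"
proof -
  have "(reflection n u f * B) $$ (i, j) =
      (\<Sum>k<n. ((if i = k then 1 else 0) - u i * f k) * B $$ (k, j))"
    using assms by (simp add: reflection_def scalar_prod_def lessThan_atLeast0)
  also have "\<dots> = (\<Sum>k<n. (if i = k then B $$ (k, j) else 0) - u i * (f k * B $$ (k, j)))"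
    by (intro sum.cong) (auto simp: algebra_simps)
  also have "\<dots> = B $$ (i, j) - u i * (\<Sum>k<n. f k * B $$ (k, j))"
    using assms(1) by (simp add: sum_subtractf sum_distrib_left)
  finally show ?thesis .
qed

lemma reflection_mult_left:
  assumes "i < dim_row B" "j < n" "dim_col B = n"
  shows "(B * reflection n u f) $$ (i, j) = B $$ (i, j) - (\<Sum>k<n. B $$ (i, k) * u k) * f j"
proof -
  have "(B * reflection n u f) $$ (i, j) =
      (\<Sum>k<n. B $$ (i, k) * ((if k = j then 1 else 0) - u k * f j))"
    using assms by (simp add: reflection_def scalar_prod_def lessThan_atLeast0)
  also have "\<dots> = (\<Sum>k<n. (if k = j then B $$ (i, k) else 0) - B $$ (i, k) * u k * f j)"
    by (intro sum.cong) (auto simp: algebra_simps)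
  also have "\<dots> = B $$ (i, j) - (\<Sum>k<n. B $$ (i, k) * u k) * f j"
    using assms(2) by (simp add: sum_subtractf sum_distrib_right)
  finally show ?thesis .
qed

text \<open>The inverse is the reflection in which $u$ is replaced by $t^{-1} u$: in the product of the two, the rank-one
terms have the coefficient $1 + t^{-1} - t^{-1}(1 + t) = 0$.\<close>

lemma reflection_GL:
  assumes "(\<Sum>k<n. f k * u k) = 1 + tpow 1"
  shows "reflection n u f \<in> carrier (GL n)"
proof -
  let ?R = "reflection n u f" and ?S = "reflection n (\<lambda>i. tpow (- 1) * u i) f"
  have t: "tpow (- 1) * (1 + tpow 1) = 1 + tpow (- 1)" by (simp add: algebra_simps tpow_simps)
  have sum: "(\<Sum>k<n. f k * ?S $$ (k, j)) = f j - (1 + tpow (- 1)) * f j"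
      "(\<Sum>k<n. f k * ?R $$ (k, j)) = f j - (1 + tpow 1) * f j" if "j < n" for j
  proof -
    have "(\<Sum>k<n. f k * ?S $$ (k, j)) =
        (\<Sum>k<n. (if k = j then f k else 0) - tpow (- 1) * (f k * u k) * f j)"
      using that by (intro sum.cong) (auto simp: reflection_def algebra_simps)
    also have "\<dots> = f j - tpow (- 1) * (\<Sum>k<n. f k * u k) * f j"
      using that by (simp add: sum_subtractf sum_distrib_left sum_distrib_right)
    finally show "(\<Sum>k<n. f k * ?S $$ (k, j)) = f j - (1 + tpow (- 1)) * f j"
      by (simp only: assms t)
    have "(\<Sum>k<n. f k * ?R $$ (k, j)) = (\<Sum>k<n. (if k = j then f k else 0) - (f k * u k) * f j)"
      using that by (intro sum.cong) (auto simp: reflection_def algebra_simps)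
    also have "\<dots> = f j - (\<Sum>k<n. f k * u k) * f j"
      using that by (simp add: sum_subtractf sum_distrib_left sum_distrib_right)
    finally show "(\<Sum>k<n. f k * ?R $$ (k, j)) = f j - (1 + tpow 1) * f j"
      by (simp only: assms)
  qed
  have "?R * ?S = 1\<^sub>m n"
  proof (rule eq_matI)
    fix i j assume "i < dim_row (1\<^sub>m n :: laurent mat)" "j < dim_col (1\<^sub>m n :: laurent mat)"
    then show "(?R * ?S) $$ (i, j) = 1\<^sub>m n $$ (i, j)"
      using sum(1)[of j] by (subst reflection_mult_right) (auto simp: reflection_def algebra_simps)
  qed (simp_all add: reflection_def)
  moreover have "?S * ?R = 1\<^sub>m n"
  proof (rule eq_matI)
    fix i j assume "i < dim_row (1\<^sub>m n :: laurent mat)" "j < dim_col (1\<^sub>m n :: laurent mat)"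
    then show "(?S * ?R) $$ (i, j) = 1\<^sub>m n $$ (i, j)"
      using sum(2)[of j]
      by (subst reflection_mult_right) (auto simp: reflection_def algebra_simps tpow_simps)
  qed (simp_all add: reflection_def)
  ultimately show ?thesis
    unfolding GL_carrier using reflection_carrier by blast
qed

text \<open>If $f$ is $1 + t$ times the Hermitian dual of $u$, the terms of $\bar R J R^T - J$ are multiples of $\bar u u^T$
with total coefficient $(1 + t)(1 + t^{-1}) - (1 + t) - (1 + t^{-1}) = 0$.\<close>

lemma reflection_Gamma:
  assumes norm: "(\<Sum>k<n. f k * u k) = 1 + tpow 1"
    and v: "(\<Sum>k<n. tpow (int (Suc k)) * u k) = 0"
    and ones: "(\<Sum>k<n. f k) = 0"
    and J: "\<And>i. i < n \<Longrightarrow> (\<Sum>k<n. J_mat n $$ (i, k) * f k) = (1 + tpow 1) * laurent_bar (u i)"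
    and at_one: "map_mat laurent_at_one (reflection n u f) \<in> permutation_mats n"
  shows "reflection n u f \<in> Gamma n"
proof -
  let ?R = "reflection n u f"
  have vR: "mat_of_row (v_vec n) * ?R = mat_of_row (v_vec n)"
  proof (rule eq_matI)
    fix i j assume "i < dim_row (mat_of_row (v_vec n))" "j < dim_col (mat_of_row (v_vec n))"
    then show "(mat_of_row (v_vec n) * ?R) $$ (i, j) = mat_of_row (v_vec n) $$ (i, j)"
      using v by (subst reflection_mult_left) (auto simp: v_vec_def mat_of_row_def)
  qed (simp_all add: reflection_def v_vec_def)
  have R1: "?R *\<^sub>v ones_vec n = ones_vec n"
  proof (rule eq_vecI)
    fix i assume "i < dim_vec (ones_vec n)"
    then have i: "i < n" by (simp add: ones_vec_def)
    have "(?R *\<^sub>v ones_vec n) $ i = (\<Sum>k<n. (if i = k then 1 else 0) - u i * f k)"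
      using i by (simp add: reflection_def ones_vec_def scalar_prod_def lessThan_atLeast0)
    also have "\<dots> = 1 - u i * (\<Sum>k<n. f k)"
      using i by (simp add: sum_subtractf sum_distrib_left)
    finally show "(?R *\<^sub>v ones_vec n) $ i = ones_vec n $ i" using i ones by (simp add: ones_vec_def)
  qed (simp add: reflection_def ones_vec_def)
  have J_carrier: "J_mat n \<in> carrier_mat n n" by (simp add: J_mat_def)
  have bar_R: "map_mat laurent_bar ?R = reflection n (\<lambda>i. laurent_bar (u i)) (\<lambda>i. laurent_bar (f i))"
    by (rule eq_matI) (auto simp: reflection_def laurent_bar_simps)
  have RT: "transpose_mat ?R = reflection n f u"
    by (rule eq_matI) (auto simp: reflection_def mult.commute)
  \<comment> \<open>as J is Hermitian, the conjugate of the assumption on J describes the product from the left\<close>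
  have bar_sum: "laurent_bar (sum g S) = (\<Sum>k\<in>S. laurent_bar (g k))" for g :: "nat \<Rightarrow> laurent" and S
    by (induction S rule: infinite_finite_induct) (simp_all add: laurent_bar_simps)
  have J_bar: "(\<Sum>k<n. laurent_bar (f k) * J_mat n $$ (k, j)) = (1 + tpow (- 1)) * u j" if "j < n" for j
  proof -
    have "(\<Sum>k<n. laurent_bar (f k) * J_mat n $$ (k, j)) =
        (\<Sum>k<n. laurent_bar (J_mat n $$ (j, k) * f k))"
      using that by (intro sum.cong) (auto simp: J_mat_def laurent_bar_simps)
    also have "\<dots> = laurent_bar ((1 + tpow 1) * laurent_bar (u j))"
      by (simp only: bar_sum[symmetric] J[OF that])
    finally show ?thesis by (simp add: laurent_bar_simps)
  qed
  have "map_mat laurent_bar ?R * J_mat n * transpose_mat ?R = J_mat n"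
  proof (rule eq_matI)
    fix i j assume "i < dim_row (J_mat n)" "j < dim_col (J_mat n)"
    then have ij: "i < n" "j < n" by (auto simp: J_mat_def)
    have row: "(map_mat laurent_bar ?R * J_mat n) $$ (i, k) =
        J_mat n $$ (i, k) - laurent_bar (u i) * ((1 + tpow (- 1)) * u k)" if "k < n" for k
      using that ij J_bar J_carrier unfolding bar_R by (subst reflection_mult_right) auto
    have "(map_mat laurent_bar ?R * J_mat n * transpose_mat ?R) $$ (i, j) =
        (map_mat laurent_bar ?R * J_mat n) $$ (i, j) -
        (\<Sum>k<n. (map_mat laurent_bar ?R * J_mat n) $$ (i, k) * f k) * u j"
      unfolding RT using ij J_carrier by (subst reflection_mult_left) (auto simp: bar_R reflection_def)
    also have "(\<Sum>k<n. (map_mat laurent_bar ?R * J_mat n) $$ (i, k) * f k) =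
        (\<Sum>k<n. J_mat n $$ (i, k) * f k) - (\<Sum>k<n. laurent_bar (u i) * (1 + tpow (- 1)) * (f k * u k))"
      unfolding sum_subtractf[symmetric] by (intro sum.cong) (auto simp: row algebra_simps)
    also have "\<dots> = (1 + tpow 1) * laurent_bar (u i) - laurent_bar (u i) * (1 + tpow (- 1)) * (1 + tpow 1)"
      by (simp only: sum_distrib_left[symmetric] norm J[OF ij(1)])
    finally show "(map_mat laurent_bar ?R * J_mat n * transpose_mat ?R) $$ (i, j) = J_mat n $$ (i, j)"
      unfolding row[OF ij(2)] by (simp add: algebra_simps tpow_simps)
  qed (simp_all add: reflection_def J_mat_def)
  then show ?thesis
    unfolding Gamma_def using reflection_GL[OF norm] vR R1 at_one by simp
qed


section \<open>Reflections of the Burau module\<close>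

definition root_coords :: "laurent \<Rightarrow> laurent \<Rightarrow> laurent \<Rightarrow> nat \<Rightarrow> laurent" where
  "root_coords x y z = (!) [x, y, z]"

text \<open>A multiple of the Hermitian form of the Burau module, evaluated on the basis vectors $w_j$ in the linear argument and on
$x w_1 + y w_2 + z w_3$ in the conjugate-linear one. It is normalized such that each $w_i$ has norm
$1 + t$ and the reflection in $w_i$ is $\sigma_i$.\<close>

definition root_form :: "laurent \<Rightarrow> laurent \<Rightarrow> laurent \<Rightarrow> nat \<Rightarrow> laurent" where
  "root_form x y z = (!)
     [(1 + tpow 1) * laurent_bar x - tpow 1 * laurent_bar y,
      (1 + tpow 1) * laurent_bar y - laurent_bar x - tpow 1 * laurent_bar z,
      (1 + tpow 1) * laurent_bar z - laurent_bar y]"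

text \<open>The vector $x w_1 + y w_2 + z w_3$ in the standard basis.\<close>

definition ambient_coords :: "laurent \<Rightarrow> laurent \<Rightarrow> laurent \<Rightarrow> nat \<Rightarrow> laurent" where
  "ambient_coords x y z = (!)
     [x, tpow (- 1) * y - tpow (- 1) * x, tpow (- 2) * z - tpow (- 2) * y, - tpow (- 3) * z]"

text \<open>The conjugate-linear extension of the rows $t^i (e_i - e_{i+1})$ that belong to the reflections
$\sigma_i$ in the unreduced Burau representation. Its restriction to the span of the $w_i$ is \<open>root_form\<close>.\<close>

definition ambient_form :: "laurent \<Rightarrow> laurent \<Rightarrow> laurent \<Rightarrow> nat \<Rightarrow> laurent" where
  "ambient_form x y z = (!)
     [tpow 1 * laurent_bar x, tpow 2 * laurent_bar y - tpow 1 * laurent_bar x,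
      tpow 3 * laurent_bar z - tpow 2 * laurent_bar y, - tpow 3 * laurent_bar z]"

definition root_reflection :: "laurent \<Rightarrow> laurent \<Rightarrow> laurent \<Rightarrow> laurent mat" where
  "root_reflection x y z = reflection 3 (root_coords x y z) (root_form x y z)"

lemma sum_less_3: "(\<Sum>k<3::nat. f k) = f 0 + f 1 + (f 2 :: 'a::comm_monoid_add)"
  by (simp add: eval_nat_numeral add.assoc)

lemma sum_less_4: "(\<Sum>k<4::nat. f k) = f 0 + f 1 + f 2 + (f 3 :: 'a::comm_monoid_add)"
  by (simp add: eval_nat_numeral add.assoc)

lemma less_3_cases: "(i :: nat) < 3 \<Longrightarrow> i = 0 \<or> i = 1 \<or> i = 2"
  by linarith

lemma less_4_cases: "(i :: nat) < 4 \<Longrightarrow> i = 0 \<or> i = 1 \<or> i = 2 \<or> i = 3"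
  by linarith

lemma w_mat_entry: "i < 4 \<Longrightarrow> j < 3 \<Longrightarrow> w_mat 4 $$ (i, j) = w_vec 4 (Suc j) $ i"
  by (simp add: w_mat_def mat_of_cols_index nth_upt)

lemma w_mat_carrier: "w_mat 4 \<in> carrier_mat 4 3"
  by (simp add: w_mat_def mat_of_cols_def)

text \<open>At $t = 1$ the reflection in $e_i - e_{i+1}$ is the permutation matrix of a transposition.\<close>

lemma ambient_at_one:
  assumes "(laurent_at_one x, laurent_at_one y, laurent_at_one z) \<in> {(1, 0, 0), (0, 1, 0), (0, 0, 1)}"
  shows "map_mat laurent_at_one (reflection 4 (ambient_coords x y z) (ambient_form x y z)) \<in> permutation_mats 4"
proof -
  define i :: nat where "i = (if laurent_at_one x = 1 then 0 else if laurent_at_one y = 1 then 1 else 2)"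
  have i: "i < 3" "laurent_at_one x = (if i = 0 then 1 else 0)"
    "laurent_at_one y = (if i = 1 then 1 else 0)" "laurent_at_one z = (if i = 2 then 1 else 0)"
    using assms by (auto simp: i_def)
  have entries: "laurent_at_one (ambient_coords x y z k) = (if k = i then 1 else if k = Suc i then - 1 else 0)"
    "laurent_at_one (ambient_form x y z k) = (if k = i then 1 else if k = Suc i then - 1 else 0)"
    if "k < 4" for k
    using less_4_cases[OF that] less_3_cases[OF i(1)]
    by (elim disjE; simp add: ambient_coords_def ambient_form_def laurent_at_one_simps i(2-4))+
  have "Transposition.transpose i (Suc i) permutes {..<4}"
    by (rule permutes_swap_id) (use i(1) in auto)
  moreover have "map_mat laurent_at_one (reflection 4 (ambient_coords x y z) (ambient_form x y z)) =
      mat 4 4 (\<lambda>(r, c). if r = Transposition.transpose i (Suc i) c then 1 else 0)"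
  proof (rule eq_matI)
    fix r c :: nat
    assume "r < dim_row (mat 4 4 (\<lambda>(r, c). if r = Transposition.transpose i (Suc i) c then 1 else 0 :: int))"
      "c < dim_col (mat 4 4 (\<lambda>(r, c). if r = Transposition.transpose i (Suc i) c then 1 else 0 :: int))"
    then have rc: "r < 4" "c < 4" by auto
    have "map_mat laurent_at_one (reflection 4 (ambient_coords x y z) (ambient_form x y z)) $$ (r, c) =
        (if r = c then 1 else 0) - laurent_at_one (ambient_coords x y z r) * laurent_at_one (ambient_form x y z c)"
      using rc by (simp add: reflection_def laurent_at_one_simps)
    then show "map_mat laurent_at_one (reflection 4 (ambient_coords x y z) (ambient_form x y z)) $$ (r, c) =
        mat 4 4 (\<lambda>(r, c). if r = Transposition.transpose i (Suc i) c then 1 else 0) $$ (r, c)"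
      using rc by (auto simp: entries Transposition.transpose_def)
  qed (simp_all add: reflection_def)
  ultimately show ?thesis unfolding permutation_mats_def by blast
qed

lemma root_norm:
  "(\<Sum>k<4. ambient_form x y z k * ambient_coords x y z k) = (\<Sum>k<3. root_form x y z k * root_coords x y z k)"
  by (simp add: sum_less_3 sum_less_4 ambient_form_def ambient_coords_def root_form_def root_coords_def
      algebra_simps tpow_simps)

text \<open>The unitary reflection in a vector of the Burau module extends to the ambient module, since its linear form does.\<close>

lemma root_reflection_Gamma':
  assumes norm: "(\<Sum>k<3. root_form x y z k * root_coords x y z k) = 1 + tpow 1"
    and at_one: "(laurent_at_one x, laurent_at_one y, laurent_at_one z) \<in> {(1, 0, 0), (0, 1, 0), (0, 0, 1)}"
  shows "root_reflection x y z \<in> Gamma' 4"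
proof -
  let ?u = "ambient_coords x y z" and ?f = "ambient_form x y z"
  have "reflection 4 ?u ?f \<in> Gamma 4"
  proof (rule reflection_Gamma)
    show "(\<Sum>k<4. ?f k * ?u k) = 1 + tpow 1" by (simp only: root_norm norm)
    show "(\<Sum>k<4. tpow (int (Suc k)) * ?u k) = 0"
      by (simp add: sum_less_4 ambient_coords_def algebra_simps tpow_simps)
    show "(\<Sum>k<4. ?f k) = 0"
      by (simp add: sum_less_4 ambient_form_def)
    show "(\<Sum>k<4. J_mat 4 $$ (i, k) * ?f k) = (1 + tpow 1) * laurent_bar (?u i)" if "i < 4" for i
      using less_4_cases[OF that]
      by (elim disjE; simp add: sum_less_4 J_mat_def ambient_form_def ambient_coords_def laurent_bar_simps)
        (simp_all add: algebra_simps tpow_simps)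
    show "map_mat laurent_at_one (reflection 4 ?u ?f) \<in> permutation_mats 4"
      by (rule ambient_at_one[OF at_one])
  qed
  moreover have "reflection 4 ?u ?f * w_mat 4 = w_mat 4 * root_reflection x y z"
  proof (rule eq_matI)
    fix i j assume "i < dim_row (w_mat 4 * root_reflection x y z)" "j < dim_col (w_mat 4 * root_reflection x y z)"
    then have ij: "i < 4" "j < 3" using w_mat_carrier by (auto simp: root_reflection_def reflection_def)
    have "(\<Sum>k<4. ?f k * w_mat 4 $$ (k, j)) = root_form x y z j"
      using less_3_cases[OF ij(2)]
      by (elim disjE; simp add: sum_less_4 w_mat_entry w_vec_def ambient_form_def root_form_def)
        (simp_all add: algebra_simps tpow_simps)
    moreover have "(\<Sum>k<3. w_mat 4 $$ (i, k) * root_coords x y z k) = ?u i"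
      using less_4_cases[OF ij(1)]
      by (elim disjE; simp add: sum_less_3 w_mat_entry w_vec_def ambient_coords_def root_coords_def)
        (simp_all add: algebra_simps tpow_simps)
    ultimately show "(reflection 4 ?u ?f * w_mat 4) $$ (i, j) = (w_mat 4 * root_reflection x y z) $$ (i, j)"
      unfolding root_reflection_def using ij w_mat_carrier
      by (subst reflection_mult_right, simp_all, subst reflection_mult_left, simp_all)
  qed (use w_mat_carrier in \<open>auto simp: root_reflection_def reflection_def\<close>)
  moreover have "root_reflection x y z \<in> carrier (GL (4 - 1))"
    using reflection_GL[OF norm] by (simp add: root_reflection_def)
  ultimately show ?thesis unfolding Gamma'_def by blast
qed

lemma reduced_burau_gen_reflection:
  "reduced_burau_gen 4 1 = root_reflection 1 0 0"
  "reduced_burau_gen 4 2 = root_reflection 0 1 0"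
  "reduced_burau_gen 4 3 = root_reflection 0 0 1"
proof -
  have entries: "reduced_burau_gen 4 1 $$ (r, c) = root_reflection 1 0 0 $$ (r, c)"
    "reduced_burau_gen 4 2 $$ (r, c) = root_reflection 0 1 0 $$ (r, c)"
    "reduced_burau_gen 4 3 $$ (r, c) = root_reflection 0 0 1 $$ (r, c)" if "r < 3" "c < 3" for r c
    using less_3_cases[OF that(1)] less_3_cases[OF that(2)]
    by (elim disjE; simp add: reduced_burau_gen_def root_reflection_def reflection_def
      root_coords_def root_form_def laurent_bar_simps)+
  have root_dims: "dim_row (root_reflection x y z) = 3" "dim_col (root_reflection x y z) = 3"
    "dim_row (reduced_burau_gen 4 i) = 3" "dim_col (reduced_burau_gen 4 i) = 3" for x y z i
    by (simp_all add: root_reflection_def reflection_def reduced_burau_gen_def)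
  show "reduced_burau_gen 4 1 = root_reflection 1 0 0"
  "reduced_burau_gen 4 2 = root_reflection 0 1 0"
  "reduced_burau_gen 4 3 = root_reflection 0 0 1"
    by (rule eq_matI; use entries in \<open>simp_all add: root_dims\<close>)+
qed

lemma reduced_burau_gen_Gamma':
  assumes "i \<in> {1, 2, 3}"
  shows "reduced_burau_gen 4 i \<in> Gamma' 4"
proof -
  have "root_reflection 1 0 0 \<in> Gamma' 4" "root_reflection 0 1 0 \<in> Gamma' 4" "root_reflection 0 0 1 \<in> Gamma' 4"
    by (rule root_reflection_Gamma';
        simp add: sum_less_3 root_form_def root_coords_def laurent_bar_simps laurent_at_one_simps)+
  with assms show ?thesis by (auto simp: reduced_burau_gen_reflection simp del: One_nat_def)
qed


section \<open>A reflection outside the image\<close>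

text \<open>On the plane fixed by $\sigma_3$ the form becomes $1 + t$ times diag$(1, t + t^{-1})$, which reduces the
choice of a root to a norm equation.\<close>

lemma plane_root_norm:
  "(\<Sum>k<3. root_form (a + b) ((1 + tpow 1) * b) (tpow 1 * b) k * root_coords (a + b) ((1 + tpow 1) * b) (tpow 1 * b) k) =
   (1 + tpow 1) * (a * laurent_bar a + (tpow 1 + tpow (- 1)) * (b * laurent_bar b))"
  by (simp add: sum_less_3 root_form_def root_coords_def laurent_bar_simps)
    (simp add: algebra_simps tpow_simps)

text \<open>A solution of $a \bar a + (t + t^{-1}) b \bar b = 1$ (see \<open>alpha_beta_norm\<close>) in which the leading coefficients
of $a$ and $b$ are not units. In terms of $d = t + t^{-1}$ it has $a = 1 + 2d(d - 2)$ and
$b \bar b = 4(2 - d)(d - 1)^2$.\<close>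

definition alpha :: laurent where
  "alpha = 2 * tpow 2 - 4 * tpow 1 + 5 - 4 * tpow (- 1) + 2 * tpow (- 2)"

definition beta :: laurent where
  "beta = 2 * tpow 2 - 4 * tpow 1 + 4 - 2 * tpow (- 1)"

lemma laurent_bar_alpha: "laurent_bar alpha = alpha"
  by (simp add: alpha_def laurent_bar_simps)

lemma alpha_beta_norm: "alpha * laurent_bar alpha + (tpow 1 + tpow (- 1)) * (beta * laurent_bar beta) = 1"
proof -
  have aa: "alpha * alpha = 4 * tpow 4 - 16 * tpow 3 + 36 * tpow 2 - 56 * tpow 1 + 65 - 56 * tpow (- 1)
      + 36 * tpow (- 2) - 16 * tpow (- 3) + 4 * tpow (- 4)"
    by (simp add: alpha_def algebra_simps tpow_simps)
  have bb: "beta * laurent_bar beta = 40 - 32 * tpow 1 - 32 * tpow (- 1) + 16 * tpow 2 + 16 * tpow (- 2) 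
     - 4 * tpow 3 - 4 * tpow (- 3)"
    by (simp add: beta_def laurent_bar_simps) (simp add: algebra_simps tpow_simps)
  show ?thesis
    unfolding laurent_bar_alpha aa bb by (simp add: algebra_simps tpow_simps)
qed

text \<open>The coefficient of $w_1$ in the image of $w_1$ under the extra element.\<close>

lemma extra_element_corner_expansion: "1 - (1 + tpow 1) * (alpha * alpha) = -4 * tpow 5 + 12 * tpow 4 - 20 * tpow 3 + 20 * tpow 2
   - 9 * tpow 1 - 8 + 20 * tpow (- 1) - 20 * tpow (- 2) + 12 * tpow (- 3) - 4 * tpow (- 4)"
  by (simp add: alpha_def algebra_simps tpow_simps)

lemma lookup_numeral_mult:
  "Poly_Mapping.lookup (numeral c * f :: laurent) k = numeral c * Poly_Mapping.lookup f k"
proof -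
  have "Poly_Mapping.lookup (of_nat m * f :: laurent) k = int m * Poly_Mapping.lookup f k" for m
    by (induction m) (simp_all add: distrib_right lookup_add)
  from this[of "numeral c"] show ?thesis by simp
qed

text \<open>The coefficients of the product in degrees at least $5$ above that of $f$ are $-4$ times coefficients of $f$.\<close>

lemma not_leading_multiple:
  assumes "\<bar>s\<bar> = 1"
  shows "\<not> leading n s (f * (1 - (1 + tpow 1) * (alpha * alpha)))"
proof
  assume lead: "leading n s (f * (1 - (1 + tpow 1) * (alpha * alpha)))"
  have expand: "f * (1 - (1 + tpow 1) * (alpha * alpha)) = - (4 * (tpow 5 * f)) + 12 * (tpow 4 * f) - 20 * (tpow 3 * f)
      + 20 * (tpow 2 * f) - 9 * (tpow 1 * f) - 8 * f + 20 * (tpow (- 1) * f) - 20 * (tpow (- 2) * f)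
      + 12 * (tpow (- 3) * f) - 4 * (tpow (- 4) * f)"
    unfolding extra_element_corner_expansion by (simp add: algebra_simps)
  have "f \<noteq> 0" using lead assms by (auto simp: leading_def)
  define d where "d = Max (Poly_Mapping.keys f)"
  have d: "Poly_Mapping.lookup f d \<noteq> 0" "\<And>k. d < k \<Longrightarrow> Poly_Mapping.lookup f k = 0"
  proof -
    have "d \<in> Poly_Mapping.keys f" unfolding d_def using \<open>f \<noteq> 0\<close> by (intro Max_in) auto
    then show "Poly_Mapping.lookup f d \<noteq> 0" by (simp add: in_keys_iff)
    show "Poly_Mapping.lookup f k = 0" if "d < k" for k
    proof (rule ccontr)
      assume "Poly_Mapping.lookup f k \<noteq> 0"
      then have "k \<le> d" unfolding d_def by (intro Max_ge) (simp_all add: in_keys_iff)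
      with that show False by simp
    qed
  qed
  have top: "Poly_Mapping.lookup (f * (1 - (1 + tpow 1) * (alpha * alpha))) k = - 4 * Poly_Mapping.lookup f (k - 5)"
    if "d + 5 \<le> k" for k
    unfolding expand using that
    by (simp add: lookup_add lookup_minus lookup_numeral_mult lookup_tpow_mult d(2))
  show False
  proof (cases "n < d + 5")
    case True
    then have "Poly_Mapping.lookup (f * (1 - (1 + tpow 1) * (alpha * alpha))) (d + 5) = 0"
      using lead by (simp add: leading_def)
    then show False using top[of "d + 5"] d(1) by simp
  next
    case False
    then have "s = - 4 * Poly_Mapping.lookup f (n - 5)"
      using lead top[of n] by (simp add: leading_def)
    then show False using assms by (simp add: abs_mult) presburger
  qed
qed

lemma reflections_commute:
  assumes "(\<Sum>k<n. f k * u' k) = 0" "(\<Sum>k<n. f' k * u k) = 0"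
  shows "reflection n u f * reflection n u' f' = reflection n u' f' * reflection n u f"
proof -
  have prod: "(reflection n v g * reflection n v' g') $$ (i, j) =
      (if i = j then 1 else 0) - v' i * g' j - v i * g j"
    if "i < n" "j < n" "(\<Sum>k<n. g k * v' k) = 0" for v g v' g' i j
  proof -
    have "(\<Sum>k<n. g k * reflection n v' g' $$ (k, j)) = (\<Sum>k<n. (if k = j then g k else 0) - g k * v' k * g' j)"
      using that(2) by (intro sum.cong) (auto simp: reflection_def algebra_simps)
    also have "\<dots> = g j"
      using that(2,3) by (simp add: sum_subtractf sum_distrib_right[symmetric])
    finally show ?thesis using that(1,2)
      by (subst reflection_mult_right) (auto simp: reflection_def)
  qed
  show ?thesis
  proof (rule eq_matI)
    fix i j assume "i < dim_row (reflection n u' f' * reflection n u f)"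
      "j < dim_col (reflection n u' f' * reflection n u f)"
    then have ij: "i < n" "j < n" by (auto simp: reflection_def)
    show "(reflection n u f * reflection n u' f') $$ (i, j) = (reflection n u' f' * reflection n u f) $$ (i, j)"
      unfolding prod[OF ij assms(1)] prod[OF ij assms(2)] by simp
  qed (simp_all add: reflection_def)
qed

text \<open>A matrix commuting with a reflection maps the root to a multiple of itself. The three roots form a basis whose
neighbours are not orthogonal, so the multiples agree.\<close>

lemma commuting_scalar:
  assumes Z: "Z \<in> carrier_mat 3 3"
    and comm: "\<And>i. i \<in> {1, 2, 3} \<Longrightarrow> Z * reduced_burau_gen 4 i = reduced_burau_gen 4 i * Z"
  shows "\<exists>c. Z = c \<cdot>\<^sub>m 1\<^sub>m 3"
proof -
  have eq: "root_coords x y z r * (\<Sum>k<3. root_form x y z k * Z $$ (k, j)) =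
      (\<Sum>k<3. Z $$ (r, k) * root_coords x y z k) * root_form x y z j"
    if "Z * root_reflection x y z = root_reflection x y z * Z" "r < 3" "j < 3" for x y z r j
  proof -
    have "(Z * root_reflection x y z) $$ (r, j) = (root_reflection x y z * Z) $$ (r, j)" by (simp only: that(1))
    then show ?thesis unfolding root_reflection_def
      using Z that(2,3) by (simp add: reflection_mult_left reflection_mult_right)
  qed
  note eqs = eq[OF comm[of 1, unfolded reduced_burau_gen_reflection]]
    eq[OF comm[of 2, unfolded reduced_burau_gen_reflection]]
    eq[OF comm[of 3, unfolded reduced_burau_gen_reflection]]
  note simps = sum_less_3 root_coords_def root_form_def laurent_bar_simps
  have t: "tpow 1 \<noteq> 0"
    using lookup_tpow[of 1 1] by auto
  have offdiag: "Z $$ (1, 0) = 0" "Z $$ (2, 0) = 0" "Z $$ (0, 1) = 0" "Z $$ (2, 1) = 0"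
    "Z $$ (0, 2) = 0" "Z $$ (1, 2) = 0"
    using eqs(1)[of 1 1] eqs(1)[of 2 1] eqs(2)[of 0 0] eqs(2)[of 2 0] eqs(3)[of 0 1] eqs(3)[of 1 1] t
    by (simp_all add: simps)
  have diag: "Z $$ (1, 1) = Z $$ (0, 0)" "Z $$ (2, 2) = Z $$ (0, 0)"
    using eqs(2)[of 1 0] eqs(2)[of 1 2] t offdiag by (simp_all add: simps)
  have "Z = Z $$ (0, 0) \<cdot>\<^sub>m 1\<^sub>m 3"
  proof (rule eq_matI)
    fix i j assume "i < dim_row (Z $$ (0, 0) \<cdot>\<^sub>m 1\<^sub>m 3)" "j < dim_col (Z $$ (0, 0) \<cdot>\<^sub>m 1\<^sub>m 3)"
    then have "i < 3" "j < 3" by auto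
    then show "Z $$ (i, j) = (Z $$ (0, 0) \<cdot>\<^sub>m 1\<^sub>m 3) $$ (i, j)"
      using less_3_cases[OF \<open>i < 3\<close>] less_3_cases[OF \<open>j < 3\<close>] offdiag diag by auto
  qed (use Z in auto)
  then show ?thesis by blast
qed

lemma one_Gamma': "1\<^sub>m 3 \<in> Gamma' 4"
proof -
  have GL: "1\<^sub>m n \<in> carrier (GL n)" for n
    using monoid.one_closed[OF group.is_monoid[OF GL_group], of n] by simp
  have J: "J_mat 4 \<in> carrier_mat 4 4" by (simp add: J_mat_def)
  have "map_mat laurent_bar (1\<^sub>m 4) = 1\<^sub>m 4"
    by (rule eq_matI) (auto simp: laurent_bar_simps)
  moreover have "map_mat laurent_at_one (1\<^sub>m 4) = mat 4 4 (\<lambda>(r, c). if r = id c then 1 else 0)"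
    by (rule eq_matI) (auto simp: laurent_at_one_simps)
  then have "map_mat laurent_at_one (1\<^sub>m 4) \<in> permutation_mats 4"
    unfolding permutation_mats_def using permutes_id[of "{..<4}"] by blast
  moreover have "v_vec 4 \<in> carrier_vec 4" "ones_vec 4 \<in> carrier_vec 4"
    by (simp_all add: v_vec_def ones_vec_def)
  ultimately have "1\<^sub>m 4 \<in> Gamma 4"
    unfolding Gamma_def using GL J by simp
  moreover have "1\<^sub>m 4 * w_mat 4 = w_mat 4 * 1\<^sub>m 3" using w_mat_carrier by simp
  ultimately show ?thesis unfolding Gamma'_def using GL[of 3] by auto
qed

definition extra_element :: "laurent mat" where
  "extra_element = root_reflection (alpha + beta) ((1 + tpow 1) * beta) (tpow 1 * beta)"

lemma extra_element_Gamma': "extra_element \<in> Gamma' 4"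
  unfolding extra_element_def
proof (rule root_reflection_Gamma')
  show "(\<Sum>k<3. root_form (alpha + beta) ((1 + tpow 1) * beta) (tpow 1 * beta) k *
      root_coords (alpha + beta) ((1 + tpow 1) * beta) (tpow 1 * beta) k) = 1 + tpow 1"
    by (simp only: plane_root_norm alpha_beta_norm mult_1_right)
  show "(laurent_at_one (alpha + beta), laurent_at_one ((1 + tpow 1) * beta), laurent_at_one (tpow 1 * beta))
      \<in> {(1, 0, 0), (0, 1, 0), (0, 0, 1)}"
    by (simp add: alpha_def beta_def laurent_at_one_simps)
qed

lemma extra_element_commutes:
  "extra_element * reduced_burau_gen 4 3 = reduced_burau_gen 4 3 * extra_element"
  unfolding extra_element_def reduced_burau_gen_reflection root_reflection_def
  by (rule reflections_commute)
    (simp_all add: sum_less_3 root_form_def root_coords_def laurent_bar_simps algebra_simps tpow_simps)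

lemma extra_element_first_column:
  "extra_element *\<^sub>v vec3 1 0 0 =
     vec3 (1 - (alpha + beta) * ((1 + tpow 1) * alpha)) (- ((1 + tpow 1) * beta * ((1 + tpow 1) * alpha)))
       (tpow 1 * - (beta * ((1 + tpow 1) * alpha)))"
proof -
  have form: "root_form (alpha + beta) ((1 + tpow 1) * beta) (tpow 1 * beta) 0 = (1 + tpow 1) * alpha"
    by (simp add: root_form_def laurent_bar_simps laurent_bar_alpha) (simp add: algebra_simps tpow_simps)
  show ?thesis
  proof (rule eq_vecI)
    fix i assume "i < dim_vec (vec3 (1 - (alpha + beta) * ((1 + tpow 1) * alpha))
      (- ((1 + tpow 1) * beta * ((1 + tpow 1) * alpha))) (tpow 1 * - (beta * ((1 + tpow 1) * alpha))))"
    then have i: "i < 3" by (simp add: vec3_def)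
    have "(extra_element *\<^sub>v vec3 1 0 0) $ i = (\<Sum>k<3. extra_element $$ (i, k) * [1, 0, 0] ! k)"
      using i by (simp add: extra_element_def root_reflection_def reflection_def vec3_def scalar_prod_def
          lessThan_atLeast0)
    also have "\<dots> = extra_element $$ (i, 0)" by (simp add: sum_less_3)
    also have "\<dots> = (if i = 0 then 1 else 0) -
        root_coords (alpha + beta) ((1 + tpow 1) * beta) (tpow 1 * beta) i * ((1 + tpow 1) * alpha)"
      using i by (simp add: extra_element_def root_reflection_def reflection_def form)
    finally show "(extra_element *\<^sub>v vec3 1 0 0) $ i = vec3 (1 - (alpha + beta) * ((1 + tpow 1) * alpha))
      (- ((1 + tpow 1) * beta * ((1 + tpow 1) * alpha))) (tpow 1 * - (beta * ((1 + tpow 1) * alpha))) $ i"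
      using less_3_cases[OF i] by (elim disjE; simp add: root_coords_def vec3_def mult.assoc)
  qed (simp add: extra_element_def root_reflection_def reflection_def vec3_def)
qed

text \<open>By faithfulness a braid whose Burau matrix is a multiple of the extra element commutes with $\sigma_3$.\<close>

lemma extra_element_not_burau:
  assumes inj: "inj_on (reduced_burau 4) (carrier (braid_group 4))"
  shows "burau x \<noteq> c \<cdot>\<^sub>m extra_element"
proof
  assume x: "burau x = c \<cdot>\<^sub>m extra_element"
  have A: "extra_element \<in> carrier_mat 3 3" "reduced_burau_gen 4 3 \<in> carrier_mat 3 3"
    using reduced_burau_gen_carrier[of 4 3]
    by (simp_all add: extra_element_def root_reflection_def reflection_carrier)
  have sigma3: "burau sigma3 = reduced_burau_gen 4 3" by (simp add: sigma3_def burau_braid_sigma)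
  have "burau (x + sigma3) = burau (sigma3 + x)"
    by (simp add: burau_add x sigma3 mult_smult_assoc_mat[OF A] mult_smult_distrib[OF A(2,1)]
        extra_element_commutes)
  then have "Rep_braid4 (x + sigma3) = Rep_braid4 (sigma3 + x)"
    unfolding burau_def by (rule inj_onD[OF inj]) (rule Rep_braid4)+
  then have "x + sigma3 = sigma3 + x" by (simp only: Rep_braid4_inject)
  moreover have "burau x *\<^sub>v vec3 1 0 0 = vec3 (c * (1 - (alpha + beta) * ((1 + tpow 1) * alpha)))
      (c * (- ((1 + tpow 1) * beta * ((1 + tpow 1) * alpha)))) (tpow 1 * (c * - (beta * ((1 + tpow 1) * alpha))))"
  proof -
    have "burau x *\<^sub>v vec3 1 0 0 = c \<cdot>\<^sub>v (extra_element *\<^sub>v vec3 1 0 0)"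
      unfolding x using A(1) vec3_carrier[of 1 0 0] by (intro eq_vecI) auto
    also have "\<dots> = vec3 (c * (1 - (alpha + beta) * ((1 + tpow 1) * alpha)))
      (c * (- ((1 + tpow 1) * beta * ((1 + tpow 1) * alpha)))) (tpow 1 * (c * - (beta * ((1 + tpow 1) * alpha))))"
      unfolding extra_element_first_column
      by (rule eq_vecI) (auto simp: vec3_def ac_simps dest!: less_3_cases)
    finally show ?thesis .
  qed
  ultimately have "\<exists>n s. \<bar>s\<bar> = 1 \<and> leading n s (c * (1 - (alpha + beta) * ((1 + tpow 1) * alpha)) -
      c * - (beta * ((1 + tpow 1) * alpha)))"
    by (rule centralizer_leading)
  also have "c * (1 - (alpha + beta) * ((1 + tpow 1) * alpha)) - c * - (beta * ((1 + tpow 1) * alpha)) =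
      c * (1 - (1 + tpow 1) * (alpha * alpha))"
    by (simp add: algebra_simps)
  finally show False using not_leading_multiple by blast
qed

lemma scalar_unit:
  assumes "c \<cdot>\<^sub>m 1\<^sub>m 3 \<in> carrier (GL 3)"
  shows "\<exists>d. d * c = 1"
proof -
  obtain B where B: "B \<in> carrier_mat 3 3" "B * (c \<cdot>\<^sub>m 1\<^sub>m 3) = 1\<^sub>m 3"
    using assms by (auto simp: GL_carrier)
  have "c \<cdot>\<^sub>m B = 1\<^sub>m 3" using B by (simp add: mult_smult_distrib[OF B(1) one_carrier_mat])
  then have "(c \<cdot>\<^sub>m B) $$ (0, 0) = 1\<^sub>m 3 $$ (0, 0)" by simp
  then have "B $$ (0, 0) * c = 1" using B(1) by (simp add: mult.commute)
  then show ?thesis by blast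
qed

theorem theorem1p2:
  assumes "inj_on (reduced_burau 4) (carrier (braid_group 4))"
  shows "\<exists>A \<in> carrier (Gamma'_bar 4).
    A \<otimes>\<^bsub>Gamma'_bar 4\<^esub> reduced_burau_bar 4 (braid_gen 4 3) =
      reduced_burau_bar 4 (braid_gen 4 3) \<otimes>\<^bsub>Gamma'_bar 4\<^esub> A \<and>
    A \<notin> reduced_burau_bar 4 ` carrier (braid_group 4)"
proof -
  let ?G = "Gamma'_group 4" and ?Z = "center (Gamma'_group 4)" and ?S = "reduced_burau_gen 4 3"
  let ?A = "?Z #>\<^bsub>?G\<^esub> extra_element"
  have G: "carrier ?G = Gamma' 4" "x \<otimes>\<^bsub>?G\<^esub> y = x * y" for x y
    by (simp_all add: Gamma'_group_def)
  have carrier: "x \<in> carrier_mat 3 3" if "x \<in> Gamma' 4" for x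
    using that by (auto simp: Gamma'_def GL_carrier)
  have Z: "z \<in> Gamma' 4" "x \<in> Gamma' 4 \<Longrightarrow> z * x = x * z" if "z \<in> ?Z" for z x
    using that by (auto simp: center_def G)
  have coset: "?Z #>\<^bsub>?G\<^esub> x = {z * x | z. z \<in> ?Z}" for x
    by (auto simp: r_coset_def G)
  have S: "?S \<in> Gamma' 4" by (rule reduced_burau_gen_Gamma') simp
  have product: "(?Z #>\<^bsub>?G\<^esub> x) <#>\<^bsub>?G\<^esub> (?Z #>\<^bsub>?G\<^esub> y) = {z * z' * (x * y) | z z'. z \<in> ?Z \<and> z' \<in> ?Z}"
    if "x \<in> Gamma' 4" "y \<in> Gamma' 4" for x y
  proof -
    \<comment> \<open>the product of cosets is computed on elements by moving the second central factor past x\<close>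
    have rearrange: "(z * x) * (z' * y) = z * z' * (x * y)" if z: "z \<in> ?Z" "z' \<in> ?Z" for z z'
    proof -
      have c: "z \<in> carrier_mat 3 3" "z' \<in> carrier_mat 3 3" "x \<in> carrier_mat 3 3" "y \<in> carrier_mat 3 3"
        using z Z carrier \<open>x \<in> Gamma' 4\<close> \<open>y \<in> Gamma' 4\<close> by auto
      have "(z * x) * (z' * y) = z * ((x * z') * y)"
        using c by (simp add: assoc_mult_mat[of _ 3 3 _ 3 _ 3])
      also have "x * z' = z' * x" using Z(2)[OF z(2) \<open>x \<in> Gamma' 4\<close>] by simp
      finally show ?thesis using c by (simp add: assoc_mult_mat[of _ 3 3 _ 3 _ 3])
    qed
    have "(?Z #>\<^bsub>?G\<^esub> x) <#>\<^bsub>?G\<^esub> (?Z #>\<^bsub>?G\<^esub> y) =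
        {(z * x) * (z' * y) | z z'. z \<in> ?Z \<and> z' \<in> ?Z}"
      unfolding coset set_mult_def G(2) by blast
    also have "\<dots> = {z * z' * (x * y) | z z'. z \<in> ?Z \<and> z' \<in> ?Z}"
      by (rule Collect_cong) (metis rearrange)
    finally show ?thesis .
  qed
  have bar_S: "reduced_burau_bar 4 (braid_gen 4 3) = ?Z #>\<^bsub>?G\<^esub> ?S"
    by (simp add: reduced_burau_bar_def reduced_burau_braid_gen)
  have "?A \<in> carrier (Gamma'_bar 4)"
    using extra_element_Gamma' by (auto simp: Gamma'_bar_def FactGroup_def RCOSETS_def G)
  moreover have "?A \<otimes>\<^bsub>Gamma'_bar 4\<^esub> reduced_burau_bar 4 (braid_gen 4 3) =
      reduced_burau_bar 4 (braid_gen 4 3) \<otimes>\<^bsub>Gamma'_bar 4\<^esub> ?A"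
    unfolding bar_S Gamma'_bar_def
    by (simp add: FactGroup_def product extra_element_Gamma' S extra_element_commutes)
  moreover have "?A \<notin> reduced_burau_bar 4 ` carrier (braid_group 4)"
  proof
    assume "?A \<in> reduced_burau_bar 4 ` carrier (braid_group 4)"
    then obtain X where X: "X \<in> carrier (braid_group 4)" "?A = ?Z #>\<^bsub>?G\<^esub> reduced_burau 4 X"
      by (auto simp: reduced_burau_bar_def)
    define x where "x = Abs_braid4 X"
    have x: "reduced_burau 4 X = burau x" by (simp add: x_def burau_def Abs_braid4_inverse X(1))
    have "1\<^sub>m 3 * y = y * 1\<^sub>m 3" if "y \<in> Gamma' 4" for y
      using left_mult_one_mat[OF carrier[OF that]] right_mult_one_mat[OF carrier[OF that]] by simp
    then have "1\<^sub>m 3 \<in> ?Z" using one_Gamma' by (simp add: center_def G)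
    moreover have "extra_element = 1\<^sub>m 3 * extra_element"
      using left_mult_one_mat[OF carrier[OF extra_element_Gamma']] by simp
    ultimately have "extra_element \<in> ?A" unfolding coset by blast
    then have "extra_element \<in> ?Z #>\<^bsub>?G\<^esub> burau x" by (simp only: X(2) x)
    then obtain z where z: "z \<in> ?Z" "extra_element = z * burau x"
      unfolding coset by blast
    have "\<exists>c. z = c \<cdot>\<^sub>m 1\<^sub>m 3"
      by (rule commuting_scalar[OF carrier[OF Z(1)[OF z(1)]] Z(2)[OF z(1) reduced_burau_gen_Gamma']])
    then obtain c where c: "z = c \<cdot>\<^sub>m 1\<^sub>m 3" by blast
    have "z \<in> carrier (GL 3)" using Z(1)[OF z(1)] by (simp add: Gamma'_def)
    then obtain d where d: "d * c = 1" using scalar_unit c by blast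
    have "extra_element = c \<cdot>\<^sub>m burau x"
      using z(2) burau_carrier[of x] by (simp add: c mult_smult_assoc_mat[OF one_carrier_mat burau_carrier])
    then have "d \<cdot>\<^sub>m extra_element = d \<cdot>\<^sub>m (c \<cdot>\<^sub>m burau x)" by (rule arg_cong)
    also have "\<dots> = (d * c) \<cdot>\<^sub>m burau x"
      by (intro eq_matI) (simp_all add: mult.assoc)
    also have "\<dots> = burau x" by (rule eq_matI) (simp_all add: d)
    finally show False using extra_element_not_burau[OF assms] by metis
  qed
  ultimately show ?thesis by blast
qed

end
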